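(* Assume Gap-ETH holds, and let $\gamma>0$ be the constant it provides. Then there is no polynomial-time $\left(1+\frac{\gamma}{10}\right)$-approximation algorithm for correlation clustering with same-cluster queries that uses $o(C_{OPT})$ queries to the oracle.
   Context: Correlation clustering: the input is a complete graph on $N$ vertices in which every edge is labeled $+$ or $-$. A clustering is a partition of the vertices; it makes a mistake on a $+$ edge whose endpoints are in different clusters and on a $-$ edge whose endpoints are in the same cluster. $C_{OPT}$ is the minimum number of mistakes over all clusterings. In the same-cluster query model the algorithm may query an oracle that knows a fixed optimal clustering $OPT$: on a query $\{u,v\}$ it answers whether $OPT$ puts $u$ and $v$ in the same cluster. A $\beta$-approximation algorithm outputs a clustering with at most $\beta C_{OPT}$ mistakes. Gap-ETH: there is an absolute constant $\gamma>0$ such that any algorithm that, given a 3-SAT instance with $n$ variables and $m$ clauses, distinguishes between (i) the instance is satisfiable and (ii) fewer than $(1-\gamma)m$ of the clauses are simultaneously satisfiable, must take time at least $2^{\Omega(m)}$. *)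

theory Defs
  imports Complex_Main "HOL-Library.Disjoint_Sets" "HOL-Computational_Algebra.Polynomial"
begin

section \<open>Model of computation\<close>

text \<open>
  Algorithms are programs of the WHILE language of N. D. Jones (\<^emph>\<open>Computability and
  Complexity: From a Programming Perspective\<close>) over binary trees, extended by an oracle
  instruction. Every elementary instruction costs one unit (the size of an expression is a
  constant of the program). Trees are only inspected through head, tail and the test for
  being a leaf, so with shared subtrees each step is implementable in constant time: the
  language and Turing machines simulate each other with polynomial overhead, and neither
  "polynomial time" nor "time at least 2 to the Omega(m)" depends on the choice between them.
\<close>

datatype tree = Leaf | Node tree tree

type_synonym state = "nat \<Rightarrow> tree"

datatype expr = Var nat | Lf | Pair expr expr | Hd expr | Tl expr

fun head :: "tree \<Rightarrow> tree" where
  "head Leaf = Leaf"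
| "head (Node a b) = a"

fun tail :: "tree \<Rightarrow> tree" where
  "tail Leaf = Leaf"
| "tail (Node a b) = b"

primrec eval_expr :: "expr \<Rightarrow> state \<Rightarrow> tree" where
  "eval_expr (Var x) s = s x"
| "eval_expr Lf s = Leaf"
| "eval_expr (Pair a b) s = Node (eval_expr a s) (eval_expr b s)"
| "eval_expr (Hd a) s = head (eval_expr a s)"
| "eval_expr (Tl a) s = tail (eval_expr a s)"

text \<open>Lists are right spines; a number is a list of that many leaves (unary).\<close>

primrec enc_list :: "('a \<Rightarrow> tree) \<Rightarrow> 'a list \<Rightarrow> tree" where
  "enc_list f [] = Leaf"
| "enc_list f (x # xs) = Node (f x) (enc_list f xs)"

primrec dec_list :: "tree \<Rightarrow> tree list" where
  "dec_list Leaf = []"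
| "dec_list (Node a b) = a # dec_list b"

definition enc_nat :: "nat \<Rightarrow> tree" where
  "enc_nat n = enc_list (\<lambda>_. Leaf) (replicate n ())"

definition dec_nat :: "tree \<Rightarrow> nat" where
  "dec_nat t = length (dec_list t)"

definition enc_bool :: "bool \<Rightarrow> tree" where
  "enc_bool b = (if b then Node Leaf Leaf else Leaf)"

datatype prog =
    Skip
  | Assign nat expr
  | Seq prog prog
  | Cond expr prog prog
  | While expr prog
  | Query nat expr expr  \<comment> \<open>\<open>Query x a b\<close> stores the oracle's answer on the numbers \<open>a\<close>, \<open>b\<close> in \<open>x\<close>\<close>

text \<open>\<open>exec orc P s t q s'\<close>: with oracle \<open>orc\<close>, the program \<open>P\<close> started in \<open>s\<close> halts in \<open>s'\<close>
  after \<open>t\<close> steps and \<open>q\<close> oracle queries. A tree counts as true iff it is not a leaf.\<close>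

inductive exec :: "(nat \<Rightarrow> nat \<Rightarrow> bool) \<Rightarrow> prog \<Rightarrow> state \<Rightarrow> nat \<Rightarrow> nat \<Rightarrow> state \<Rightarrow> bool"
  for orc :: "nat \<Rightarrow> nat \<Rightarrow> bool" where
  Skip: "exec orc Skip s 1 0 s"
| Assign: "exec orc (Assign x a) s 1 0 (s(x := eval_expr a s))"
| Seq: "exec orc P s t q s' \<Longrightarrow> exec orc Q s' t' q' s'' \<Longrightarrow>
    exec orc (Seq P Q) s (t + t') (q + q') s''"
| CondTrue: "eval_expr b s \<noteq> Leaf \<Longrightarrow> exec orc P s t q s' \<Longrightarrow>
    exec orc (Cond b P Q) s (1 + t) q s'"
| CondFalse: "eval_expr b s = Leaf \<Longrightarrow> exec orc Q s t q s' \<Longrightarrow>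
    exec orc (Cond b P Q) s (1 + t) q s'"
| WhileFalse: "eval_expr b s = Leaf \<Longrightarrow> exec orc (While b P) s 1 0 s"
| WhileTrue: "eval_expr b s \<noteq> Leaf \<Longrightarrow> exec orc P s t q s' \<Longrightarrow>
    exec orc (While b P) s' t' q' s'' \<Longrightarrow>
    exec orc (While b P) s (1 + t + t') (q + q') s''"
| Query: "exec orc (Query x a b) s 1 1
    (s(x := enc_bool (orc (dec_nat (eval_expr a s)) (dec_nat (eval_expr b s)))))"

inductive_cases SkipE: "exec orc Skip s t q s'"
inductive_cases AssignE: "exec orc (Assign x a) s t q s'"
inductive_cases SeqE: "exec orc (Seq P Q) s t q s'"
inductive_cases CondE: "exec orc (Cond b P Q) s t q s'"
inductive_cases WhileE: "exec orc (While b P) s t q s'"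
inductive_cases QueryE: "exec orc (Query x a b) s t q s'"

text \<open>Runs are unique, so the separate existential statements about runs below all concern
  the same run.\<close>

lemma exec_deterministic:
  assumes "exec orc P s t q s'" and "exec orc P s u r s''"
  shows "u = t \<and> r = q \<and> s'' = s'"
  using assms
proof (induction arbitrary: u r s'')
  case (Skip s)
  from Skip.prems show ?case by (rule SkipE) simp
next
  case (Assign x a s)
  from Assign.prems show ?case by (rule AssignE) simp
next
  case (Seq P s t q s' Q t' q' s'')
  from Seq.prems show ?case
    by (rule SeqE) (metis Seq.IH)
next
  case (CondTrue b s P t q s' Q)
  from CondTrue.prems show ?case
    by (rule CondE) (metis plus_1_eq_Suc add_Suc CondTrue.hyps(1) CondTrue.IH)+
next
  case (CondFalse b s Q t q s' P)
  from CondFalse.prems show ?case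
    by (rule CondE) (metis plus_1_eq_Suc add_Suc CondFalse.hyps(1) CondFalse.IH)+
next
  case (WhileFalse b s P)
  from WhileFalse.prems show ?case
    by (rule WhileE) (metis One_nat_def WhileFalse.hyps)+
next
  case (WhileTrue b s P t q s' t' q' s'')
  from WhileTrue.prems show ?case
    by (rule WhileE) (metis plus_1_eq_Suc add_Suc WhileTrue.hyps(1) WhileTrue.IH)+
next
  case (Query x a b s)
  from Query.prems show ?case by (rule QueryE) simp
qed

text \<open>The input is placed in variable 0, and the output is read off from variable 0.\<close>

definition init :: "tree \<Rightarrow> state" where
  "init i = (\<lambda>_. Leaf)(0 := i)"

section \<open>3-SAT and Gap-ETH\<close>

datatype literal = Pos nat | Neg nat

text \<open>A clause has three literals, not necessarily distinct.\<close>

type_synonym clause = "literal \<times> literal \<times> literal"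

type_synonym formula = "clause list"

primrec var_of :: "literal \<Rightarrow> nat" where
  "var_of (Pos x) = x"
| "var_of (Neg x) = x"

fun clause_vars :: "clause \<Rightarrow> nat set" where
  "clause_vars (a, b, c) = {var_of a, var_of b, var_of c}"

primrec sat_literal :: "(nat \<Rightarrow> bool) \<Rightarrow> literal \<Rightarrow> bool" where
  "sat_literal \<sigma> (Pos x) = \<sigma> x"
| "sat_literal \<sigma> (Neg x) = (\<not> \<sigma> x)"

fun sat_clause :: "(nat \<Rightarrow> bool) \<Rightarrow> clause \<Rightarrow> bool" where
  "sat_clause \<sigma> (a, b, c) \<longleftrightarrow> sat_literal \<sigma> a \<or> sat_literal \<sigma> b \<or> sat_literal \<sigma> c"

text \<open>The variables are \<open>0, \<dots>, n - 1\<close> and each of them occurs in some clause. Without the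
  latter, the input size, and hence the running time, would not be controlled by \<open>m\<close> at all,
  and a lower bound in terms of \<open>m\<close> would hold for trivial reasons.\<close>

definition is_3sat :: "nat \<Rightarrow> nat \<Rightarrow> formula \<Rightarrow> bool" where
  "is_3sat n m \<phi> \<longleftrightarrow> length \<phi> = m \<and> (\<Union>c\<in>set \<phi>. clause_vars c) = {..<n}"

definition satisfiable :: "formula \<Rightarrow> bool" where
  "satisfiable \<phi> \<longleftrightarrow> (\<exists>\<sigma>. \<forall>c\<in>set \<phi>. sat_clause \<sigma> c)"

definition num_sat :: "(nat \<Rightarrow> bool) \<Rightarrow> formula \<Rightarrow> nat" where
  "num_sat \<sigma> \<phi> = length (filter (sat_clause \<sigma>) \<phi>)"

primrec enc_literal :: "literal \<Rightarrow> tree" where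
  "enc_literal (Pos x) = Node (enc_bool True) (enc_nat x)"
| "enc_literal (Neg x) = Node (enc_bool False) (enc_nat x)"

fun enc_clause :: "clause \<Rightarrow> tree" where
  "enc_clause (a, b, c) = enc_list enc_literal [a, b, c]"

definition enc_formula :: "formula \<Rightarrow> tree" where
  "enc_formula = enc_list enc_clause"

definition sat_run :: "prog \<Rightarrow> formula \<Rightarrow> nat \<Rightarrow> tree \<Rightarrow> bool" where
  "sat_run P \<phi> t out \<longleftrightarrow>
     (\<exists>s. exec (\<lambda>_ _. False) P (init (enc_formula \<phi>)) t 0 s \<and> out = s 0)"

definition distinguishes :: "real \<Rightarrow> prog \<Rightarrow> bool" where
  "distinguishes \<gamma> P \<longleftrightarrow>
     (\<forall>n m \<phi>. is_3sat n m \<phi> \<longrightarrow>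
        (\<exists>t out. sat_run P \<phi> t out \<and>
           (satisfiable \<phi> \<longrightarrow> out \<noteq> Leaf) \<and>
           ((\<forall>\<sigma>. real (num_sat \<sigma> \<phi>) < (1 - \<gamma>) * real m) \<longrightarrow> out = Leaf)))"

text \<open>The constant hidden in "2 to the Omega(m)" is absolute, i.e. the same for all algorithms.
  The bound is on the worst-case running time, and only required for infinitely many \<open>m\<close>: no
  algorithm takes time less than \<open>2 powr (c * m)\<close> on all instances with sufficiently many
  clauses.\<close>

definition gap_eth :: "real \<Rightarrow> bool" where
  "gap_eth \<gamma> \<longleftrightarrow> \<gamma> > 0 \<and>
     (\<exists>c>0. \<forall>P. distinguishes \<gamma> P \<longrightarrow>
        (\<exists>\<^sub>F m in sequentially. \<exists>n \<phi> t out.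
           is_3sat n m \<phi> \<and> sat_run P \<phi> t out \<and> real t \<ge> 2 powr (c * real m)))"

section \<open>Correlation clustering\<close>

text \<open>An input is a complete graph on \<open>{..<N}\<close> with the set \<open>E\<close> of edges labeled \<open>+\<close>.\<close>

definition complete_edges :: "nat \<Rightarrow> nat set set" where
  "complete_edges N = {e. e \<subseteq> {..<N} \<and> card e = 2}"

definition together :: "nat set set \<Rightarrow> nat set \<Rightarrow> bool" where
  "together C e \<longleftrightarrow> (\<exists>X\<in>C. e \<subseteq> X)"

definition mistakes :: "nat \<Rightarrow> nat set set \<Rightarrow> nat set set \<Rightarrow> nat" where
  "mistakes N E C = card {e \<in> complete_edges N. if e \<in> E then \<not> together C e else together C e}"

definition C_OPT :: "nat \<Rightarrow> nat set set \<Rightarrow> nat" where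
  "C_OPT N E = Min {mistakes N E C | C. partition_on {..<N} C}"

definition optimal :: "nat \<Rightarrow> nat set set \<Rightarrow> nat set set \<Rightarrow> bool" where
  "optimal N E C \<longleftrightarrow> partition_on {..<N} C \<and> mistakes N E C = C_OPT N E"

definition same_cluster :: "nat set set \<Rightarrow> nat \<Rightarrow> nat \<Rightarrow> bool" where
  "same_cluster C u v \<longleftrightarrow> together C {u, v}"

definition enc_graph :: "nat \<Rightarrow> nat set set \<Rightarrow> tree" where
  "enc_graph N E =
     enc_list (enc_list enc_bool) (map (\<lambda>u. map (\<lambda>v. {u, v} \<in> E) [0..<N]) [0..<N])"

text \<open>A clustering is output as a list of \<open>N\<close> numbers, vertices being in the same cluster iff
  their numbers are equal.\<close>

definition outputs_clustering :: "nat \<Rightarrow> tree \<Rightarrow> nat set set \<Rightarrow> bool" where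
  "outputs_clustering N out C \<longleftrightarrow>
     (let l = map dec_nat (dec_list out)
      in length l = N \<and> C = (\<lambda>u. {v. v < N \<and> l ! v = l ! u}) ` {..<N})"

definition cc_run ::
    "prog \<Rightarrow> nat \<Rightarrow> nat set set \<Rightarrow> nat set set \<Rightarrow> nat \<Rightarrow> nat \<Rightarrow> tree \<Rightarrow> bool" where
  "cc_run P N E OPT t q out \<longleftrightarrow>
     (\<exists>s. exec (same_cluster OPT) P (init (enc_graph N E)) t q s \<and> out = s 0)"

definition cc_polynomial_time :: "prog \<Rightarrow> bool" where
  "cc_polynomial_time P \<longleftrightarrow>
     (\<exists>p :: nat poly. \<forall>N E OPT. E \<subseteq> complete_edges N \<longrightarrow> optimal N E OPT \<longrightarrow>
        (\<exists>t q out. cc_run P N E OPT t q out \<and> t \<le> poly p N))"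

definition cc_approximation :: "real \<Rightarrow> prog \<Rightarrow> bool" where
  "cc_approximation \<beta> P \<longleftrightarrow>
     (\<forall>N E OPT. E \<subseteq> complete_edges N \<longrightarrow> optimal N E OPT \<longrightarrow>
        (\<exists>t q out C. cc_run P N E OPT t q out \<and> outputs_clustering N out C \<and>
           real (mistakes N E C) \<le> \<beta> * real (C_OPT N E)))"

text \<open>The number of queries is \<open>o(C_OPT)\<close> as \<open>C_OPT\<close> tends to infinity, uniformly in the
  instance and in the optimal clustering known to the oracle.\<close>

definition cc_little_o_queries :: "prog \<Rightarrow> bool" where
  "cc_little_o_queries P \<longleftrightarrow>
     (\<forall>\<epsilon>>0. \<exists>K. \<forall>N E OPT t q out. E \<subseteq> complete_edges N \<longrightarrow> optimal N E OPT \<longrightarrow>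
        C_OPT N E \<ge> K \<longrightarrow> cc_run P N E OPT t q out \<longrightarrow> real q \<le> \<epsilon> * real (C_OPT N E))"

end

theory Submission
  imports Defs
begin

text \<open>
  Suppose that there is such an algorithm \<open>P\<close>. Given a formula with \<open>m\<close> clauses, we guess the values of
  the at most \<open>3 m / (D + 1)\<close> variables that occur in more than \<open>D\<close> clauses, and turn the clauses
  that are not yet satisfied into a clustering instance. A variable with \<open>d\<close> occurrences becomes a
  \<open>(d + 1) \<times> (d + 1)\<close> grid of cliques, two of which are similar iff they share a row or a column; all
  rows and columns have the same number \<open>R\<close> of vertices. A clause becomes a clique of size \<open>8 R / 15\<close>
  that is similar to one row of each variable occurring positively and to one column of each variable
  occurring negatively. Cutting the grids of the true variables into rows and those of the false ones
  into columns, and attaching each clause to a satisfied literal, yields a clustering whose cost is a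
  certain base value if all clauses are satisfied. Conversely, a cluster structure of a grid that mixes
  rows and columns is expensive, as one sees by summing over the 4-cycles of the grid, and therefore
  every clustering exceeds the base value by \<open>4/15 R\<^sup>2\<close> for each clause that is violated by a suitable
  assignment. The base value is at most \<open>(8 + 77/30 R\<^sup>2) m\<close>, and \<open>77/300 < 4/15\<close>, so for large \<open>R\<close> a
  \<open>(1 + \<gamma>/10)\<close>-approximation separates satisfiable formulas from those in which a fraction \<open>\<gamma>\<close> of
  the clauses is always violated. As the optimum lies between \<open>m\<close> and \<open>O(m)\<close>, the algorithm \<open>P\<close> asks
  only \<open>o(m)\<close> queries, whose answers are guessed as well. Altogether this takes time
  \<open>2\<^sup>\<epsilon>\<^sup>m\<close> times a polynomial for an arbitrarily small \<open>\<epsilon>\<close>, contradicting Gap-ETH.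
\<close>

section \<open>Functions computable in polynomial time\<close>

text \<open>The counting needs every row and column to weigh exactly \<open>R\<close>, so the sizes
  of all grids with attached clauses must divide \<open>R\<close>. For arbitrary numbers of
  occurrences \<open>R\<close> would grow with the formula; once the variables with more than
  \<open>D\<close> occurrences are fixed, the sizes are at most D + 1 and a constant multiple of (D
  + 1)! will do. The instance then has O(m) vertices and an optimum of order m, which turns o(C_OPT)
  queries into o(m) guessed bits.

  Wrong oracle answers cannot do harm, since no trust is put in the simulated run: its output is
  read as a clustering and its mistakes are counted, and any clustering below the threshold yields
  an assignment violating few clauses. A wrong answer may however keep the algorithm from halting,
  hence a clock is needed.

  The factor 10 bounds the quotient of base value and price. For a clause with three free literals
  the grids contribute 3/2 R^2 and the two literals from which it is cut 2 * 8/15 R^2, together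
  77/30 R^2; divided by 4/15 R^2 this is 77/8.\<close>

lemma poly_nat_mono: "x \<le> y \<Longrightarrow> poly p x \<le> poly p y" for p :: "nat poly"
  by (induction p) (auto intro!: add_mono mult_mono)

definition poly_bounded :: "(nat \<Rightarrow> nat) \<Rightarrow> bool" where
  "poly_bounded g \<longleftrightarrow> (\<exists>p :: nat poly. \<forall>n. g n \<le> poly p n)"

lemma poly_bounded_const: "poly_bounded (\<lambda>_. c)"
  unfolding poly_bounded_def by (rule exI[of _ "[:c:]"]) simp

lemma poly_bounded_id: "poly_bounded (\<lambda>n. n)"
  unfolding poly_bounded_def by (rule exI[of _ "[:0, 1:]"]) simp

lemma poly_bounded_poly: "poly_bounded (poly p)"
  unfolding poly_bounded_def by blast

lemma poly_bounded_add: "poly_bounded f \<Longrightarrow> poly_bounded g \<Longrightarrow> poly_bounded (\<lambda>n. f n + g n)"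
  unfolding poly_bounded_def by (metis add_mono poly_add)

lemma poly_bounded_mult: "poly_bounded f \<Longrightarrow> poly_bounded g \<Longrightarrow> poly_bounded (\<lambda>n. f n * g n)"
  unfolding poly_bounded_def by (metis mult_le_mono poly_mult)

lemma poly_bounded_comp: "poly_bounded f \<Longrightarrow> poly_bounded g \<Longrightarrow> poly_bounded (\<lambda>n. f (g n))"
  unfolding poly_bounded_def
  by (metis (no_types, opaque_lifting) le_trans poly_nat_mono poly_pcompose)

lemma poly_bounded_Suc: "poly_bounded f \<Longrightarrow> poly_bounded (\<lambda>n. Suc (f n))"
  using poly_bounded_add[OF _ poly_bounded_const[of 1], of f] by simp

lemmas poly_bounded_intros = poly_bounded_const poly_bounded_id poly_bounded_poly
  poly_bounded_add poly_bounded_mult poly_bounded_Suc poly_bounded_comp[OF poly_bounded_poly]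

section \<open>Heights of trees and their growth along a run\<close>

primrec height :: "tree \<Rightarrow> nat" where
  "height Leaf = 0"
| "height (Node a b) = Suc (max (height a) (height b))"

text \<open>Inverse of \<open>dec_list\<close>: every tree is the spine of exactly one list, so all
  data can be specified as lists and no input is malformed.\<close>

definition list_tree :: "tree list \<Rightarrow> tree" where
  "list_tree = enc_list (\<lambda>x. x)"

lemma list_tree_simps [simp]: "list_tree [] = Leaf" "list_tree (x # xs) = Node x (list_tree xs)"
  by (simp_all add: list_tree_def)

lemma dec_list_tree [simp]: "dec_list (list_tree xs) = xs"
  by (induction xs) auto

lemma list_tree_dec [simp]: "list_tree (dec_list t) = t"
  by (induction t) auto

lemma enc_list_conv: "enc_list f xs = list_tree (map f xs)"
  by (induction xs) auto

lemma dec_enc_list [simp]: "dec_list (enc_list f xs) = map f xs"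
  by (simp add: enc_list_conv)

lemma length_dec_list_le: "length (dec_list t) \<le> height t"
  by (induction t) auto

lemma height_dec_list: "x \<in> set (dec_list t) \<Longrightarrow> height x < height t"
  by (induction t) auto

lemma list_tree_eq_Leaf [simp]: "list_tree xs = Leaf \<longleftrightarrow> xs = []"
  by (cases xs) auto

lemma dec_list_eq_Nil [simp]: "dec_list t = [] \<longleftrightarrow> t = Leaf"
  by (cases t) auto

lemma dec_nat_eq_0 [simp]: "dec_nat t = 0 \<longleftrightarrow> t = Leaf"
  by (cases t) (auto simp: dec_nat_def)

lemma dec_nat_Leaf [simp]: "dec_nat Leaf = 0"
  by (simp add: dec_nat_def)

lemma dec_nat_Node [simp]: "dec_nat (Node a b) = Suc (dec_nat b)"
  by (simp add: dec_nat_def)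

lemma dec_enc_nat [simp]: "dec_nat (enc_nat n) = n"
  by (simp add: dec_nat_def enc_nat_def)

lemma dec_nat_list_tree [simp]: "dec_nat (list_tree xs) = length xs"
  by (simp add: dec_nat_def)

lemma height_expr:
  "(\<And>x. height (s x) \<le> H) \<Longrightarrow> height (eval_expr e s) \<le> H + size e"
proof (induction e)
  case (Hd a)
  then show ?case by (cases "eval_expr a s") fastforce+
next
  case (Tl a)
  then show ?case by (cases "eval_expr a s") fastforce+
qed (auto simp: le_SucI le_supI1 le_supI2 add.commute trans_le_add1 trans_le_add2 intro: order_trans)

primrec growth :: "prog \<Rightarrow> nat" where
  "growth Skip = 0"
| "growth (Assign x e) = size e"
| "growth (Seq P Q) = max (growth P) (growth Q)"
| "growth (Cond b P Q) = max (growth P) (growth Q)"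
| "growth (While b P) = growth P"
| "growth (Query x a b) = 1"

text \<open>One step raises the largest height by at most a constant of the program: the size of an
  assigned expression, or 1 for an oracle answer. Short runs therefore have low outputs, which makes
  time bounds in terms of the height composable.\<close>

lemma height_exec:
  assumes "exec orc P s t q s'" "\<And>x. height (s x) \<le> H"
  shows "height (s' x) \<le> H + growth P * t"
  using assms
proof (induction arbitrary: H x)
  case (Assign x' a s)
  then show ?case using height_expr[of s H a] by (auto intro: trans_le_add1)
next
  case (Seq P s t q s' Q t' q' s'')
  have "height (s'' x) \<le> (H + growth P * t) + growth Q * t'"
    by (rule Seq.IH(2)) (rule Seq.IH(1)[OF Seq.prems])
  also have "\<dots> \<le> H + max (growth P) (growth Q) * t + max (growth P) (growth Q) * t'"
    by (intro add_mono mult_right_mono) auto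
  finally show ?case by (simp add: algebra_simps)
next
  case (CondTrue b s P t q s' Q)
  have "height (s' x) \<le> H + growth P * t" by (rule CondTrue.IH[OF CondTrue.prems])
  also have "\<dots> \<le> H + max (growth P) (growth Q) * (1 + t)"
    by (intro add_mono mult_mono) auto
  finally show ?case by simp
next
  case (CondFalse b s Q t q s' P)
  have "height (s' x) \<le> H + growth Q * t" by (rule CondFalse.IH[OF CondFalse.prems])
  also have "\<dots> \<le> H + max (growth P) (growth Q) * (1 + t)"
    by (intro add_mono mult_mono) auto
  finally show ?case by simp
next
  case (WhileTrue b s P t q s' t' q' s'')
  have "height (s'' x) \<le> (H + growth P * t) + growth (While b P) * t'"
    by (rule WhileTrue.IH(2)) (rule WhileTrue.IH(1)[OF WhileTrue.prems])
  then show ?case by (simp add: algebra_simps)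
next
  case (Query x' a b s)
  have "height (enc_bool c) \<le> Suc H" for c by (simp add: enc_bool_def)
  then show ?case using Query by (auto intro: le_SucI)
qed (auto intro: trans_le_add1)

section \<open>Query-free runs with an upper bound on the time\<close>

definition run :: "prog \<Rightarrow> state \<Rightarrow> nat \<Rightarrow> state \<Rightarrow> bool" where
  "run P s T s' \<longleftrightarrow> (\<exists>t\<le>T. exec (\<lambda>_ _. False) P s t 0 s')"

lemma run_Assign: "s' = s(x := eval_expr a s) \<Longrightarrow> run (Assign x a) s 1 s'"
  unfolding run_def using exec.Assign by blast

lemma run_Skip: "run Skip s 1 s"
  unfolding run_def using exec.Skip by blast

lemma run_Seq: "run P s T s' \<Longrightarrow> run Q s' T' s'' \<Longrightarrow> run (Seq P Q) s (T + T') s''"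
  unfolding run_def using exec.Seq[of _ P s _ 0 s' Q _ 0 s''] add_mono by (metis add_0)

lemma run_CondTrue: "eval_expr b s \<noteq> Leaf \<Longrightarrow> run P s T s' \<Longrightarrow> run (Cond b P Q) s (1 + T) s'"
  unfolding run_def using exec.CondTrue by (meson add_le_cancel_left)

lemma run_CondFalse: "eval_expr b s = Leaf \<Longrightarrow> run Q s T s' \<Longrightarrow> run (Cond b P Q) s (1 + T) s'"
  unfolding run_def using exec.CondFalse by (meson add_le_cancel_left)

lemma run_WhileFalse: "eval_expr b s = Leaf \<Longrightarrow> run (While b P) s 1 s"
  unfolding run_def using exec.WhileFalse by blast

lemma run_WhileTrue:
  assumes "eval_expr b s \<noteq> Leaf" "run P s T s'" "run (While b P) s' T' s''"
  shows "run (While b P) s (1 + T + T') s''"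
proof -
  from assms(2) obtain t where "t \<le> T" "exec (\<lambda>_ _. False) P s t 0 s'" by (auto simp: run_def)
  moreover from assms(3) obtain t' where "t' \<le> T'" "exec (\<lambda>_ _. False) (While b P) s' t' 0 s''"
    by (auto simp: run_def)
  ultimately show ?thesis using exec.WhileTrue[OF assms(1), of _ P t 0 s' t' 0 s'']
    unfolding run_def by (intro exI[of _ "1 + t + t'"]) auto
qed

lemma run_mono: "run P s T s' \<Longrightarrow> T \<le> T' \<Longrightarrow> run P s T' s'"
  unfolding run_def by (meson le_trans)

section \<open>Subroutine calls on renumbered variables\<close>

primrec shift_expr :: "nat \<Rightarrow> expr \<Rightarrow> expr" where
  "shift_expr K (Var x) = Var (x + K)"
| "shift_expr K Lf = Lf"
| "shift_expr K (Pair a b) = Pair (shift_expr K a) (shift_expr K b)"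
| "shift_expr K (Hd a) = Hd (shift_expr K a)"
| "shift_expr K (Tl a) = Tl (shift_expr K a)"

primrec shift :: "nat \<Rightarrow> prog \<Rightarrow> prog" where
  "shift K Skip = Skip"
| "shift K (Assign x e) = Assign (x + K) (shift_expr K e)"
| "shift K (Seq P Q) = Seq (shift K P) (shift K Q)"
| "shift K (Cond b P Q) = Cond (shift_expr K b) (shift K P) (shift K Q)"
| "shift K (While b P) = While (shift_expr K b) (shift K P)"
| "shift K (Query x a b) = Query (x + K) (shift_expr K a) (shift_expr K b)"

text \<open>The variables below \<open>K\<close> belong to the caller, the others to the subroutine,
  which sees them numbered from 0. A shifted program acts on the second part only.\<close>

definition join_state :: "nat \<Rightarrow> state \<Rightarrow> state \<Rightarrow> state" where
  "join_state K \<sigma> s = (\<lambda>x. if x < K then \<sigma> x else s (x - K))"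

lemma eval_shift [simp]: "eval_expr (shift_expr K e) (join_state K \<sigma> s) = eval_expr e s"
  by (induction e) (auto simp: join_state_def)

lemma join_state_upd: "(join_state K \<sigma> s)(x + K := v) = join_state K \<sigma> (s(x := v))"
  by (auto simp: join_state_def fun_eq_iff)

lemma exec_shift:
  "exec orc P s t q s' \<Longrightarrow> exec orc (shift K P) (join_state K \<sigma> s) t q (join_state K \<sigma> s')"
proof (induction rule: exec.induct)
  case (Assign x a s)
  show ?case using exec.Assign[of orc "x + K" "shift_expr K a" "join_state K \<sigma> s"]
    by (simp only: join_state_upd eval_shift shift.simps)
next
  case (Query x a b s)
  show ?case
    using exec.Query[of orc "x + K" "shift_expr K a" "shift_expr K b" "join_state K \<sigma> s"]
    by (simp only: join_state_upd eval_shift shift.simps)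
qed (auto intro: exec.intros simp del: One_nat_def plus_nat.simps)

text \<open>A memory given by its first few variables, all others being leaves. A trailing leaf does
  not change the state, so overwriting the last variable with a leaf frees it.\<close>

definition st :: "tree list \<Rightarrow> state" where
  "st vs = (\<lambda>x. if x < length vs then vs ! x else Leaf)"

lemma st_upd: "x < length vs \<Longrightarrow> (st vs)(x := v) = st (vs[x := v])"
  by (auto simp: st_def fun_eq_iff)

lemma st_snoc_Leaf [simp]: "st (vs @ [Leaf]) = st vs"
  by (auto simp: st_def fun_eq_iff nth_append)

lemma init_conv_st: "init v = st [v]"
  by (auto simp: init_def st_def fun_eq_iff)

lemma st_append: "st (vs @ [v]) = join_state (length vs) (st vs) (init v)"
  by (auto simp: st_def join_state_def init_def fun_eq_iff nth_append)

text \<open>A call: the argument sits in the topmost variable, and since the callee starts and ends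
  in a state of the form \<open>init\<close>, the result replaces it and no scratch data
  remain.\<close>

lemma run_shift:
  "run Q (init v) T (init w) \<Longrightarrow> run (shift (length vs) Q) (st (vs @ [v])) T (st (vs @ [w]))"
  unfolding run_def st_append using exec_shift by blast

text \<open>Polynomial time is measured in the height of the input, as every loop below runs along the
  spine of a list; the size of a tree with shared subtrees may be exponential in the time it took to
  build it.\<close>

definition FP :: "(tree \<Rightarrow> tree) \<Rightarrow> bool" where
  "FP f \<longleftrightarrow> (\<exists>Q g. poly_bounded g \<and> (\<forall>v. run Q (init v) (g (height v)) (init (f v))))"

text \<open>By \<open>height_exec\<close> the value also has polynomial height, which bounds the
  running time of whatever is applied to it next.\<close>

lemma FP_D:
  assumes "FP f"
  shows "\<exists>Q p h. \<forall>v. run Q (init v) (poly p (height v)) (init (f v)) \<and> height (f v) \<le> poly h (height v)"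
proof -
  from assms obtain Q p where
    Q: "\<And>v. run Q (init v) (poly p (height v)) (init (f v))"
    unfolding FP_def poly_bounded_def by (meson run_mono)
  have "height (f v) \<le> poly ([:0, 1:] + [:growth Q:] * p) (height v)" for v
  proof -
    from Q[of v] obtain t where t: "t \<le> poly p (height v)"
      "exec (\<lambda>_ _. False) Q (init v) t 0 (init (f v))" by (auto simp: run_def)
    have "height (init (f v) 0) \<le> height v + growth Q * t"
      by (rule height_exec[OF t(2)]) (simp add: init_def)
    also have "\<dots> \<le> height v + growth Q * poly p (height v)" using t(1) by simp
    finally show ?thesis by (simp add: init_def)
  qed
  with Q show ?thesis by blast
qed

section \<open>Closure properties of polynomial-time functions\<close>

lemma FP_I:
  assumes "poly_bounded g" "\<And>v. run Q (init v) (g (height v)) (init (f v))"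
  shows "FP f"
  using assms unfolding FP_def by blast

lemma FP_id [simp, intro]: "FP (\<lambda>x. x)"
  by (rule FP_I[OF poly_bounded_const, of Skip 1]) (rule run_Skip)

lemma FP_comp:
  assumes "FP f" "FP g"
  shows "FP (\<lambda>x. f (g x))"
proof -
  obtain Q p where Q: "\<And>v. run Q (init v) (poly p (height v)) (init (f v))"
    using FP_D[OF assms(1)] by auto
  obtain Q' p' h' where Q': "\<And>v. run Q' (init v) (poly p' (height v)) (init (g v))"
    "\<And>v. height (g v) \<le> poly h' (height v)"
    using FP_D[OF assms(2)] by auto
  show ?thesis
  proof (rule FP_I)
    show "poly_bounded (\<lambda>n. poly p' n + poly p (poly h' n))" by (intro poly_bounded_intros)
    fix v
    have "run Q (init (g v)) (poly p (poly h' (height v))) (init (f (g v)))"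
      by (rule run_mono[OF Q]) (rule poly_nat_mono[OF Q'(2)])
    with Q'(1) show "run (Seq Q' Q) (init v) (poly p' (height v) + poly p (poly h' (height v)))
        (init (f (g v)))"
      by (rule run_Seq)
  qed
qed

primrec const_expr :: "tree \<Rightarrow> expr" where
  "const_expr Leaf = Lf"
| "const_expr (Node a b) = Pair (const_expr a) (const_expr b)"

lemma eval_const_expr [simp]: "eval_expr (const_expr c) s = c"
  by (induction c) auto

lemma FP_expr: "FP (\<lambda>x. eval_expr e (init x))"
  by (rule FP_I[OF poly_bounded_const, of "Assign 0 e" 1]) (rule run_Assign, simp add: init_def)

lemma FP_const: "FP (\<lambda>_. c)"
  using FP_expr[of "const_expr c"] by simp

lemma FP_head: "FP f \<Longrightarrow> FP (\<lambda>x. head (f x))"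
  using FP_comp[OF FP_expr[of "Hd (Var 0)"]] by (simp add: init_def)

lemma FP_tail: "FP f \<Longrightarrow> FP (\<lambda>x. tail (f x))"
  using FP_comp[OF FP_expr[of "Tl (Var 0)"]] by (simp add: init_def)

lemma st_nth: "x < length vs \<Longrightarrow> st vs x = vs ! x"
  by (simp add: st_def)

lemma run_Assign_st:
  "x < length vs \<Longrightarrow> w = eval_expr e (st vs) \<Longrightarrow> vs' = vs[x := w] \<Longrightarrow> run (Assign x e) (st vs) 1 (st vs')"
  by (rule run_Assign) (simp add: st_upd)

lemma run_new_st:
  "x = length vs \<Longrightarrow> w = eval_expr e (st vs) \<Longrightarrow> run (Assign x e) (st vs) 1 (st (vs @ [w]))"
  by (rule run_Assign) (auto simp: st_def fun_eq_iff nth_append)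

lemma run_shift_st:
  assumes "\<And>v. run Q (init v) (poly p (height v)) (init (f v))"
    and "ws = vs @ [v]" "ws' = vs @ [f v]" "K = length vs" "height v \<le> h"
  shows "run (shift K Q) (st ws) (poly p h) (st ws')"
  using run_mono[OF run_shift[OF assms(1)] poly_nat_mono[OF assms(5)]] assms(2-4) by simp

lemma st_drop_Leaf2: "st [a, Leaf] = st [a]"
  using st_snoc_Leaf[of "[a]"] by simp

lemma st_drop_Leaf3: "st [a, b, Leaf] = st [a, b]"
  using st_snoc_Leaf[of "[a, b]"] by simp

lemma st_drop_Leaf4: "st [a, b, c, Leaf] = st [a, b, c]"
  using st_snoc_Leaf[of "[a, b, c]"] by simp

lemma st_drop_Leaf5: "st [a, b, c, d, Leaf] = st [a, b, c, d]"
  using st_snoc_Leaf[of "[a, b, c, d]"] by simp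

lemmas st_drop_Leaf = st_drop_Leaf2 st_drop_Leaf3 st_drop_Leaf4 st_drop_Leaf5

lemma FP_Node:
  assumes "FP f" "FP g"
  shows "FP (\<lambda>x. Node (f x) (g x))"
proof -
  obtain Q p where Q: "\<And>v. run Q (init v) (poly p (height v)) (init (f v))"
    using FP_D[OF assms(1)] by auto
  obtain Q' p' where Q': "\<And>v. run Q' (init v) (poly p' (height v)) (init (g v))"
    using FP_D[OF assms(2)] by auto
  let ?P = "Seq (Assign 1 (Var 0)) (Seq (shift 1 Q) (Seq (Assign 2 (Var 0)) (Seq (shift 2 Q')
    (Seq (Assign 0 (Pair (Var 1) (Var 2))) (Seq (Assign 1 Lf) (Assign 2 Lf))))))"
  show ?thesis
  proof (rule FP_I)
    show "poly_bounded (\<lambda>n. 1 + (poly p n + (1 + (poly p' n + (1 + (1 + 1))))))"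
      by (intro poly_bounded_intros)
    fix v
    show "run ?P (init v) (1 + (poly p (height v) + (1 + (poly p' (height v) + (1 + (1 + 1))))))
      (init (Node (f v) (g v)))" unfolding init_conv_st
    proof (intro run_Seq)
      show "run (Assign 1 (Var 0)) (st [v]) 1 (st [v, v])"
        using run_new_st[of 1 "[v]" v "Var 0"] by (simp add: st_def)
      show "run (shift 1 Q) (st [v, v]) (poly p (height v)) (st [v, f v])"
        by (rule run_shift_st[OF Q, of _ "[v]"]) auto
      show "run (Assign 2 (Var 0)) (st [v, f v]) 1 (st [v, f v, v])"
        using run_new_st[of 2 "[v, f v]" v "Var 0"] by (simp add: st_def)
      show "run (shift 2 Q') (st [v, f v, v]) (poly p' (height v)) (st [v, f v, g v])"
        by (rule run_shift_st[OF Q', of _ "[v, f v]"]) auto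
      show "run (Assign 0 (Pair (Var 1) (Var 2))) (st [v, f v, g v]) 1
          (st [Node (f v) (g v), f v, g v])"
        by (rule run_Assign_st) (auto simp: st_nth)
      show "run (Assign 1 Lf) (st [Node (f v) (g v), f v, g v]) 1
          (st [Node (f v) (g v), Leaf, g v])"
        by (rule run_Assign_st) auto
      show "run (Assign 2 Lf) (st [Node (f v) (g v), Leaf, g v]) 1 (st [Node (f v) (g v)])"
        by (subst st_drop_Leaf[symmetric], subst st_drop_Leaf[symmetric], rule run_Assign_st)
          auto
    qed
  qed
qed

lemma FP_if:
  assumes "FP b" "FP f" "FP g"
  shows "FP (\<lambda>x. if b x = Leaf then g x else f x)"
proof -
  obtain Q p where Q: "\<And>v. run Q (init v) (poly p (height v)) (init (f v))"
    using FP_D[OF assms(2)] by auto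
  obtain Q' p' where Q': "\<And>v. run Q' (init v) (poly p' (height v)) (init (g v))"
    using FP_D[OF assms(3)] by auto
  obtain Qb pb where Qb: "\<And>v. run Qb (init v) (poly pb (height v)) (init (b v))"
    using FP_D[OF assms(1)] by auto
  let ?P = "Seq (Assign 1 (Var 0)) (Seq (shift 1 Qb)
    (Cond (Var 1) (Seq (Assign 1 Lf) Q) (Seq (Assign 1 Lf) Q')))"
  show ?thesis
  proof (rule FP_I)
    show "poly_bounded (\<lambda>n. 1 + (poly pb n + (1 + (1 + (poly p n + poly p' n)))))"
      by (intro poly_bounded_intros)
    fix v
    \<comment> \<open>The flag is erased before a branch is entered, because the programs of the
      branches expect a state of the form \<open>init\<close>.\<close>
    have clear: "run (Assign 1 Lf) (st [v, b v]) 1 (init v)"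
      unfolding init_conv_st by (subst st_drop_Leaf[symmetric], rule run_Assign_st) auto
    show "run ?P (init v) (1 + (poly pb (height v) + (1 + (1 + (poly p (height v) + poly p' (height v))))))
      (init (if b v = Leaf then g v else f v))"
    proof (intro run_Seq)
      show "run (Assign 1 (Var 0)) (init v) 1 (st [v, v])"
        using run_new_st[of 1 "[v]" v "Var 0"] by (simp add: st_def init_conv_st)
      show "run (shift 1 Qb) (st [v, v]) (poly pb (height v)) (st [v, b v])"
        by (rule run_shift_st[OF Qb, of _ "[v]"]) auto
      show "run (Cond (Var 1) (Seq (Assign 1 Lf) Q) (Seq (Assign 1 Lf) Q')) (st [v, b v])
         (1 + (1 + (poly p (height v) + poly p' (height v)))) (init (if b v = Leaf then g v else f v))"
      proof (cases "b v = Leaf")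
        case True
        show ?thesis
          using run_Seq[OF clear run_mono[OF Q' le_add2]]
            True by (intro run_CondFalse) (auto simp: st_nth)
      next
        case False
        show ?thesis
          using run_Seq[OF clear run_mono[OF Q le_add1]]
            False by (intro run_CondTrue) (auto simp: st_nth)
      qed
    qed
  qed
qed

primrec suffixes :: "tree \<Rightarrow> tree list" where
  "suffixes Leaf = []"
| "suffixes (Node a b) = Node a b # suffixes b"

text \<open>One primitive for two purposes: on unary numbers it decides comparison
  (\<open>leq\<close>), and on tables it gives access by position (\<open>tcopies\<close>,
  \<open>tlabel\<close>).\<close>

definition drp :: "tree \<Rightarrow> tree \<Rightarrow> tree" where
  "drp l a = list_tree (drop (dec_nat l) (dec_list a))"

text \<open>The body of a loop sees the current suffix of the list, hence also the position of the current
  element, counted from the end.\<close>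

definition scmap :: "(tree \<Rightarrow> tree) \<Rightarrow> tree \<Rightarrow> tree" where
  "scmap f l = list_tree (concat (map (\<lambda>S. dec_list (f S)) (suffixes l)))"

lemma drp_simps [simp]: "drp Leaf a = a" "drp (Node x l) a = drp l (tail a)"
  by (cases a; simp add: drp_def)+

lemma run_drp_loop:
  "run (While (Var 1) (Seq (Assign 0 (Tl (Var 0))) (Assign 1 (Tl (Var 1))))) (st [a, l])
     (1 + 3 * dec_nat l) (st [drp l a])"
proof (induction l arbitrary: a)
  case Leaf
  have "run (While (Var 1) P) (st [a, Leaf]) 1 (st [a, Leaf])" for P
    by (rule run_WhileFalse) (simp add: st_def)
  then show ?case by (simp add: st_drop_Leaf)
next
  case (Node x l)
  have "run (Seq (Assign 0 (Tl (Var 0))) (Assign 1 (Tl (Var 1)))) (st [a, Node x l]) (1 + 1)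
      (st [tail a, l])"
  proof (rule run_Seq)
    show "run (Assign 0 (Tl (Var 0))) (st [a, Node x l]) 1 (st [tail a, Node x l])"
      by (rule run_Assign_st) (auto simp: st_nth)
    show "run (Assign 1 (Tl (Var 1))) (st [tail a, Node x l]) 1 (st [tail a, l])"
      by (rule run_Assign_st) (auto simp: st_nth)
  qed
  from run_mono[OF run_WhileTrue[OF _ this Node(2)], of "1 + 3 * dec_nat (Node x l)"] show ?case
    by (simp add: st_nth)
qed

lemma FP_drp:
  assumes "FP f" "FP g"
  shows "FP (\<lambda>x. drp (f x) (g x))"
proof -
  let ?P = "Seq (Assign 1 (Hd (Var 0))) (Seq (Assign 0 (Tl (Var 0)))
    (While (Var 1) (Seq (Assign 0 (Tl (Var 0))) (Assign 1 (Tl (Var 1))))))"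
  have "FP (\<lambda>x. drp (head x) (tail x))"
  proof (rule FP_I)
    show "poly_bounded (\<lambda>n. 1 + (1 + (1 + 3 * n)))" by (intro poly_bounded_intros)
    fix v
    show "run ?P (init v) (1 + (1 + (1 + 3 * height v))) (init (drp (head v) (tail v)))"
      unfolding init_conv_st
    proof (intro run_Seq)
      show "run (Assign 1 (Hd (Var 0))) (st [v]) 1 (st [v, head v])"
        using run_new_st[of 1 "[v]" "head v" "Hd (Var 0)"] by (simp add: st_def)
      show "run (Assign 0 (Tl (Var 0))) (st [v, head v]) 1 (st [tail v, head v])"
        by (rule run_Assign_st) (auto simp: st_nth)
      have "dec_nat (head v) \<le> height v"
        using length_dec_list_le[of "head v"] by (cases v) (auto simp: dec_nat_def)
      then show "run (While (Var 1) (Seq (Assign 0 (Tl (Var 0))) (Assign 1 (Tl (Var 1)))))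
          (st [tail v, head v]) (1 + 3 * height v) (st [drp (head v) (tail v)])"
        by (intro run_mono[OF run_drp_loop]) simp
    qed
  qed
  from FP_comp[OF this FP_Node[OF assms]] show ?thesis by simp
qed

abbreviation (input) move :: "nat \<Rightarrow> nat \<Rightarrow> prog" where
  "move y x \<equiv> While (Var x) (Seq (Assign y (Pair (Hd (Var x)) (Var y))) (Assign x (Tl (Var x))))"

text \<open>Popping from one list and pushing onto the other reverses the order;
  \<open>FP_scmap\<close> collects its results this way and restores their order by a last
  move.\<close>

lemma run_move:
  "x < length vs \<Longrightarrow> y < length vs \<Longrightarrow> x \<noteq> y \<Longrightarrow> vs ! x = t \<Longrightarrow>
   run (move y x) (st vs) (1 + 3 * dec_nat t)
     (st (vs[x := Leaf, y := list_tree (rev (dec_list t) @ dec_list (vs ! y))]))"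
proof (induction t arbitrary: vs)
  case Leaf
  then have "vs[x := Leaf, y := list_tree (rev (dec_list Leaf) @ dec_list (vs ! y))] = vs"
    by (metis append_Nil dec_list.simps(1) list_tree_dec list_update_id rev.simps(1))
  with Leaf show ?case using run_WhileFalse[of "Var x" "st vs"] by (simp add: st_def)
next
  case (Node a t)
  let ?vs = "vs[y := Node a (vs ! y), x := t]"
  have "run (Seq (Assign y (Pair (Hd (Var x)) (Var y))) (Assign x (Tl (Var x)))) (st vs) (1 + 1)
      (st ?vs)"
  proof (rule run_Seq)
    show "run (Assign y (Pair (Hd (Var x)) (Var y))) (st vs) 1 (st (vs[y := Node a (vs ! y)]))"
      by (rule run_Assign_st) (use Node.prems in \<open>auto simp: st_nth\<close>)
    show "run (Assign x (Tl (Var x))) (st (vs[y := Node a (vs ! y)])) 1 (st ?vs)"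
      by (rule run_Assign_st) (use Node.prems in \<open>auto simp: st_nth\<close>)
  qed
  from run_mono[OF run_WhileTrue[OF _ this Node.IH(2)[of ?vs]], of "1 + 3 * dec_nat (Node a t)"]
    Node.prems show ?case
    by (simp add: st_nth list_update_swap[where i = x and i' = y])
qed

lemma length_suffixes [simp]: "length (suffixes t) = dec_nat t"
  by (induction t) auto

lemma dec_nat_le_height: "dec_nat t \<le> height t"
  by (simp add: dec_nat_def length_dec_list_le)

lemma length_concat_le: "(\<And>x. x \<in> set xs \<Longrightarrow> length x \<le> c) \<Longrightarrow> length (concat xs) \<le> length xs * c"
proof (induction xs)
  case (Cons x xs)
  then have "length x \<le> c" "length (concat xs) \<le> length xs * c" by auto
  then show ?case by simp
qed simp

lemma height_suffixes: "S \<in> set (suffixes t) \<Longrightarrow> height S \<le> height t"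
  by (induction t) auto

lemma FP_scmap:
  assumes "FP (\<lambda>p. f (head p) (tail p))" "FP L"
  shows "FP (\<lambda>x. scmap (f x) (L x))"
proof -
  obtain Qf p h where Qf: "\<And>v. run Qf (init v) (poly p (height v)) (init (f (head v) (tail v)))"
    and h: "\<And>v. height (f (head v) (tail v)) \<le> poly h (height v)"
    using FP_D[OF assms(1)] by auto
  obtain QL pL hL where QL: "\<And>v. run QL (init v) (poly pL (height v)) (init (L v))"
    and hL: "\<And>v. height (L v) \<le> poly hL (height v)"
    using FP_D[OF assms(2)] by auto
  \<comment> \<open>Variable 0 keeps the parameter, 1 the remaining suffix, 2 the reversed results,
    and 3 is the frame for calling \<open>f\<close>.\<close>
  let ?step = "Seq (Assign 3 (Pair (Var 0) (Var 1))) (Seq (shift 3 Qf)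
    (Seq (move 2 3) (Assign 1 (Tl (Var 1)))))"
  let ?P = "Seq (Assign 1 (Var 0)) (Seq (shift 1 QL) (Seq (While (Var 1) ?step)
    (Seq (Assign 0 Lf) (move 0 2))))"
  let ?T = "\<lambda>H. 1 + (1 + (poly p H + ((1 + 3 * poly h H) + 1)))"
  \<comment> \<open>The strict inequalities leave room for the pair \<open>Node x l\<close> that is
    handed to \<open>f\<close>.\<close>
  have loop: "run (While (Var 1) ?step) (st [x, l, a]) (1 + dec_nat l * ?T H)
      (st [x, Leaf, list_tree (rev (concat (map (\<lambda>S. dec_list (f x S)) (suffixes l))) @ dec_list a)])"
    if "height x < H" "height l < H" for x l a H
    using that
  proof (induction l arbitrary: a)
    case Leaf
    show ?case using run_WhileFalse[of "Var 1" "st [x, Leaf, a]"] by (simp add: st_def)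
  next
    case (Node b l)
    let ?a = "list_tree (rev (dec_list (f x (Node b l))) @ dec_list a)"
    have H: "height (Node x (Node b l)) \<le> H" using Node.prems by auto
    have "run ?step (st [x, Node b l, a]) (1 + (poly p H + ((1 + 3 * poly h H) + 1))) (st [x, l, ?a])"
    proof (intro run_Seq)
      show "run (Assign 3 (Pair (Var 0) (Var 1))) (st [x, Node b l, a]) 1
          (st [x, Node b l, a, Node x (Node b l)])"
        using run_new_st[of 3 "[x, Node b l, a]" "Node x (Node b l)" "Pair (Var 0) (Var 1)"]
        by (simp add: st_def)
      show "run (shift 3 Qf) (st [x, Node b l, a, Node x (Node b l)]) (poly p H)
          (st [x, Node b l, a, f x (Node b l)])"
        by (rule run_shift_st[OF Qf, of _ "[x, Node b l, a]" "Node x (Node b l)"]) (use H in auto)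
      have "dec_nat (f x (Node b l)) \<le> poly h H"
        using h[of "Node x (Node b l)"] poly_nat_mono[OF H, of h] dec_nat_le_height[of "f x (Node b l)"]
        by simp
      then show "run (move 2 3) (st [x, Node b l, a, f x (Node b l)]) (1 + 3 * poly h H)
          (st [x, Node b l, ?a])"
        using run_mono[OF run_move[of 3 "[x, Node b l, a, f x (Node b l)]" 2]]
        by (simp add: st_drop_Leaf)
      show "run (Assign 1 (Tl (Var 1))) (st [x, Node b l, ?a]) 1 (st [x, l, ?a])"
        by (rule run_Assign_st) (auto simp: st_nth)
    qed
    from run_WhileTrue[OF _ this Node.IH(2)] Node.prems show ?case
      by (simp add: st_nth algebra_simps)
  qed
  show ?thesis
  proof (rule FP_I)
    let ?g = "\<lambda>n. 1 + (poly pL n + ((1 + poly hL n * ?T (Suc (n + poly hL n))) +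
      (1 + (1 + 3 * (poly hL n * poly h (Suc (n + poly hL n)))))))"
    show "poly_bounded ?g" by (intro poly_bounded_intros)
    fix x
    let ?r = "concat (map (\<lambda>S. dec_list (f x S)) (suffixes (L x)))"
    define H where "H = Suc (height x + poly hL (height x))"
    have H: "height x < H" "height (L x) < H" using hL[of x] by (auto simp: H_def)
    have lenL: "dec_nat (L x) \<le> poly hL (height x)"
      using hL[of x] dec_nat_le_height[of "L x"] by simp
    have "length (dec_list (f x S)) \<le> poly h H" if "S \<in> set (suffixes (L x))" for S
    proof -
      have "height (Node x S) \<le> H" using height_suffixes[OF that] H by simp
      from order_trans[OF h[of "Node x S"] poly_nat_mono[OF this]] length_dec_list_le[of "f x S"]
      show ?thesis by simp
    qed
    then have "length ?r \<le> dec_nat (L x) * poly h H"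
      using length_concat_le[of "map (\<lambda>S. dec_list (f x S)) (suffixes (L x))" "poly h H"] by auto
    then have len: "length ?r \<le> poly hL (height x) * poly h H"
      using mult_right_mono[OF lenL] by (rule order_trans) simp
    show "run ?P (init x) (?g (height x)) (init (scmap (f x) (L x)))"
      unfolding H_def[symmetric]
    proof (intro run_Seq)
      show "run (Assign 1 (Var 0)) (init x) 1 (st [x, x])"
        using run_new_st[of 1 "[x]" x "Var 0"] by (simp add: st_def init_conv_st)
      show "run (shift 1 QL) (st [x, x]) (poly pL (height x)) (st [x, L x])"
        by (rule run_shift_st[OF QL, of _ "[x]"]) auto
      show "run (While (Var 1) ?step) (st [x, L x]) (1 + poly hL (height x) * ?T H)
        (st [x, Leaf, list_tree (rev ?r)])"
      proof (rule run_mono)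
        show "run (While (Var 1) ?step) (st [x, L x]) (1 + dec_nat (L x) * ?T H)
            (st [x, Leaf, list_tree (rev ?r)])"
          using loop[OF H, of Leaf] by (simp add: st_drop_Leaf)
      qed (intro add_left_mono mult_right_mono lenL le0)
      show "run (Assign 0 Lf) (st [x, Leaf, list_tree (rev ?r)]) 1 (st [Leaf, Leaf, list_tree (rev ?r)])"
        by (rule run_Assign_st) auto
      show "run (move 0 2) (st [Leaf, Leaf, list_tree (rev ?r)])
          (1 + 3 * (poly hL (height x) * poly h H)) (init (scmap (f x) (L x)))"
        using run_mono[OF run_move[of 2 "[Leaf, Leaf, list_tree (rev ?r)]" 0 "list_tree (rev ?r)"],
            of "1 + 3 * (poly hL (height x) * poly h H)"] len
        by (simp add: st_drop_Leaf scmap_def init_conv_st)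
    qed
  qed
qed

section \<open>Simulating an algorithm with guessed oracle answers\<close>

lemma run_unique: "run P s T s' \<Longrightarrow> run P s T' s'' \<Longrightarrow> s'' = s'"
  unfolding run_def using exec_deterministic by blast

definition test :: "expr \<Rightarrow> prog" where
  "test b = Cond (Var 0) (Assign 2 (shift_expr 3 b)) (Assign 2 Lf)"

text \<open>Variable 0 holds the clock (a list, one element per loop iteration), variable 1 the list of
  guessed oracle answers, variable 2 the loop condition. When the clock has run out, all loops are
  left, so that the program always terminates.\<close>

primrec clocked :: "prog \<Rightarrow> prog" where
  "clocked Skip = Skip"
| "clocked (Assign x e) = Assign (x + 3) (shift_expr 3 e)"
| "clocked (Seq P Q) = Seq (clocked P) (clocked Q)"
| "clocked (Cond b P Q) = Cond (shift_expr 3 b) (clocked P) (clocked Q)"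
| "clocked (While b P) =
    Seq (test b) (While (Var 2) (Seq (Assign 0 (Tl (Var 0))) (Seq (clocked P) (test b))))"
| "clocked (Query x a b) = Seq (Assign (x + 3) (Tl (Hd (Var 1)))) (Assign 1 (Tl (Var 1)))"

definition clock_state :: "tree \<Rightarrow> tree \<Rightarrow> tree \<Rightarrow> state \<Rightarrow> state" where
  "clock_state c a f s = join_state 3 (st [c, a, f]) s"

lemma clock_state_simps [simp]:
  "clock_state c a f s 0 = c" "clock_state c a f s (Suc 0) = a" "clock_state c a f s 2 = f"
  "clock_state c a f s 3 = s 0"
  "eval_expr (shift_expr 3 e) (clock_state c a f s) = eval_expr e s"
  by (simp_all add: clock_state_def) (simp_all add: join_state_def st_def)

lemma clock_state_upd:
  "(clock_state c a f s)(0 := v) = clock_state v a f s"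
  "(clock_state c a f s)(1 := v) = clock_state c v f s"
  "(clock_state c a f s)(2 := v) = clock_state c a v s"
  "(clock_state c a f s)(x + 3 := v) = clock_state c a f (s(x := v))"
  unfolding clock_state_def join_state_upd
  by (auto simp: join_state_def fun_eq_iff st_def nth_Cons' less_Suc_eq numeral_eq_Suc)

lemma clock_state_inject:
  assumes "clock_state c a f s = clock_state c' a' f' s'"
  shows "s = s'"
proof
  fix x
  from assms have "clock_state c a f s (x + 3) = clock_state c' a' f' s' (x + 3)" by simp
  then show "s x = s' x" by (simp add: clock_state_def join_state_def)
qed

lemma run_test:
  "run (test b) (clock_state c a f s) 2
     (clock_state c a (if c = Leaf then Leaf else eval_expr b s) s)"
proof (cases "c = Leaf")
  case True
  have "run (Assign 2 Lf) (clock_state c a f s) 1 (clock_state c a Leaf s)"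
    by (rule run_Assign) (simp only: clock_state_upd eval_expr.simps)
  from run_CondFalse[OF _ this, of "Var 0"] True show ?thesis
    by (simp add: test_def numeral_2_eq_2)
next
  case False
  have "run (Assign 2 (shift_expr 3 b)) (clock_state c a f s) 1 (clock_state c a (eval_expr b s) s)"
    by (rule run_Assign) (simp only: clock_state_upd clock_state_simps)
  from run_CondTrue[OF _ this, of "Var 0"] False show ?thesis
    by (simp add: test_def numeral_2_eq_2)
qed

lemma run_tick: "run (Assign 0 (Tl (Var 0))) (clock_state c a f s) 1 (clock_state (tail c) a f s)"
  by (rule run_Assign) (simp only: clock_state_upd clock_state_simps eval_expr.simps)

text \<open>The answers used up by a run are a prefix of the advice, so runs compose.\<close>

definition simulates :: "prog \<Rightarrow> state \<Rightarrow> nat \<Rightarrow> bool list \<Rightarrow> state \<Rightarrow> bool" where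
  "simulates P s t bs s' \<longleftrightarrow> (\<forall>c a f. t < dec_nat c \<longrightarrow>
     map tail (take (length bs) (dec_list a)) = map enc_bool bs \<longrightarrow>
     (\<exists>T c' f'. run (clocked P) (clock_state c a f s) T
        (clock_state c' (list_tree (drop (length bs) (dec_list a))) f' s') \<and> dec_nat c \<le> dec_nat c' + t))"

text \<open>The translation of a loop starts with an extra test, but after one iteration the rest of
  the run is again a run of the whole loop. The induction therefore speaks of the bare inner loop,
  entered with its condition already in variable 2.\<close>

definition loop_simulates :: "expr \<Rightarrow> prog \<Rightarrow> state \<Rightarrow> nat \<Rightarrow> bool list \<Rightarrow> state \<Rightarrow> bool" where
  "loop_simulates b P s t bs s' \<longleftrightarrow> (\<forall>c a. t < dec_nat c \<longrightarrow>
     map tail (take (length bs) (dec_list a)) = map enc_bool bs \<longrightarrow>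
     (\<exists>T c' f'. run (While (Var 2) (Seq (Assign 0 (Tl (Var 0))) (Seq (clocked P) (test b))))
        (clock_state c a (eval_expr b s) s) T
        (clock_state c' (list_tree (drop (length bs) (dec_list a))) f' s') \<and> dec_nat c \<le> dec_nat c' + t))"

lemma loop_simulates_imp: "loop_simulates b P s t bs s' \<Longrightarrow> simulates (While b P) s t bs s'"
  unfolding simulates_def
proof (intro allI impI)
  fix c a f
  assume L: "loop_simulates b P s t bs s'" and "t < dec_nat c"
    "map tail (take (length bs) (dec_list a)) = map enc_bool bs"
  then obtain T c' f' where R: "run (While (Var 2) (Seq (Assign 0 (Tl (Var 0))) (Seq (clocked P) (test b))))
        (clock_state c a (eval_expr b s) s) T
        (clock_state c' (list_tree (drop (length bs) (dec_list a))) f' s')" "dec_nat c \<le> dec_nat c' + t"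
    unfolding loop_simulates_def by blast
  have "run (test b) (clock_state c a f s) 2 (clock_state c a (eval_expr b s) s)"
    using run_test[of b c a f s] \<open>t < dec_nat c\<close> by (cases c) auto
  from run_Seq[OF this R(1)] R(2) show "\<exists>T c' f'. run (clocked (While b P)) (clock_state c a f s) T
        (clock_state c' (list_tree (drop (length bs) (dec_list a))) f' s') \<and> dec_nat c \<le> dec_nat c' + t"
    by auto
qed

text \<open>The equation forces the advice to be at least as long as both parts together, so cutting
  off the first part leaves advice that starts with the second.\<close>

lemma advice_append:
  assumes "map tail (take (length (bs @ bs')) (dec_list a)) = map enc_bool (bs @ bs')"
  shows "map tail (take (length bs) (dec_list a)) = map enc_bool bs"
    and "map tail (take (length bs') (dec_list (list_tree (drop (length bs) (dec_list a))))) = map enc_bool bs'"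
proof -
  have *: "map tail (take (length bs) (dec_list a)) @ map tail (take (length bs') (drop (length bs) (dec_list a)))
      = map enc_bool bs @ map enc_bool bs'"
    using assms by (simp add: take_add)
  have "length (map enc_bool (bs @ bs')) \<le> length (dec_list a)"
    unfolding assms[symmetric] by simp
  then have "length (map tail (take (length bs) (dec_list a))) = length (map enc_bool bs)"
    by simp
  with * show "map tail (take (length bs) (dec_list a)) = map enc_bool bs"
    "map tail (take (length bs') (dec_list (list_tree (drop (length bs) (dec_list a))))) = map enc_bool bs'"
    by (auto simp: append_eq_append_conv)
qed

lemma simulates_Seq:
  assumes "simulates P s t bs s'" "simulates Q s' t' bs' s''"
  shows "simulates (Seq P Q) s (t + t') (bs @ bs') s''"
  unfolding simulates_def
proof (intro allI impI)
  fix c a f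
  assume c: "t + t' < dec_nat c"
    and a: "map tail (take (length (bs @ bs')) (dec_list a)) = map enc_bool (bs @ bs')"
  let ?a = "list_tree (drop (length bs) (dec_list a))"
  from assms(1) c advice_append(1)[OF a] obtain T c' f' where
    1: "run (clocked P) (clock_state c a f s) T (clock_state c' ?a f' s')" "dec_nat c \<le> dec_nat c' + t"
    unfolding simulates_def using add_lessD1 by blast
  then have "t' < dec_nat c'" using c by linarith
  with assms(2) advice_append(2)[OF a] obtain T' c'' f'' where
    2: "run (clocked Q) (clock_state c' ?a f' s') T'
      (clock_state c'' (list_tree (drop (length bs') (dec_list ?a))) f'' s'')" "dec_nat c' \<le> dec_nat c'' + t'"
    unfolding simulates_def by blast
  from run_Seq[OF 1(1) 2(1)] 1(2) 2(2)
  show "\<exists>T c' f'. run (clocked (Seq P Q)) (clock_state c a f s) T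
        (clock_state c' (list_tree (drop (length (bs @ bs')) (dec_list a))) f' s'') \<and>
        dec_nat c \<le> dec_nat c' + (t + t')"
    by (intro exI[of _ "T + T'"] exI[of _ c''] exI[of _ f'']) (simp add: add.commute)
qed

lemma loop_simulates_True:
  assumes "eval_expr b s \<noteq> Leaf" "simulates P s t bs s'" "loop_simulates b P s' t' bs' s''"
  shows "loop_simulates b P s (1 + t + t') (bs @ bs') s''"
  unfolding loop_simulates_def
proof (intro allI impI)
  fix c a
  assume c: "1 + t + t' < dec_nat c"
    and a: "map tail (take (length (bs @ bs')) (dec_list a)) = map enc_bool (bs @ bs')"
  let ?a = "list_tree (drop (length bs) (dec_list a))"
  let ?L = "While (Var 2) (Seq (Assign 0 (Tl (Var 0))) (Seq (clocked P) (test b)))"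
  have tc: "dec_nat (tail c) = dec_nat c - 1" by (cases c) auto
  then have "t < dec_nat (tail c)" using c by simp
  with assms(2) advice_append(1)[OF a] obtain T c' f' where
    1: "run (clocked P) (clock_state (tail c) a (eval_expr b s) s) T (clock_state c' ?a f' s')"
      "dec_nat (tail c) \<le> dec_nat c' + t"
    unfolding simulates_def by blast
  \<comment> \<open>The strict time bound keeps the clock nonempty after the body, so the next test
    evaluates the real condition.\<close>
  have t': "t' < dec_nat c'" using c tc 1(2) by linarith
  with assms(3) advice_append(2)[OF a] obtain T' c'' f'' where
    2: "run ?L (clock_state c' ?a (eval_expr b s') s') T'
      (clock_state c'' (list_tree (drop (length bs') (dec_list ?a))) f'' s'')" "dec_nat c' \<le> dec_nat c'' + t'"
    unfolding loop_simulates_def by blast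
  have 3: "run (test b) (clock_state c' ?a f' s') 2 (clock_state c' ?a (eval_expr b s') s')"
    using run_test[of b c' ?a f' s'] t' by (cases c') auto
  from run_WhileTrue[OF _ run_Seq[OF run_tick run_Seq[OF 1(1) 3]] 2(1)] assms(1) 1(2) 2(2) tc
  show "\<exists>T c' f'. run ?L (clock_state c a (eval_expr b s) s) T
        (clock_state c' (list_tree (drop (length (bs @ bs')) (dec_list a))) f' s'') \<and>
        dec_nat c \<le> dec_nat c' + (1 + t + t')"
    by (intro exI[of _ "1 + (1 + (T + 2)) + T'"] exI[of _ c''] exI[of _ f''])
      (simp add: add.commute)
qed

text \<open>The answers are collected in the order of the queries. The case distinction on the
  program gives loops the stronger claim that their own induction step needs.\<close>

lemma simulates_exec_aux:
  assumes "exec orc P s t q s'"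
  shows "\<exists>bs. length bs = q \<and> (case P of While b P' \<Rightarrow> loop_simulates b P' s t bs s' | _ \<Rightarrow> simulates P s t bs s')"
  using assms
proof (induction rule: exec.induct)
  case (Skip s)
  show ?case using run_Skip by (fastforce simp: simulates_def)
next
  case (Assign x e s)
  have "run (clocked (Assign x e)) (clock_state c a f s) 1 (clock_state c a f (s(x := eval_expr e s)))"
    for c a f
    unfolding clocked.simps by (rule run_Assign) (simp only: clock_state_upd clock_state_simps)
  then show ?case by (fastforce simp: simulates_def)
next
  case (Query x e1 e2 s)
  let ?b = "orc (dec_nat (eval_expr e1 s)) (dec_nat (eval_expr e2 s))"
  have R: "run (clocked (Query x e1 e2)) (clock_state c a f s) (1 + 1)
      (clock_state c (list_tree (drop 1 (dec_list a))) f (s(x := enc_bool ?b)))"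
    if "map tail (take 1 (dec_list a)) = map enc_bool [?b]" for c a f
  proof -
    \<comment> \<open>An advice entry is a pair of a key and a value; only its tail carries the
      answer.\<close>
    have a2: "tail (head a) = enc_bool ?b" "list_tree (drop 1 (dec_list a)) = tail a"
      using that by (cases a; simp)+
    show ?thesis unfolding clocked.simps a2
    proof (rule run_Seq)
      show "run (Assign (x + 3) (Tl (Hd (Var 1)))) (clock_state c a f s) 1
          (clock_state c a f (s(x := enc_bool ?b)))"
        by (rule run_Assign) (simp add: clock_state_upd a2)
      show "run (Assign 1 (Tl (Var 1))) (clock_state c a f (s(x := enc_bool ?b))) 1
          (clock_state c (tail a) f (s(x := enc_bool ?b)))"
        by (rule run_Assign) (simp add: clock_state_upd[simplified])
    qed
  qed
  have "simulates (Query x e1 e2) s 1 [?b] (s(x := enc_bool ?b))"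
    unfolding simulates_def
  proof (intro allI impI)
    fix c a f
    assume "map tail (take (length [?b]) (dec_list a)) = map enc_bool [?b]"
    then show "\<exists>T c' f'. run (clocked (Query x e1 e2)) (clock_state c a f s) T
        (clock_state c' (list_tree (drop (length [?b]) (dec_list a))) f' (s(x := enc_bool ?b))) \<and>
        dec_nat c \<le> dec_nat c' + 1"
      using R[of a c f] by (intro exI[of _ "1 + 1"] exI[of _ c] exI[of _ f]) (simp del: clocked.simps)
  qed
  then show ?case by (intro exI[of _ "[?b]"]) auto
next
  case (Seq P s t q s' Q t' q' s'')
  have sim: "\<exists>bs. length bs = q \<and> simulates P s t bs s'"
    if "\<exists>bs. length bs = q \<and> (case P of While b P' \<Rightarrow> loop_simulates b P' s t bs s' | _ \<Rightarrow> simulates P s t bs s')"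
    for P s t q s' using that loop_simulates_imp by (cases P) auto
  obtain bs bs' where bs: "length bs = q" "length bs' = q'"
    "simulates P s t bs s'" "simulates Q s' t' bs' s''"
    using sim[OF Seq.IH(1)] sim[OF Seq.IH(2)] by blast
  from bs(1,2) simulates_Seq[OF bs(3,4)] show ?case
    by (intro exI[of _ "bs @ bs'"]) simp
next
  case (CondTrue b s P t q s' Q)
  then obtain bs where bs: "length bs = q" "simulates P s t bs s'"
    using loop_simulates_imp by (cases P) auto
  have "simulates (Cond b P Q) s (1 + t) bs s'"
    unfolding simulates_def
  proof (intro allI impI)
    fix c a f assume "1 + t < dec_nat c" "map tail (take (length bs) (dec_list a)) = map enc_bool bs"
    with bs(2) obtain T c' f' where R: "run (clocked P) (clock_state c a f s) T
        (clock_state c' (list_tree (drop (length bs) (dec_list a))) f' s')" "dec_nat c \<le> dec_nat c' + t"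
      unfolding simulates_def using Suc_lessD by (metis plus_1_eq_Suc)
    from run_CondTrue[OF _ this(1), of "shift_expr 3 b" "clocked Q"] CondTrue.hyps(1) R(2)
    show "\<exists>T c' f'. run (clocked (Cond b P Q)) (clock_state c a f s) T
        (clock_state c' (list_tree (drop (length bs) (dec_list a))) f' s') \<and> dec_nat c \<le> dec_nat c' + (1 + t)"
      by (intro exI[of _ "1 + T"] exI[of _ c'] exI[of _ f']) simp
  qed
  with bs(1) show ?case by auto
next
  case (CondFalse b s Q t q s' P)
  then obtain bs where bs: "length bs = q" "simulates Q s t bs s'"
    using loop_simulates_imp by (cases Q) auto
  have "simulates (Cond b P Q) s (1 + t) bs s'"
    unfolding simulates_def
  proof (intro allI impI)
    fix c a f assume "1 + t < dec_nat c" "map tail (take (length bs) (dec_list a)) = map enc_bool bs"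
    with bs(2) obtain T c' f' where R: "run (clocked Q) (clock_state c a f s) T
        (clock_state c' (list_tree (drop (length bs) (dec_list a))) f' s')" "dec_nat c \<le> dec_nat c' + t"
      unfolding simulates_def using Suc_lessD by (metis plus_1_eq_Suc)
    from run_CondFalse[OF _ this(1), of "shift_expr 3 b" "clocked P"] CondFalse.hyps(1) R(2)
    show "\<exists>T c' f'. run (clocked (Cond b P Q)) (clock_state c a f s) T
        (clock_state c' (list_tree (drop (length bs) (dec_list a))) f' s') \<and> dec_nat c \<le> dec_nat c' + (1 + t)"
      by (intro exI[of _ "1 + T"] exI[of _ c'] exI[of _ f']) simp
  qed
  with bs(1) show ?case by auto
next
  case (WhileFalse b s P)
  have "run (While (Var 2) R) (clock_state c a (eval_expr b s) s) 1 (clock_state c a (eval_expr b s) s)"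
    for c a R by (rule run_WhileFalse) (simp add: WhileFalse)
  then show ?case by (fastforce simp: loop_simulates_def)
next
  case (WhileTrue b s P t q s' t' q' s'')
  from WhileTrue.IH(1) obtain bs where bs: "length bs = q" "simulates P s t bs s'"
    using loop_simulates_imp by (cases P) auto
  from WhileTrue.IH(2) obtain bs' where bs': "length bs' = q'" "loop_simulates b P s' t' bs' s''"
    by auto
  from loop_simulates_True[OF WhileTrue.hyps(1) bs(2) bs'(2)] bs(1) bs'(1) show ?case
    by (intro exI[of _ "bs @ bs'"]) auto
qed

lemma simulates_exec:
  "exec orc P s t q s' \<Longrightarrow> \<exists>bs. length bs = q \<and> simulates P s t bs s'"
  using simulates_exec_aux[of orc P s t q s'] loop_simulates_imp by (cases P) auto

section \<open>Termination of the clocked program under arbitrary advice\<close>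

primrec step_cost :: "prog \<Rightarrow> nat" where
  "step_cost Skip = 1"
| "step_cost (Assign x e) = 1"
| "step_cost (Seq P Q) = step_cost P + step_cost Q"
| "step_cost (Cond b P Q) = 1 + step_cost P + step_cost Q"
| "step_cost (While b P) = step_cost P + 4"
| "step_cost (Query x a b) = 2"

primrec var_bound :: "prog \<Rightarrow> nat" where
  "var_bound Skip = 0"
| "var_bound (Assign x e) = Suc x"
| "var_bound (Seq P Q) = max (var_bound P) (var_bound Q)"
| "var_bound (Cond b P Q) = max (var_bound P) (var_bound Q)"
| "var_bound (While b P) = var_bound P"
| "var_bound (Query x a b) = Suc x"

text \<open>Time is charged to the consumed part of the clock, so nested loops share one budget
  instead of multiplying their iteration numbers. The last conjunct confines the changes to finitely
  many variables, which can be cleared afterwards.\<close>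

definition halts_within :: "nat \<Rightarrow> nat \<Rightarrow> prog \<Rightarrow> bool" where
  "halts_within B A P \<longleftrightarrow> (\<forall>c a f s. \<exists>c' a' f' s'.
     run P (clock_state c a f s) (A * (1 + (dec_nat c - dec_nat c'))) (clock_state c' a' f' s') \<and>
     dec_nat c' \<le> dec_nat c \<and> (\<forall>x\<ge>B. s' x = s x))"

lemma halts_within_mono: "halts_within B A P \<Longrightarrow> B \<le> B' \<Longrightarrow> A \<le> A' \<Longrightarrow> halts_within B' A' P"
  unfolding halts_within_def by (meson le_trans mult_le_mono1 run_mono)

lemma halts_within_clocked: "halts_within (var_bound P) (step_cost P) (clocked P)"
proof (induction P)
  case Skip
  show ?case unfolding halts_within_def
  proof (intro allI)
    fix c a f s
    show "\<exists>c' a' f' s'. run (clocked Skip) (clock_state c a f s)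
      (step_cost Skip * (1 + (dec_nat c - dec_nat c'))) (clock_state c' a' f' s') \<and>
     dec_nat c' \<le> dec_nat c \<and> (\<forall>y\<ge>var_bound Skip. s' y = s y)"
      using run_Skip[of "clock_state c a f s"]
      by (intro exI[of _ c] exI[of _ a] exI[of _ f] exI[of _ s]) simp
  qed
next
  case (Assign x e)
  show ?case unfolding halts_within_def
  proof (intro allI)
    fix c a f s
    have "run (clocked (Assign x e)) (clock_state c a f s) 1 (clock_state c a f (s(x := eval_expr e s)))"
      unfolding clocked.simps by (rule run_Assign) (simp only: clock_state_upd clock_state_simps)
    then show "\<exists>c' a' f' s'. run (clocked (Assign x e)) (clock_state c a f s)
      (step_cost (Assign x e) * (1 + (dec_nat c - dec_nat c'))) (clock_state c' a' f' s') \<and>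
     dec_nat c' \<le> dec_nat c \<and> (\<forall>y\<ge>var_bound (Assign x e). s' y = s y)"
      by (intro exI[of _ c] exI[of _ a] exI[of _ f] exI[of _ "s(x := eval_expr e s)"]) simp
  qed
next
  case (Query x e1 e2)
  show ?case unfolding halts_within_def
  proof (intro allI)
    fix c a f s
    let ?s = "s(x := tail (head a))"
    have "run (clocked (Query x e1 e2)) (clock_state c a f s) (1 + 1) (clock_state c (tail a) f ?s)"
      unfolding clocked.simps
    proof (rule run_Seq)
      show "run (Assign (x + 3) (Tl (Hd (Var 1)))) (clock_state c a f s) 1 (clock_state c a f ?s)"
        by (rule run_Assign) (simp add: clock_state_upd)
      show "run (Assign 1 (Tl (Var 1))) (clock_state c a f ?s) 1 (clock_state c (tail a) f ?s)"
        by (rule run_Assign) (simp add: clock_state_upd[simplified])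
    qed
    then show "\<exists>c' a' f' s'. run (clocked (Query x e1 e2)) (clock_state c a f s)
      (step_cost (Query x e1 e2) * (1 + (dec_nat c - dec_nat c'))) (clock_state c' a' f' s') \<and>
     dec_nat c' \<le> dec_nat c \<and> (\<forall>y\<ge>var_bound (Query x e1 e2). s' y = s y)"
      by (intro exI[of _ c] exI[of _ "tail a"] exI[of _ f] exI[of _ ?s]) (simp add: numeral_2_eq_2)
  qed
next
  case (Seq P Q)
  show ?case unfolding halts_within_def
  proof (intro allI)
    fix c a f s
    from Seq.IH(1) obtain c1 a1 f1 s1 where
      1: "run (clocked P) (clock_state c a f s) (step_cost P * (1 + (dec_nat c - dec_nat c1))) (clock_state c1 a1 f1 s1)"
       "dec_nat c1 \<le> dec_nat c" "\<forall>x\<ge>var_bound P. s1 x = s x" unfolding halts_within_def by blast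
    from Seq.IH(2) obtain c2 a2 f2 s2 where
      2: "run (clocked Q) (clock_state c1 a1 f1 s1) (step_cost Q * (1 + (dec_nat c1 - dec_nat c2))) (clock_state c2 a2 f2 s2)"
       "dec_nat c2 \<le> dec_nat c1" "\<forall>x\<ge>var_bound Q. s2 x = s1 x" unfolding halts_within_def by blast
    have "step_cost P * (1 + (dec_nat c - dec_nat c1)) + step_cost Q * (1 + (dec_nat c1 - dec_nat c2))
        \<le> step_cost (Seq P Q) * (1 + (dec_nat c - dec_nat c2))"
      unfolding step_cost.simps add_mult_distrib
      by (intro add_mono mult_left_mono) (use 1(2) 2(2) in auto)
    from run_mono[OF run_Seq[OF 1(1) 2(1)] this] 1 2 show "\<exists>c' a' f' s'. run (clocked (Seq P Q)) (clock_state c a f s)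
      (step_cost (Seq P Q) * (1 + (dec_nat c - dec_nat c'))) (clock_state c' a' f' s') \<and>
     dec_nat c' \<le> dec_nat c \<and> (\<forall>y\<ge>var_bound (Seq P Q). s' y = s y)"
      by (intro exI[of _ c2] exI[of _ a2] exI[of _ f2] exI[of _ s2]) (simp del: step_cost.simps)
  qed
next
  case (Cond b P Q)
  show ?case unfolding halts_within_def
  proof (intro allI)
    fix c a f s
    define R where "R = (if eval_expr b s = Leaf then Q else P)"
    have "halts_within (max (var_bound P) (var_bound Q)) (step_cost P + step_cost Q) (clocked R)"
      using Cond.IH by (auto simp: R_def elim!: halts_within_mono)
    then obtain c1 a1 f1 s1 where
      1: "run (clocked R) (clock_state c a f s) ((step_cost P + step_cost Q) * (1 + (dec_nat c - dec_nat c1))) (clock_state c1 a1 f1 s1)"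
       "dec_nat c1 \<le> dec_nat c" "\<forall>x\<ge>max (var_bound P) (var_bound Q). s1 x = s x" unfolding halts_within_def by blast
    have "run (clocked (Cond b P Q)) (clock_state c a f s)
       (1 + (step_cost P + step_cost Q) * (1 + (dec_nat c - dec_nat c1))) (clock_state c1 a1 f1 s1)"
      using 1(1) run_CondTrue[of "shift_expr 3 b" "clock_state c a f s" "clocked P"]
        run_CondFalse[of "shift_expr 3 b" "clock_state c a f s" "clocked Q"]
      by (auto simp: R_def split: if_splits simp del: mult_Suc_right)
    from run_mono[OF this, of "step_cost (Cond b P Q) * (1 + (dec_nat c - dec_nat c1))"] 1
    show "\<exists>c' a' f' s'. run (clocked (Cond b P Q)) (clock_state c a f s)
      (step_cost (Cond b P Q) * (1 + (dec_nat c - dec_nat c'))) (clock_state c' a' f' s') \<and>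
     dec_nat c' \<le> dec_nat c \<and> (\<forall>y\<ge>var_bound (Cond b P Q). s' y = s y)"
      by (intro exI[of _ c1] exI[of _ a1] exI[of _ f1] exI[of _ s1]) simp
  qed
next
  case (While b P)
  let ?A = "step_cost P + 4"
  let ?L = "While (Var 2) (Seq (Assign 0 (Tl (Var 0))) (Seq (clocked P) (test b)))"
  have loop: "\<exists>c' a' f' s'. run ?L (clock_state c a f s) (1 + ?A * (dec_nat c - dec_nat c')) (clock_state c' a' f' s')
      \<and> dec_nat c' \<le> dec_nat c \<and> (\<forall>x\<ge>var_bound P. s' x = s x)" if "f \<noteq> Leaf \<longrightarrow> c \<noteq> Leaf" for c a f s
    using that
  proof (induction "dec_nat c" arbitrary: c a f s rule: less_induct)
    case less
    show ?case
    proof (cases "f = Leaf")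
      case True
      then have "run ?L (clock_state c a f s) 1 (clock_state c a f s)"
        by (intro run_WhileFalse) simp
      then show ?thesis
        by (intro exI[of _ c] exI[of _ a] exI[of _ f] exI[of _ s]) simp
    next
      case False
      then obtain x d where c: "c = Node x d" using less.prems by (cases c) auto
      from While.IH obtain c1 a1 f1 s1 where
        1: "run (clocked P) (clock_state d a f s) (step_cost P * (1 + (dec_nat d - dec_nat c1))) (clock_state c1 a1 f1 s1)"
         "dec_nat c1 \<le> dec_nat d" "\<forall>x\<ge>var_bound P. s1 x = s x" unfolding halts_within_def by blast
      let ?f = "if c1 = Leaf then Leaf else eval_expr b s1"
      have "\<exists>c' a' f' s'. run ?L (clock_state c1 a1 ?f s1) (1 + ?A * (dec_nat c1 - dec_nat c')) (clock_state c' a' f' s')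
        \<and> dec_nat c' \<le> dec_nat c1 \<and> (\<forall>x\<ge>var_bound P. s' x = s1 x)"
        by (rule less.hyps) (use 1(2) c in auto)
      then obtain c2 a2 f2 s2 where
        2: "run ?L (clock_state c1 a1 ?f s1) (1 + ?A * (dec_nat c1 - dec_nat c2)) (clock_state c2 a2 f2 s2)"
          "dec_nat c2 \<le> dec_nat c1" "\<forall>x\<ge>var_bound P. s2 x = s1 x" by blast
      have tick: "run (Assign 0 (Tl (Var 0))) (clock_state c a f s) 1 (clock_state d a f s)"
        using run_tick[of c a f s] c by simp
      let ?u = "dec_nat d - dec_nat c1" and ?v = "dec_nat c1 - dec_nat c2"
      have "run ?L (clock_state c a f s) (1 + (1 + (step_cost P * (1 + ?u) + 2)) + (1 + ?A * ?v)) (clock_state c2 a2 f2 s2)"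
        by (rule run_WhileTrue[OF _ run_Seq[OF tick run_Seq[OF 1(1) run_test]] 2(1)]) (simp add: False)
      \<comment> \<open>Of the 4 in \<open>step_cost\<close>, one step is the guard, one the tick
        and two the test; the clock element consumed by this iteration pays for them.\<close>
      moreover have "1 + (1 + (step_cost P * (1 + ?u) + 2)) + (1 + ?A * ?v) \<le> 1 + ?A * (dec_nat c - dec_nat c2)"
      proof -
        have "dec_nat c - dec_nat c2 = (1 + ?u) + ?v" using 1(2) 2(2) c by simp
        then show ?thesis by (simp add: algebra_simps)
      qed
      ultimately show ?thesis using run_mono 1(2,3) 2(2,3) c
        by (intro exI[of _ c2] exI[of _ a2] exI[of _ f2] exI[of _ s2]) auto
    qed
  qed
  show ?case unfolding halts_within_def
  proof (intro allI)
    fix c a f s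
    let ?f = "if c = Leaf then Leaf else eval_expr b s"
    have "?f \<noteq> Leaf \<longrightarrow> c \<noteq> Leaf" by simp
    from loop[OF this, of a s] obtain c1 a1 f1 s1 where
      1: "run ?L (clock_state c a ?f s) (1 + ?A * (dec_nat c - dec_nat c1)) (clock_state c1 a1 f1 s1)"
        "dec_nat c1 \<le> dec_nat c" "\<forall>x\<ge>var_bound P. s1 x = s x" by blast
    from run_mono[OF run_Seq[OF run_test 1(1)], of "?A * (1 + (dec_nat c - dec_nat c1))"] 1(2,3)
    show "\<exists>c' a' f' s'. run (clocked (While b P)) (clock_state c a f s)
      (step_cost (While b P) * (1 + (dec_nat c - dec_nat c'))) (clock_state c' a' f' s') \<and>
     dec_nat c' \<le> dec_nat c \<and> (\<forall>y\<ge>var_bound (While b P). s' y = s y)"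
      by (intro exI[of _ c1] exI[of _ a1] exI[of _ f1] exI[of _ s1]) (simp add: algebra_simps)
  qed
qed

primrec clear :: "nat \<Rightarrow> prog" where
  "clear 0 = Skip"
| "clear (Suc n) = Seq (Assign (Suc n) Lf) (clear n)"

lemma run_clear:
  "run (clear n) s (1 + n) (\<lambda>x. if 0 < x \<and> x \<le> n then Leaf else s x)"
proof (induction n arbitrary: s)
  case 0
  have "s = (\<lambda>x. if 0 < x \<and> x \<le> 0 then Leaf else s x)" by (auto simp: fun_eq_iff)
  then show ?case using run_Skip[of s] by simp
next
  case (Suc n)
  have "run (Assign (Suc n) Lf) s 1 (s(Suc n := Leaf))" by (rule run_Assign) simp
  from run_Seq[OF this Suc.IH]
  have "run (clear (Suc n)) s (1 + (1 + n))
      (\<lambda>x. if 0 < x \<and> x \<le> n then Leaf else (s(Suc n := Leaf)) x)" by simp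
  also have "(\<lambda>x. if 0 < x \<and> x \<le> n then Leaf else (s(Suc n := Leaf)) x) =
      (\<lambda>x. if 0 < x \<and> x \<le> Suc n then Leaf else s x)"
    by (auto simp: fun_eq_iff le_Suc_eq)
  finally show ?case by simp
qed

text \<open>The algorithm becomes a total function of instance, advice and clock, computable in
  polynomial time whatever the advice is. It agrees with the oracle computation as soon as the clock
  exceeds the running time and the advice starts with the true answers.\<close>

lemma FP_clocked:
  "\<exists>f. FP f \<and> (\<forall>orc G t q s. exec orc P (init G) t q s \<longrightarrow>
     (\<exists>bs. length bs = q \<and> (\<forall>a c. t < dec_nat c \<longrightarrow>
        map tail (take q (dec_list a)) = map enc_bool bs \<longrightarrow> f (Node G (Node a c)) = s 0)))"
proof -
  define B where "B = var_bound P"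
  let ?pre = "Seq (Assign 3 (Hd (Var 0))) (Seq (Assign 1 (Hd (Tl (Var 0)))) (Assign 0 (Tl (Tl (Var 0)))))"
  let ?post = "Seq (Assign 0 (Var 3)) (clear (B + 3))"
  let ?Q = "Seq ?pre (Seq (clocked P) ?post)"
  have pre: "run ?pre (init v) (1 + (1 + 1))
      (clock_state (tail (tail v)) (head (tail v)) Leaf (init (head v)))" for v
  proof -
    have *: "init v = clock_state v Leaf Leaf (init Leaf)"
      by (auto simp: init_def clock_state_def join_state_def st_def nth_Cons' fun_eq_iff)
    show ?thesis unfolding *
    proof (intro run_Seq)
      have "clock_state v Leaf Leaf (init (head v)) = (clock_state v Leaf Leaf (init Leaf))(0 + 3 := head v)"
        unfolding clock_state_upd by (simp add: init_def)
      then show "run (Assign 3 (Hd (Var 0))) (clock_state v Leaf Leaf (init Leaf)) 1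
          (clock_state v Leaf Leaf (init (head v)))"
        by (intro run_Assign) simp
      show "run (Assign 1 (Hd (Tl (Var 0)))) (clock_state v Leaf Leaf (init (head v))) 1
          (clock_state v (head (tail v)) Leaf (init (head v)))"
        by (rule run_Assign) (simp only: clock_state_upd clock_state_simps eval_expr.simps)
      show "run (Assign 0 (Tl (Tl (Var 0)))) (clock_state v (head (tail v)) Leaf (init (head v))) 1
          (clock_state (tail (tail v)) (head (tail v)) Leaf (init (head v)))"
        by (rule run_Assign) (simp only: clock_state_upd clock_state_simps eval_expr.simps)
    qed
  qed
  have post: "run ?post (clock_state c a f s) (1 + (1 + (B + 3))) (init (s 0))"
    if "\<forall>x\<ge>B. s x = init g x" for c a f s g
  proof (rule run_Seq)
    show "run (Assign 0 (Var 3)) (clock_state c a f s) 1 (clock_state (s 0) a f s)"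
      by (rule run_Assign) (simp only: clock_state_upd clock_state_simps eval_expr.simps)
    have "s (x - 3) = Leaf" if "B + 3 < x" for x
      using \<open>\<forall>x\<ge>B. s x = init g x\<close> that by (auto simp: init_def)
    then have "(\<lambda>x. if 0 < x \<and> x \<le> B + 3 then Leaf else clock_state (s 0) a f s x) = init (s 0)"
      by (auto simp: fun_eq_iff init_def clock_state_def join_state_def st_def)
    then show "run (clear (B + 3)) (clock_state (s 0) a f s) (1 + (B + 3)) (init (s 0))"
      using run_clear[of "B + 3" "clock_state (s 0) a f s"] by simp
  qed
  let ?g = "\<lambda>n. (1 + (1 + 1)) + (step_cost P * (1 + n) + (1 + (1 + (B + 3))))"
  have "\<exists>w. run ?Q (init v) (?g (height v)) (init w)" for v
  proof -
    from halts_within_clocked[of P] obtain c a f s where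
      *: "run (clocked P) (clock_state (tail (tail v)) (head (tail v)) Leaf (init (head v)))
        (step_cost P * (1 + (dec_nat (tail (tail v)) - dec_nat c))) (clock_state c a f s)"
      "\<forall>x\<ge>B. s x = init (head v) x"
      unfolding halts_within_def B_def by blast
    have "dec_nat (tail (tail v)) \<le> height v"
      by (cases v rule: tree.exhaust; cases "tail v" rule: tree.exhaust)
        (auto intro: order_trans[OF dec_nat_le_height])
    then have "step_cost P * (1 + (dec_nat (tail (tail v)) - dec_nat c)) \<le> step_cost P * (1 + height v)"
      by (intro mult_left_mono) auto
    from run_Seq[OF pre run_Seq[OF run_mono[OF *(1) this] post[OF *(2)]]] show ?thesis by blast
  qed
  \<comment> \<open>Termination on all inputs makes the result a function, even for meaningless
    advice.\<close>
  then obtain F where F: "\<And>v. run ?Q (init v) (?g (height v)) (init (F v))" by metis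
  have "FP F" by (rule FP_I[OF _ F]) (intro poly_bounded_intros)
  moreover have "\<exists>bs. length bs = q \<and> (\<forall>a c. t < dec_nat c \<longrightarrow>
        map tail (take q (dec_list a)) = map enc_bool bs \<longrightarrow> F (Node G (Node a c)) = s 0)"
    if ex: "exec orc P (init G) t q s" for orc G t q s
  proof -
    from simulates_exec[OF ex] obtain bs where bs: "length bs = q" "simulates P (init G) t bs s" by blast
    have "F (Node G (Node a c)) = s 0"
      if "t < dec_nat c" "map tail (take q (dec_list a)) = map enc_bool bs" for a c
    proof -
      from bs that obtain T c' f' where
        *: "run (clocked P) (clock_state c a Leaf (init G)) T
          (clock_state c' (list_tree (drop q (dec_list a))) f' s)"
        unfolding simulates_def by blast
      \<comment> \<open>Determinism identifies the simulated run with the one from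
        \<open>halts_within_clocked\<close>, for which the higher variables are known to keep their
        initial values.\<close>
      have agree: "\<forall>x\<ge>B. s x = init G x"
      proof -
        from halts_within_clocked[of P] obtain c2 a2 f2 s2 where
          "run (clocked P) (clock_state c a Leaf (init G))
            (step_cost P * (1 + (dec_nat c - dec_nat c2))) (clock_state c2 a2 f2 s2)"
          and s2: "\<forall>x\<ge>B. s2 x = init G x"
          unfolding halts_within_def B_def by blast
        from run_unique[OF * this(1)] have "s2 = s"
          by (rule clock_state_inject)
        with s2 show ?thesis by simp
      qed
      have "run ?Q (init (Node G (Node a c))) ((1 + (1 + 1)) + (T + (1 + (1 + (B + 3))))) (init (s 0))"
        using run_Seq[OF pre[of "Node G (Node a c)"] run_Seq[OF _ post[OF agree]]] * by simp
      from run_unique[OF this F] have "init (F (Node G (Node a c))) 0 = init (s 0) 0" by simp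
      then show ?thesis by (simp add: init_def)
    qed
    with bs(1) show ?thesis by blast
  qed
  ultimately show ?thesis by blast
qed

section \<open>Grids of cliques\<close>

definition off_diag :: "nat set \<Rightarrow> (nat \<times> nat) set" where
  "off_diag I = {p \<in> I \<times> I. fst p \<noteq> snd p}"

lemma finite_off_diag [simp]: "finite I \<Longrightarrow> finite (off_diag I)"
  by (auto simp: off_diag_def intro: rev_finite_subset[of "I \<times> I"])

lemma off_diag_Sigma: "off_diag I = (SIGMA i:I. I - {i})"
  by (auto simp: off_diag_def)

lemma real_card_remove: "finite I \<Longrightarrow> i \<in> I \<Longrightarrow> real (card (I - {i})) = real (card I) - 1"
  using card.remove[of I i] by simp

lemma sum_off_diag:
  "finite I \<Longrightarrow> (\<Sum>p\<in>off_diag I. f (fst p) (snd p)) = (\<Sum>i\<in>I. \<Sum>i'\<in>I-{i}. f i i')"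
  unfolding off_diag_Sigma using sum.Sigma[of I "\<lambda>i. I - {i}" f] by (simp add: case_prod_beta')

lemma card_off_diag: "finite I \<Longrightarrow> real (card (off_diag I)) = real (card I) * (real (card I) - 1)"
proof -
  assume I: "finite I"
  have "real (card (off_diag I)) = (\<Sum>i\<in>I. real (card (I - {i})))"
    using I by (simp add: off_diag_Sigma card_SigmaI)
  also have "\<dots> = (\<Sum>i\<in>I. real (card I) - 1)"
    by (rule sum.cong[OF refl real_card_remove[OF I]])
  finally show ?thesis by simp
qed

lemma sum_off_diag_swap:
  "(\<Sum>p\<in>off_diag I. f (snd p) (fst p)) = (\<Sum>p\<in>off_diag I. f (fst p) (snd p))"
  by (rule sum.reindex_bij_witness[of _ prod.swap prod.swap]) (auto simp: off_diag_def)

lemma sum_off_diag_fst: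
  fixes f :: "nat \<Rightarrow> real"
  assumes "finite I"
  shows "(\<Sum>p\<in>off_diag I. f (fst p)) = (real (card I) - 1) * (\<Sum>i\<in>I. f i)"
proof -
  have "(\<Sum>p\<in>off_diag I. f (fst p)) = (\<Sum>i\<in>I. \<Sum>i'\<in>I-{i}. f i)"
    by (rule sum_off_diag[OF assms])
  also have "\<dots> = (\<Sum>i\<in>I. (real (card I) - 1) * f i)"
    by (rule sum.cong) (use real_card_remove[OF assms] in simp_all)
  finally show ?thesis by (simp add: sum_distrib_left)
qed

lemma sum_off_diag_snd:
  fixes f :: "nat \<Rightarrow> real"
  assumes "finite I"
  shows "(\<Sum>p\<in>off_diag I. f (snd p)) = (real (card I) - 1) * (\<Sum>i\<in>I. f i)"
  using sum_off_diag_swap[of "\<lambda>a b. f a" I] sum_off_diag_fst[OF assms, of f] by simp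

text \<open>Deviations from the mean cancel, so the positive ones make up half of the absolute ones;
  and the deviation of one value is the average of its differences to all values.\<close>

lemma sum_mean_deviation_le:
  fixes f :: "nat \<Rightarrow> real"
  assumes "finite I" "I \<noteq> {}"
  shows "(\<Sum>i\<in>I. max 0 (f i - (\<Sum>i\<in>I. f i) / real (card I))) \<le>
    (\<Sum>p\<in>off_diag I. \<bar>f (fst p) - f (snd p)\<bar>) / (2 * real (card I))"
proof -
  define \<mu> where "\<mu> = (\<Sum>i\<in>I. f i) / card I"
  let ?n = "real (card I)"
  have n: "?n > 0" using assms by (simp add: card_gt_0_iff)
  have "(\<Sum>i\<in>I. f i - \<mu>) = 0" using n by (simp add: sum_subtractf \<mu>_def)
  then have "2 * (\<Sum>i\<in>I. max 0 (f i - \<mu>)) = (\<Sum>i\<in>I. 2 * max 0 (f i - \<mu>)) - (\<Sum>i\<in>I. f i - \<mu>)"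
    by (simp add: sum_distrib_left)
  also have "\<dots> = (\<Sum>i\<in>I. \<bar>f i - \<mu>\<bar>)"
    unfolding sum_subtractf[symmetric] by (rule sum.cong) (auto simp: max_def abs_if)
  also have "\<dots> \<le> (\<Sum>i\<in>I. (\<Sum>i'\<in>I-{i}. \<bar>f i - f i'\<bar>) / ?n)"
  proof (rule sum_mono)
    fix i assume i: "i \<in> I"
    have "f i - \<mu> = (\<Sum>i'\<in>I. f i - f i') / ?n"
      using n by (simp add: sum_subtractf \<mu>_def field_simps)
    then have "\<bar>f i - \<mu>\<bar> = \<bar>\<Sum>i'\<in>I. f i - f i'\<bar> / ?n" using n by simp
    also have "\<dots> \<le> (\<Sum>i'\<in>I. \<bar>f i - f i'\<bar>) / ?n" using n by (intro divide_right_mono sum_abs) auto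
    also have "(\<Sum>i'\<in>I. \<bar>f i - f i'\<bar>) = (\<Sum>i'\<in>I-{i}. \<bar>f i - f i'\<bar>)"
      using i assms(1) by (subst sum.remove[of I i]) auto
    finally show "\<bar>f i - \<mu>\<bar> \<le> (\<Sum>i'\<in>I-{i}. \<bar>f i - f i'\<bar>) / ?n" .
  qed
  also have "\<dots> = (\<Sum>p\<in>off_diag I. \<bar>f (fst p) - f (snd p)\<bar>) / ?n"
    by (simp add: sum_off_diag[OF assms(1), of "\<lambda>i i'. \<bar>f i - f i'\<bar>"] sum_divide_distrib)
  finally show ?thesis using n unfolding \<mu>_def by (simp add: field_simps)
qed

section \<open>Labelings of a square grid and their 4-cycles\<close>

locale grid =
  fixes I :: "nat set" and L :: "nat \<Rightarrow> nat \<Rightarrow> 'l"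
  assumes finI: "finite I" and neI: "I \<noteq> {}"
begin

abbreviation "n \<equiv> real (card I)"

definition eq :: "'l \<Rightarrow> 'l \<Rightarrow> real" where "eq u v = of_bool (u = v)"

definition row :: "nat \<Rightarrow> real" where
  "row i = (\<Sum>q\<in>off_diag I. eq (L i (fst q)) (L i (snd q)))"

definition col :: "nat \<Rightarrow> real" where
  "col k = (\<Sum>p\<in>off_diag I. eq (L (fst p) k) (L (snd p) k))"

definition diag :: real where
  "diag = (\<Sum>p\<in>off_diag I. \<Sum>q\<in>off_diag I. eq (L (fst p) (fst q)) (L (snd p) (snd q)))"

text \<open>All counts are in ordered pairs. Clustering by rows costs n^2 (n - 1), because it cuts n
  (n - 1) pairs in each of the n columns; by \<open>grid_cost\<close>, \<open>excess\<close> is what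
  a labeling costs beyond that.\<close>

definition excess :: real where
  "excess = n\<^sup>2 * (n - 1) - (\<Sum>i\<in>I. row i) - (\<Sum>k\<in>I. col k) + diag"

definition all4 :: real where
  "all4 = (\<Sum>p\<in>off_diag I. \<Sum>q\<in>off_diag I.
     of_bool (L (fst p) (fst q) = L (fst p) (snd q) \<and> L (fst p) (fst q) = L (snd p) (fst q) \<and>
       L (fst p) (fst q) = L (snd p) (snd q)))"

lemma n_ge_1: "n \<ge> 1"
  using finI neI by (simp add: Suc_leI card_gt_0_iff)

text \<open>For the 4-cycle with rows \<open>p\<close> and columns \<open>q\<close>: the number of
  cut sides beyond two, plus \<open>c\<close> for each joined diagonal. A side lies in n - 1 such
  cycles but a diagonal in only one, so c = n - 1 makes the total proportional to
  \<open>excess\<close>.\<close>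

definition quad :: "real \<Rightarrow> nat \<times> nat \<Rightarrow> nat \<times> nat \<Rightarrow> real" where
  "quad c p q = 2 - eq (L (fst p) (fst q)) (L (fst p) (snd q)) - eq (L (snd p) (fst q)) (L (snd p) (snd q))
     - eq (L (fst p) (fst q)) (L (snd p) (fst q)) - eq (L (fst p) (snd q)) (L (snd p) (snd q))
     + c * (eq (L (fst p) (fst q)) (L (snd p) (snd q)) + eq (L (fst p) (snd q)) (L (snd p) (fst q)))"

lemma sum_rows:
  "(\<Sum>p\<in>off_diag I. \<Sum>q\<in>off_diag I. eq (L (fst p) (fst q)) (L (fst p) (snd q))) = (n - 1) * (\<Sum>i\<in>I. row i)"
  "(\<Sum>p\<in>off_diag I. \<Sum>q\<in>off_diag I. eq (L (snd p) (fst q)) (L (snd p) (snd q))) = (n - 1) * (\<Sum>i\<in>I. row i)"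
  unfolding row_def[symmetric] using sum_off_diag_fst[OF finI] sum_off_diag_snd[OF finI] by auto

lemma sum_cols:
  "(\<Sum>p\<in>off_diag I. \<Sum>q\<in>off_diag I. eq (L (fst p) (fst q)) (L (snd p) (fst q))) = (n - 1) * (\<Sum>k\<in>I. col k)"
  "(\<Sum>p\<in>off_diag I. \<Sum>q\<in>off_diag I. eq (L (fst p) (snd q)) (L (snd p) (snd q))) = (n - 1) * (\<Sum>k\<in>I. col k)"
  unfolding col_def[symmetric] using sum_off_diag_fst[OF finI] sum_off_diag_snd[OF finI]
  by (subst sum.swap, simp add: col_def[symmetric])+

lemma sum_diag2:
  "(\<Sum>p\<in>off_diag I. \<Sum>q\<in>off_diag I. eq (L (fst p) (snd q)) (L (snd p) (fst q))) = diag"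
  unfolding diag_def
  by (rule sum.cong[OF refl]) (rule sum_off_diag_swap[of "\<lambda>a b. eq (L (fst p) a) (L (snd p) b)" for p])

lemma sum_quad:
  "(\<Sum>p\<in>off_diag I. \<Sum>q\<in>off_diag I. quad (n - 1) p q) = 2 * (n - 1) * excess"
proof -
  have "(\<Sum>p\<in>off_diag I. \<Sum>q\<in>off_diag I. quad (n - 1) p q) =
      2 * (n * (n - 1)) * (n * (n - 1)) - 2 * ((n - 1) * (\<Sum>i\<in>I. row i)) - 2 * ((n - 1) * (\<Sum>k\<in>I. col k))
      + (n - 1) * (diag + diag)"
    unfolding quad_def
    by (simp add: sum.distrib sum_subtractf sum_rows sum_cols sum_diag2 diag_def[symmetric]
      card_off_diag[OF finI] flip: sum_distrib_left)
  also have "\<dots> = 2 * (n - 1) * excess"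
    by (simp add: excess_def algebra_simps power2_eq_square)
  finally show ?thesis .
qed

text \<open>Only with diagonals of weight at least 2, i.e. in a grid with at least three rows, does a 4-cycle
  pay for every difference between its two rows and between its two columns.\<close>

lemma quad_lower:
  assumes "c \<ge> 2"
  shows "quad c p q \<ge>
    \<bar>eq (L (fst p) (fst q)) (L (fst p) (snd q)) - eq (L (snd p) (fst q)) (L (snd p) (snd q))\<bar> +
    \<bar>eq (L (fst p) (fst q)) (L (snd p) (fst q)) - eq (L (fst p) (snd q)) (L (snd p) (snd q))\<bar> +
    2 * of_bool (L (fst p) (fst q) = L (fst p) (snd q) \<and> L (fst p) (fst q) = L (snd p) (fst q) \<and>
       L (fst p) (fst q) = L (snd p) (snd q))"
  using assms unfolding quad_def eq_def
  by (auto simp: of_bool_def split: if_splits)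

text \<open>A negative value would need more than two joined sides; then all four labels coincide,
  and the two diagonals pay for it.\<close>

lemma quad_nonneg: "c \<ge> 1 \<Longrightarrow> quad c p q \<ge> 0"
  unfolding quad_def eq_def by (auto simp: of_bool_def split: if_splits)

lemma excess_nonneg: "excess \<ge> 0"
proof (cases "card I = 1")
  case True
  then have "off_diag I = {}" by (auto simp: off_diag_def card_1_singleton_iff)
  then show ?thesis using True by (simp add: excess_def row_def col_def diag_def)
next
  case False
  then have n: "n \<ge> 2" using n_ge_1 by linarith
  have "0 \<le> (\<Sum>p\<in>off_diag I. \<Sum>q\<in>off_diag I. quad (n - 1) p q)"
    using n by (intro sum_nonneg quad_nonneg) auto
  with n show ?thesis unfolding sum_quad by (simp add: zero_le_mult_iff)
qed

lemma excess_lower: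
  assumes "card I \<ge> 3"
  shows "2 * (n - 1) * excess \<ge> (\<Sum>p\<in>off_diag I. \<bar>row (fst p) - row (snd p)\<bar>) +
    (\<Sum>q\<in>off_diag I. \<bar>col (fst q) - col (snd q)\<bar>) + 2 * all4"
proof -
  let ?A = "\<lambda>p q. eq (L (fst p) (fst q)) (L (fst p) (snd q)) - eq (L (snd p) (fst q)) (L (snd p) (snd q))"
  let ?B = "\<lambda>p q. eq (L (fst p) (fst q)) (L (snd p) (fst q)) - eq (L (fst p) (snd q)) (L (snd p) (snd q))"
  have "(\<Sum>p\<in>off_diag I. \<bar>row (fst p) - row (snd p)\<bar>) \<le> (\<Sum>p\<in>off_diag I. \<Sum>q\<in>off_diag I. \<bar>?A p q\<bar>)"
    unfolding row_def sum_subtractf[symmetric] by (intro sum_mono sum_abs)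
  moreover have "(\<Sum>q\<in>off_diag I. \<bar>col (fst q) - col (snd q)\<bar>) \<le> (\<Sum>q\<in>off_diag I. \<Sum>p\<in>off_diag I. \<bar>?B p q\<bar>)"
    unfolding col_def sum_subtractf[symmetric] by (intro sum_mono sum_abs)
  moreover have "(\<Sum>q\<in>off_diag I. \<Sum>p\<in>off_diag I. \<bar>?B p q\<bar>) = (\<Sum>p\<in>off_diag I. \<Sum>q\<in>off_diag I. \<bar>?B p q\<bar>)"
    by (rule sum.swap)
  moreover have "(\<Sum>p\<in>off_diag I. \<Sum>q\<in>off_diag I. \<bar>?A p q\<bar>) + (\<Sum>p\<in>off_diag I. \<Sum>q\<in>off_diag I. \<bar>?B p q\<bar>) + 2 * all4
     \<le> (\<Sum>p\<in>off_diag I. \<Sum>q\<in>off_diag I. quad (n - 1) p q)"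
    unfolding all4_def sum_distrib_left sum.distrib[symmetric]
    by (intro sum_mono quad_lower) (use assms in simp)
  ultimately show ?thesis unfolding sum_quad by linarith
qed

text \<open>Three joined sides of a 4-cycle force the fourth, so at most two are joined unless the
  cycle is monochromatic. Rows and columns cannot both be dense without many monochromatic
  cycles.\<close>

lemma row_col_le: "(n - 1) * ((\<Sum>i\<in>I. row i) + (\<Sum>k\<in>I. col k)) \<le> (n * (n - 1))\<^sup>2 + all4"
proof -
  have "2 * ((n - 1) * ((\<Sum>i\<in>I. row i) + (\<Sum>k\<in>I. col k))) =
    (\<Sum>p\<in>off_diag I. \<Sum>q\<in>off_diag I. eq (L (fst p) (fst q)) (L (fst p) (snd q)) +
      eq (L (snd p) (fst q)) (L (snd p) (snd q)) +
      (eq (L (fst p) (fst q)) (L (snd p) (fst q)) + eq (L (fst p) (snd q)) (L (snd p) (snd q))))"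
    by (simp add: sum.distrib sum_rows sum_cols algebra_simps)
  also have "\<dots> \<le> (\<Sum>p\<in>off_diag I. \<Sum>q\<in>off_diag I. 2 + 2 *
     of_bool (L (fst p) (fst q) = L (fst p) (snd q) \<and> L (fst p) (fst q) = L (snd p) (fst q) \<and>
       L (fst p) (fst q) = L (snd p) (snd q)))"
    by (intro sum_mono) (auto simp: eq_def of_bool_def)
  also have "\<dots> = 2 * ((n * (n - 1)) * (n * (n - 1))) + 2 * all4"
    unfolding all4_def by (simp add: sum.distrib card_off_diag[OF finI] flip: sum_distrib_left)
  finally show ?thesis by (simp add: power2_eq_square)
qed

lemma row_bounds: "0 \<le> row i" "row i \<le> n * (n - 1)"
proof -
  show "0 \<le> row i" unfolding row_def eq_def by (intro sum_nonneg) auto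
  have "row i \<le> (\<Sum>q\<in>off_diag I. 1)" unfolding row_def eq_def by (intro sum_mono) auto
  then show "row i \<le> n * (n - 1)" by (simp add: card_off_diag[OF finI])
qed

text \<open>A grid cut into rows has mode 1, one cut into columns mode 0. In general \<tau> is the
  mean row density. By \<open>row_col_le\<close> the mean column density exceeds 1 - \<tau> at most
  by the density of monochromatic 4-cycles, and \<open>excess_lower\<close> pays for these as well
  as for the deviations of single lines from their mean.\<close>

lemma fractional_mode:
  assumes "card I \<ge> 3"
  shows "\<exists>\<tau>. 0 \<le> \<tau> \<and> \<tau> \<le> 1 \<and>
    (\<Sum>i\<in>I. max 0 (row i / (n * (n - 1)) - \<tau>)) + (\<Sum>k\<in>I. max 0 (col k / (n * (n - 1)) - (1 - \<tau>)))
      \<le> 15 / 8 * excess / n\<^sup>2"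
proof -
  define c where "c = n * (n - 1)"
  have n: "n \<ge> 3" using assms by simp
  have c: "c > 0" using n by (simp add: c_def)
  define \<rho> where "\<rho> i = row i / c" for i
  define \<chi> where "\<chi> k = col k / c" for k
  define \<tau> where "\<tau> = (\<Sum>i\<in>I. \<rho> i) / n"
  define \<kappa> where "\<kappa> = (\<Sum>k\<in>I. \<chi> k) / n"
  have \<rho>01: "0 \<le> \<rho> i" "\<rho> i \<le> 1" for i
    using row_bounds[of i] c by (auto simp: \<rho>_def c_def)
  have "0 \<le> \<tau>" unfolding \<tau>_def using \<rho>01 by (intro divide_nonneg_nonneg sum_nonneg) auto
  have "(\<Sum>i\<in>I. \<rho> i) \<le> (\<Sum>i\<in>I. 1)" by (intro sum_mono \<rho>01)
  then have "\<tau> \<le> 1" unfolding \<tau>_def using n by simp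
  have "(n - 1) * ((\<Sum>i\<in>I. row i) + (\<Sum>k\<in>I. col k)) / c\<^sup>2 \<le> (c\<^sup>2 + all4) / c\<^sup>2"
    using row_col_le by (intro divide_right_mono) (auto simp: c_def)
  also have "(n - 1) * ((\<Sum>i\<in>I. row i) + (\<Sum>k\<in>I. col k)) / c\<^sup>2 = \<tau> + \<kappa>"
  proof -
    have "c\<^sup>2 = (n - 1) * (n * c)" by (simp add: c_def power2_eq_square)
    then show ?thesis using n
      unfolding \<tau>_def \<kappa>_def \<rho>_def \<chi>_def sum_divide_distrib[symmetric]
      by (simp add: add_divide_distrib mult.commute)
  qed
  also have "(c\<^sup>2 + all4) / c\<^sup>2 = 1 + all4 / c\<^sup>2" using c by (simp add: field_simps)
  finally have \<tau>\<kappa>: "\<kappa> - (1 - \<tau>) \<le> all4 / c\<^sup>2" by simp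
  have all4: "all4 \<ge> 0" unfolding all4_def by (intro sum_nonneg) auto
  have 1: "(\<Sum>i\<in>I. max 0 (\<rho> i - \<tau>)) \<le> (\<Sum>p\<in>off_diag I. \<bar>\<rho> (fst p) - \<rho> (snd p)\<bar>) / (2 * n)"
    unfolding \<tau>_def by (rule sum_mean_deviation_le[OF finI neI])
  have 2: "(\<Sum>k\<in>I. max 0 (\<chi> k - (1 - \<tau>))) \<le> (\<Sum>p\<in>off_diag I. \<bar>\<chi> (fst p) - \<chi> (snd p)\<bar>) / (2 * n) + n * (all4 / c\<^sup>2)"
  proof -
    have "(\<Sum>k\<in>I. max 0 (\<chi> k - (1 - \<tau>))) \<le> (\<Sum>k\<in>I. max 0 (\<chi> k - \<kappa>) + all4 / c\<^sup>2)"
    proof (rule sum_mono)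
      fix k
      have "all4 / c\<^sup>2 \<ge> 0" using all4 by simp
      then show "max 0 (\<chi> k - (1 - \<tau>)) \<le> max 0 (\<chi> k - \<kappa>) + all4 / c\<^sup>2"
        using \<tau>\<kappa> by (auto simp: max_def)
    qed
    also have "\<dots> = (\<Sum>k\<in>I. max 0 (\<chi> k - \<kappa>)) + n * (all4 / c\<^sup>2)" by (simp add: sum.distrib)
    also have "(\<Sum>k\<in>I. max 0 (\<chi> k - \<kappa>)) \<le> (\<Sum>p\<in>off_diag I. \<bar>\<chi> (fst p) - \<chi> (snd p)\<bar>) / (2 * n)"
      unfolding \<kappa>_def by (rule sum_mean_deviation_le[OF finI neI])
    finally show ?thesis by simp
  qed
  have scale: "(\<Sum>p\<in>off_diag I. \<bar>f (fst p) / c - f (snd p) / c\<bar>) = (\<Sum>p\<in>off_diag I. \<bar>f (fst p) - f (snd p)\<bar>) / c"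
    for f :: "nat \<Rightarrow> real"
    using c by (simp add: sum_divide_distrib flip: diff_divide_distrib)
  define Sr where "Sr = (\<Sum>p\<in>off_diag I. \<bar>row (fst p) - row (snd p)\<bar>)"
  define Sc where "Sc = (\<Sum>p\<in>off_diag I. \<bar>col (fst p) - col (snd p)\<bar>)"
  have nonneg: "Sr \<ge> 0" "Sc \<ge> 0" unfolding Sr_def Sc_def by (intro sum_nonneg, simp)+
  have "(\<Sum>i\<in>I. max 0 (\<rho> i - \<tau>)) + (\<Sum>k\<in>I. max 0 (\<chi> k - (1 - \<tau>)))
      \<le> Sr / c / (2 * n) + (Sc / c / (2 * n) + n * (all4 / c\<^sup>2))"
    using 1 2 unfolding \<rho>_def \<chi>_def scale Sr_def Sc_def by linarith
  also have "\<dots> = (Sr / 2 + Sc / 2 + n / (n - 1) * all4) / (n\<^sup>2 * (n - 1))"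
  proof -
    have "n\<^sup>2 * (n - 1) = n * c" "c\<^sup>2 = (n - 1) * (n * c)"
      by (simp_all add: c_def power2_eq_square)
    then show ?thesis by (simp add: add_divide_distrib mult.commute mult.left_commute)
  qed
  also have "\<dots> \<le> (15 / 16 * (Sr + Sc + 2 * all4)) / (n\<^sup>2 * (n - 1))"
  proof (rule divide_right_mono)
    \<comment> \<open>Three rows give 3/2. The value 15/8 is the inverse of the 8/15 that multiplies
      R^2 in \<open>excess_scaled\<close>, where the two cancel.\<close>
    have "n / (n - 1) \<le> 15 / 8" using n by (simp add: field_simps)
    then have le: "n / (n - 1) * all4 \<le> 15 / 8 * all4" using all4 by (rule mult_right_mono)
    have lin: "a / 2 + b / 2 + z \<le> 15 / 16 * (a + b + 2 * w)"
      if "z \<le> 15 / 8 * w" "a \<ge> 0" "b \<ge> 0" for a b z w :: real using that by simp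
    show "Sr / 2 + Sc / 2 + n / (n - 1) * all4 \<le> 15 / 16 * (Sr + Sc + 2 * all4)"
      by (rule lin[OF le nonneg])
  qed (use n in simp)
  also have "\<dots> \<le> (15 / 16 * (2 * (n - 1) * excess)) / (n\<^sup>2 * (n - 1))"
    using excess_lower[OF assms] n unfolding Sr_def Sc_def
    by (intro divide_right_mono mult_left_mono) auto
  also have "\<dots> = 15 / 8 * excess / n\<^sup>2" using n by (simp add: field_simps)
  finally show ?thesis
    using \<open>0 \<le> \<tau>\<close> \<open>\<tau> \<le> 1\<close> unfolding \<rho>_def \<chi>_def c_def by blast
qed

lemma sum_plus_off_diag:
  fixes f :: "nat \<Rightarrow> nat \<Rightarrow> real"
  shows "(\<Sum>i\<in>I. \<Sum>i'\<in>I. f i i') = (\<Sum>i\<in>I. f i i) + (\<Sum>p\<in>off_diag I. f (fst p) (snd p))"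
proof -
  have "(\<Sum>i\<in>I. \<Sum>i'\<in>I. f i i') = (\<Sum>i\<in>I. f i i + (\<Sum>i'\<in>I-{i}. f i i'))"
    by (rule sum.cong) (auto simp: sum.remove[OF finI])
  then show ?thesis by (simp add: sum.distrib sum_off_diag[OF finI, of f])
qed

lemma grid_cost:
  "(\<Sum>i\<in>I. \<Sum>i'\<in>I. \<Sum>k\<in>I. \<Sum>k'\<in>I. of_bool ((i = i' \<or> k = k') \<noteq> (L i k = L i' k'))) = n\<^sup>2 * (n - 1) + excess"
proof -
  let ?F = "\<lambda>i i' k k'. of_bool ((i = i' \<or> k = k') \<noteq> (L i k = L i' k')) :: real"
  have "(\<Sum>i\<in>I. \<Sum>i'\<in>I. \<Sum>k\<in>I. \<Sum>k'\<in>I. ?F i i' k k') =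
    (\<Sum>i\<in>I. \<Sum>q\<in>off_diag I. ?F i i (fst q) (snd q)) +
    (\<Sum>p\<in>off_diag I. (\<Sum>k\<in>I. ?F (fst p) (snd p) k k) + (\<Sum>q\<in>off_diag I. ?F (fst p) (snd p) (fst q) (snd q)))"
    unfolding sum_plus_off_diag by simp
  also have "\<dots> = (\<Sum>i\<in>I. \<Sum>q\<in>off_diag I. 1 - eq (L i (fst q)) (L i (snd q))) +
    ((\<Sum>k\<in>I. \<Sum>p\<in>off_diag I. 1 - eq (L (fst p) k) (L (snd p) k)) + diag)"
    unfolding sum.distrib diag_def
    by (subst sum.swap[of _ I "off_diag I"], intro arg_cong2[of _ _ _ _ "(+)"] sum.cong)
      (auto simp: eq_def off_diag_def of_bool_def)
  also have "\<dots> = (n * (n * (n - 1)) - (\<Sum>i\<in>I. row i)) + ((n * (n * (n - 1)) - (\<Sum>k\<in>I. col k)) + diag)"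
    by (simp add: sum_subtractf row_def[symmetric] col_def[symmetric] card_off_diag[OF finI])
  finally show ?thesis by (simp add: excess_def power2_eq_square algebra_simps)
qed

lemma pairs_in_class_le:
  assumes "S \<subseteq> I"
  shows "real (card S) * (real (card S) - 1) = (\<Sum>q\<in>off_diag I. of_bool (fst q \<in> S \<and> snd q \<in> S))"
proof -
  have "off_diag S = {q \<in> off_diag I. fst q \<in> S \<and> snd q \<in> S}"
    using assms by (auto simp: off_diag_def)
  then show ?thesis
    using card_off_diag[of S] finite_subset[OF assms finI] finI
    by (simp add: of_bool_def sum.If_cases Int_def conj_commute)
qed

end

text \<open>On [0, 1] this is the piecewise linear function through (0, 1), (1/3, 1), (2/3, 2/3) and
  (1, 0): the fractions of pairs not inside a class of 0, 1, 2 or 3 out of three points.\<close>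

definition defect :: "real \<Rightarrow> real" where
  "defect f = min 1 (min (4 / 3 - f) (2 - 2 * f))"

lemma defect_le: "defect f \<le> 1" "defect f \<le> 4 / 3 - f" "defect f \<le> 2 - 2 * f"
  unfolding defect_def by linarith+

lemma defect_nonneg: "f \<le> 1 \<Longrightarrow> defect f \<ge> 0"
  by (auto simp: defect_def)

text \<open>A class of \<open>m\<close> out of \<open>n \<ge> 3\<close> points covers the fraction \<open>m (m - 1) / (n (n - 1))\<close> of the pairs.\<close>

lemma pairs_defect:
  fixes m n :: nat
  assumes "m \<le> n" "n \<ge> 3"
  shows "1 - real m * (real m - 1) / (real n * (real n - 1)) \<le> defect (real m / real n)"
proof -
  define M N where "M = real m" and "N = real n"
  have N: "N \<ge> 3" and MN: "0 \<le> M" "M \<le> N" using assms by (auto simp: M_def N_def)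
  have pos: "N * (N - 1) > 0" using N by simp
  have M1: "M * (M - 1) \<ge> 0" by (cases m) (auto simp: M_def)
  have a: "1 - M * (M - 1) / (N * (N - 1)) \<le> 1" using M1 pos by simp
  \<comment> \<open>Integrality matters: for M strictly between N - 1 and N the next inequality
    would fail.\<close>
  have "M = N \<or> M \<le> N - 1" using assms(1) by (auto simp: M_def N_def)
  then have "(N - M) * (N + M - 1) \<le> (N - M) * (2 * (N - 1))"
    using MN by (elim disjE) (auto intro: mult_left_mono)
  then have "(N - M) * (N + M - 1) / (N * (N - 1)) \<le> (N - M) * (2 * (N - 1)) / (N * (N - 1))"
    using pos by (intro divide_right_mono) auto
  moreover have "(N - M) * (N + M - 1) / (N * (N - 1)) = 1 - M * (M - 1) / (N * (N - 1))"
    using N by (simp add: field_simps)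
  moreover have "(N - M) * (2 * (N - 1)) / (N * (N - 1)) = 2 - 2 * (M / N)"
    using N by (simp add: divide_simps) (simp add: algebra_simps)
  ultimately have b: "1 - M * (M - 1) / (N * (N - 1)) \<le> 2 - 2 * (M / N)" by simp
  \<comment> \<open>M (N - M) is at most N^2 / 4, which suffices from N = 4 on. For N = 3 the four
    values of M are checked; there is equality at 1 and 2.\<close>
  have "3 * M * (N - M) \<le> N * (N - 1)"
  proof (cases "n = 3")
    case True
    then have "m = 0 \<or> m = 1 \<or> m = 2 \<or> m = 3" using assms by auto
    with True show ?thesis by (auto simp: M_def N_def)
  next
    case False
    then have "N \<ge> 4" using assms by (auto simp: N_def)
    then have "N * 4 \<le> N * N" by (intro mult_left_mono) auto
    moreover have "(N - 2 * M)\<^sup>2 \<ge> 0" by simp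
    ultimately show ?thesis by (simp add: power2_eq_square algebra_simps)
  qed
  then have "3 * M * (N - M) / (3 * (N * (N - 1))) \<le> N * (N - 1) / (3 * (N * (N - 1)))"
    using pos by (intro divide_right_mono) auto
  moreover have "3 * M * (N - M) / (3 * (N * (N - 1))) = M / N - M * (M - 1) / (N * (N - 1))"
    using N by (simp add: field_simps)
  moreover have "N * (N - 1) / (3 * (N * (N - 1))) = 1 / 3" using N by simp
  ultimately have c: "1 - M * (M - 1) / (N * (N - 1)) \<le> 4 / 3 - M / N" by linarith
  from a b c show ?thesis unfolding defect_def M_def N_def by simp
qed

text \<open>The constants 8/15 (relative size of a clause clique) and 4/15 (price of an unsatisfied clause)
  leave room for 3/2 + 2 * 8/15 < 10 * 4/15.\<close>

lemma clause_ineq3: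
  fixes f g h :: real
  assumes "0 \<le> g" "g \<le> f" "0 \<le> h" "h \<le> f" "f \<le> 1"
  shows "8 / 15 * (1 - f - g - h) + (f * g + f * h + g * h) \<ge> 4 / 15 * defect f"
proof (cases "f \<ge> 8 / 15")
  case True
  have "8 / 15 * (1 - f - g - h) + (f * g + f * h + g * h) =
      8 / 15 * (1 - f) + ((g + h) * (f - 8 / 15) + g * h)" by (simp add: field_simps)
  also have "\<dots> \<ge> 8 / 15 * (1 - f)" using True assms by simp
  finally have "8 / 15 * (1 - f) \<le> 8 / 15 * (1 - f - g - h) + (f * g + f * h + g * h)" .
  moreover have "4 / 15 * defect f \<le> 8 / 15 * (1 - f)" using defect_le[of f] by simp
  ultimately show ?thesis by (rule order_trans[rotated])
next
  case False
  define \<delta> where "\<delta> = 8 / 15 - f"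
  have \<delta>: "\<delta> > 0" using False by (simp add: \<delta>_def)
  \<comment> \<open>For fixed f this is affine in g and in h separately, so its minimum over the
    square [0, f]^2 is attained at a corner; by symmetry three corners remain.\<close>
  let ?G = "\<lambda>g h. 8 / 15 * (1 - f) - \<delta> * (g + h) + g * h"
  have lin: "u + v * x \<ge> c" if "u \<ge> c" "u + v * f \<ge> c" "0 \<le> x" "x \<le> f" for u v x c :: real
  proof (cases "v \<ge> 0")
    case True
    then show ?thesis using that mult_nonneg_nonneg[of v x] by linarith
  next
    case False
    then have "v * x \<ge> v * f" using that by (intro mult_left_mono_neg) auto
    then show ?thesis using that by linarith
  qed
  have c00: "?G 0 0 \<ge> 4 / 15 * defect f" using defect_le[of f] by simp
  have cf0: "?G f 0 \<ge> 4 / 15 * defect f"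
  proof (cases "f \<le> 1 / 3")
    case True
    have "(1 - 3 * f) * (11 - 15 * f) \<ge> 0" using True by (intro mult_nonneg_nonneg) auto
    then have "?G f 0 \<ge> 4 / 15" by (simp add: \<delta>_def field_simps)
    then show ?thesis using defect_le[of f] by simp
  next
    case False
    have "(5 * f - 2)\<^sup>2 \<ge> 0" by simp
    then have "?G f 0 \<ge> 4 / 15 * (4 / 3 - f)" by (simp add: \<delta>_def field_simps power2_eq_square)
    then show ?thesis using defect_le[of f] by simp
  qed
  have cff: "?G f f \<ge> 4 / 15 * defect f"
  proof -
    have "(15 * f - 4)\<^sup>2 \<ge> 0" by simp
    then have "?G f f \<ge> 4 / 15" by (simp add: \<delta>_def field_simps power2_eq_square)
    then show ?thesis using defect_le[of f] by simp
  qed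
  have g0: "?G g 0 \<ge> 4 / 15 * defect f"
    using lin[of "4 / 15 * defect f" "8 / 15 * (1 - f)" "- \<delta>" g] c00 cf0 assms by (simp add: algebra_simps)
  have gf: "?G g f \<ge> 4 / 15 * defect f"
    using lin[of "4 / 15 * defect f" "8 / 15 * (1 - f) - \<delta> * f" "f - \<delta>" g] cf0 cff assms
    by (simp add: algebra_simps)
  have "?G g h \<ge> 4 / 15 * defect f"
    using lin[of "4 / 15 * defect f" "8 / 15 * (1 - f) - \<delta> * g" "g - \<delta>" h] g0 gf assms
    by (simp add: algebra_simps)
  moreover have "?G g h = 8 / 15 * (1 - f - g - h) + (f * g + f * h + g * h)"
    by (simp add: \<delta>_def field_simps)
  ultimately show ?thesis by (simp only:)
qed

text \<open>Missing literals enter \<open>clause_ineq3\<close> as zeros. The double sum runs over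
  ordered pairs, hence the division by 2.\<close>

lemma clause_ineq:
  fixes f :: "'a \<Rightarrow> real"
  assumes "finite A" "card A \<le> 3" "x \<in> A" "\<And>y. y \<in> A \<Longrightarrow> 0 \<le> f y \<and> f y \<le> f x" "f x \<le> 1"
  shows "8 / 15 * (1 - (\<Sum>y\<in>A. f y)) + (\<Sum>y\<in>A. \<Sum>z\<in>A-{y}. f y * f z) / 2 \<ge> 4 / 15 * defect (f x)"
proof -
  have "card (A - {x}) \<le> 2" using assms by simp
  then consider "card (A - {x}) = 0" | "card (A - {x}) = 1" | "card (A - {x}) = 2" by linarith
  then show ?thesis
  proof cases
    case 1
    then have "A - {x} = {}" using assms(1) by (metis card_0_eq finite_Diff)
    then have A: "A = {x}" using assms(3) by blast
    show ?thesis using clause_ineq3[of 0 "f x" 0] assms(4)[OF assms(3)] assms(5) by (simp add: A)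
  next
    case 2
    then obtain y where "A - {x} = {y}" by (rule card_1_singletonE)
    then have A: "A = {x, y}" "x \<noteq> y" using assms(3) by blast+
    have *: "{x, y} - {x} = {y}" "{x, y} - {y} = {x}" using A by auto
    show ?thesis using clause_ineq3[of "f y" "f x" 0] assms(4)[of y] assms(4)[OF assms(3)] assms(5) A(2)
      unfolding A by (simp add: * algebra_simps)
  next
    case 3
    then obtain y z where yz: "A - {x} = {y, z}" "y \<noteq> z" unfolding card_2_iff by blast
    then have A: "A = {x, y, z}" "x \<noteq> y" "x \<noteq> z" using assms(3) by blast+
    have *: "{x, y, z} - {x} = {y, z}" "{x, y, z} - {y} = {x, z}" "{x, y, z} - {z} = {x, y}"
      using A yz(2) by auto
    have "1 - (\<Sum>y\<in>A. f y) = 1 - f x - f y - f z" using A(2,3) yz(2) by (simp add: A(1))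
    moreover have "(\<Sum>y\<in>A. \<Sum>z\<in>A-{y}. f y * f z) / 2 = f x * f y + f x * f z + f y * f z"
      using A(2,3) yz(2) by (simp add: A(1) * algebra_simps)
    moreover have "4 / 15 * defect (f x) \<le> 8 / 15 * (1 - f x - f y - f z) + (f x * f y + f x * f z + f y * f z)"
      using assms(4)[of y] assms(4)[of z] assms(5) by (intro clause_ineq3) (auto simp: A(1))
    ultimately show ?thesis by (simp only:)
  qed
qed

section \<open>The price of unsatisfied clauses\<close>

datatype vert = Grid nat nat nat | Cl nat

text \<open>Rows and columns of the grid of \<open>x\<close> are indexed by 0 and the clauses in
  which \<open>x\<close> occurs; clause \<open>j\<close> is attached to line number
  \<open>j\<close>, so different clauses use different lines.\<close>

locale reduction =
  fixes X J :: "nat set" and I :: "nat \<Rightarrow> nat set" and b :: "nat \<Rightarrow> nat" and s R :: nat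
    and pos neg :: "nat \<Rightarrow> nat set"
  assumes finX: "finite X" and finJ: "finite J" and finI: "x \<in> X \<Longrightarrow> finite (I x)"
    and att_sub: "j \<in> J \<Longrightarrow> pos j \<union> neg j \<subseteq> X"
    and disj: "j \<in> J \<Longrightarrow> pos j \<inter> neg j = {}"
    and card3: "j \<in> J \<Longrightarrow> card (pos j \<union> neg j) \<le> 3"
    and occ: "j \<in> J \<Longrightarrow> x \<in> pos j \<union> neg j \<Longrightarrow> j \<in> I x"
    and zero: "x \<in> X \<Longrightarrow> 0 \<in> I x" and J0: "0 \<notin> J"
    and size: "j \<in> J \<Longrightarrow> x \<in> pos j \<union> neg j \<Longrightarrow> b x * card (I x) = R"
    and s: "15 * s = 8 * R" and R: "R > 0"
begin

abbreviation att :: "nat \<Rightarrow> nat set" where "att j \<equiv> pos j \<union> neg j"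

text \<open>Every vertex is similar to itself, since it is blown up to a clique.\<close>

fun sim :: "vert \<Rightarrow> vert \<Rightarrow> bool" where
  "sim (Grid x i k) (Grid y i' k') \<longleftrightarrow> x = y \<and> (i = i' \<or> k = k')"
| "sim (Cl j) (Grid x i k) \<longleftrightarrow> x \<in> pos j \<and> i = j \<or> x \<in> neg j \<and> k = j"
| "sim (Grid x i k) (Cl j) \<longleftrightarrow> x \<in> pos j \<and> i = j \<or> x \<in> neg j \<and> k = j"
| "sim (Cl j) (Cl j') \<longleftrightarrow> j = j'"

lemma sim_commute: "sim u v = sim v u"
  by (cases u; cases v) auto

fun weight :: "vert \<Rightarrow> nat" where
  "weight (Grid x i k) = b x"
| "weight (Cl j) = s"

abbreviation pt :: "nat \<Rightarrow> nat \<times> nat \<Rightarrow> vert" where "pt x p \<equiv> Grid x (fst p) (snd p)"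

abbreviation pts :: "nat \<Rightarrow> (nat \<times> nat) set" where "pts x \<equiv> I x \<times> I x"

definition vsum :: "(vert \<Rightarrow> real) \<Rightarrow> real" where
  "vsum f = (\<Sum>x\<in>X. \<Sum>p\<in>pts x. f (pt x p)) + (\<Sum>j\<in>J. f (Cl j))"

definition pair_cost :: "(vert \<Rightarrow> 'l) \<Rightarrow> vert \<Rightarrow> vert \<Rightarrow> real" where
  "pair_cost lam u v = real (weight u) * real (weight v) * of_bool (sim u v \<noteq> (lam u = lam v))"

text \<open>All sums run over ordered pairs, hence count every mistake twice.\<close>

definition cost :: "(vert \<Rightarrow> 'l) \<Rightarrow> real" where
  "cost lam = vsum (\<lambda>u. vsum (pair_cost lam u))"

text \<open>The cost if every grid is cut purely into rows or into columns and every clause is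
  joined to one of its literals and cut from the others, whence the number of literals minus
  one.\<close>

definition base :: real where
  "base = (\<Sum>x\<in>X. real (b x)^2 * (real (card (I x))^2 * (real (card (I x)) - 1))) +
     2 * real s * real R * ((\<Sum>j\<in>J. real (card (att j))) - real (card J))"

definition unsat :: "(nat \<Rightarrow> bool) \<Rightarrow> nat set" where
  "unsat \<sigma> = {j \<in> J. (\<forall>x\<in>pos j. \<not> \<sigma> x) \<and> (\<forall>x\<in>neg j. \<sigma> x)}"

lemma pair_cost_commute: "pair_cost lam u v = pair_cost lam v u"
  by (simp add: pair_cost_def sim_commute[of u v] eq_commute mult.commute)

definition block_cost :: "(vert \<Rightarrow> 'l) \<Rightarrow> nat \<Rightarrow> nat \<Rightarrow> real" where
  "block_cost lam x y = (\<Sum>p\<in>pts x. \<Sum>q\<in>pts y. pair_cost lam (pt x p) (pt y q))"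

lemma cost_split:
  "cost lam = (\<Sum>x\<in>X. block_cost lam x x) + (\<Sum>x\<in>X. \<Sum>y\<in>X-{x}. block_cost lam x y)
    + 2 * (\<Sum>j\<in>J. \<Sum>x\<in>X. \<Sum>p\<in>pts x. pair_cost lam (Cl j) (pt x p))
    + (\<Sum>j\<in>J. \<Sum>j'\<in>J. pair_cost lam (Cl j) (Cl j'))"
proof -
  have "(\<Sum>x\<in>X. \<Sum>p\<in>pts x. \<Sum>y\<in>X. \<Sum>q\<in>pts y. pair_cost lam (pt x p) (pt y q)) =
      (\<Sum>x\<in>X. \<Sum>y\<in>X. block_cost lam x y)"
    unfolding block_cost_def by (intro sum.cong refl sum.swap)
  also have "\<dots> = (\<Sum>x\<in>X. block_cost lam x x + (\<Sum>y\<in>X-{x}. block_cost lam x y))"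
    by (rule sum.cong) (auto simp: sum.remove[OF finX])
  finally have 1: "(\<Sum>x\<in>X. \<Sum>p\<in>pts x. \<Sum>y\<in>X. \<Sum>q\<in>pts y. pair_cost lam (pt x p) (pt y q)) =
     (\<Sum>x\<in>X. block_cost lam x x) + (\<Sum>x\<in>X. \<Sum>y\<in>X-{x}. block_cost lam x y)"
    by (simp add: sum.distrib)
  have "(\<Sum>x\<in>X. \<Sum>p\<in>pts x. \<Sum>j\<in>J. pair_cost lam (pt x p) (Cl j)) =
      (\<Sum>x\<in>X. \<Sum>j\<in>J. \<Sum>p\<in>pts x. pair_cost lam (Cl j) (pt x p))"
    by (intro sum.cong refl, subst sum.swap) (intro sum.cong refl pair_cost_commute)
  also have "\<dots> = (\<Sum>j\<in>J. \<Sum>x\<in>X. \<Sum>p\<in>pts x. pair_cost lam (Cl j) (pt x p))"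
    by (rule sum.swap)
  finally show ?thesis unfolding cost_def vsum_def using 1 by (simp add: sum.distrib)
qed

end

text \<open>All copies of a cell or of a clause share a label here; \<open>merge_twins\<close>
  reduces arbitrary clusterings to this case.\<close>

locale reduction_clustering = reduction +
  fixes lam :: "vert \<Rightarrow> 'l"
begin

abbreviation ex :: "nat \<Rightarrow> real" where
  "ex x \<equiv> grid.excess (I x) (\<lambda>i k. lam (Grid x i k))"

abbreviation n :: "nat \<Rightarrow> real" where "n x \<equiv> real (card (I x))"

lemma grid: "x \<in> X \<Longrightarrow> grid (I x)"
  using finI zero by unfold_locales auto

lemma block_cost_same:
  assumes "x \<in> X"
  shows "block_cost lam x x = real (b x)^2 * ((n x)^2 * (n x - 1)) + real (b x)^2 * ex x"
proof -
  have "block_cost lam x x = (\<Sum>i\<in>I x. \<Sum>k\<in>I x. \<Sum>i'\<in>I x. \<Sum>k'\<in>I x. pair_cost lam (Grid x i k) (Grid x i' k'))"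
    unfolding block_cost_def by (simp add: sum.cartesian_product')
  also have "\<dots> = (\<Sum>i\<in>I x. \<Sum>i'\<in>I x. \<Sum>k\<in>I x. \<Sum>k'\<in>I x. pair_cost lam (Grid x i k) (Grid x i' k'))"
    by (intro sum.cong refl sum.swap)
  also have "\<dots> = real (b x)^2 * (\<Sum>i\<in>I x. \<Sum>i'\<in>I x. \<Sum>k\<in>I x. \<Sum>k'\<in>I x.
      of_bool ((i = i' \<or> k = k') \<noteq> (lam (Grid x i k) = lam (Grid x i' k'))))"
    by (simp add: pair_cost_def power2_eq_square flip: sum_distrib_left)
  also have "\<dots> = real (b x)^2 * ((n x)^2 * (n x - 1) + ex x)"
    by (subst grid.grid_cost[OF grid[OF assms]]) simp
  finally show ?thesis by (simp add: distrib_left)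
qed

section \<open>The cost at a single clause\<close>

definition line :: "nat \<Rightarrow> nat \<Rightarrow> (nat \<times> nat) set" where
  "line j x = {p \<in> pts x. sim (Cl j) (pt x p)}"

definition same :: "nat \<Rightarrow> nat \<Rightarrow> (nat \<times> nat) set" where
  "same j x = {p \<in> pts x. lam (pt x p) = lam (Cl j)}"

text \<open>What one copy of the clause saves against standing alone: attached cells in its cluster
  count positively, other cells there negatively. The base value corresponds to a gain of exactly
  \<open>R\<close>.\<close>

definition gain :: "nat \<Rightarrow> real" where
  "gain j = 2 * (\<Sum>x\<in>att j. real (b x) * card (line j x \<inter> same j x)) - (\<Sum>x\<in>X. real (b x) * card (same j x))"

definition frac :: "nat \<Rightarrow> nat \<Rightarrow> real" where
  "frac j x = real (card (line j x \<inter> same j x)) / n x"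

lemma finite_line [simp]: "x \<in> X \<Longrightarrow> finite (line j x)" "x \<in> X \<Longrightarrow> finite (same j x)"
  using finI[of x] by (auto simp: line_def same_def)

lemma line_pos: "j \<in> J \<Longrightarrow> x \<in> pos j \<Longrightarrow> line j x = {j} \<times> I x"
  using disj[of j] occ[of j x] by (auto simp: line_def)

lemma line_neg: "j \<in> J \<Longrightarrow> x \<in> neg j \<Longrightarrow> line j x = I x \<times> {j}"
  using disj[of j] occ[of j x] by (auto simp: line_def)

lemma card_line: "j \<in> J \<Longrightarrow> x \<in> att j \<Longrightarrow> card (line j x) = card (I x)"
  by (auto simp: line_pos line_neg card_cartesian_product_singleton card_cartesian_product)

lemma line_empty: "x \<notin> att j \<Longrightarrow> line j x = {}"
  by (auto simp: line_def)

lemma attX: "j \<in> J \<Longrightarrow> x \<in> att j \<Longrightarrow> x \<in> X"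
  using att_sub by blast

lemma fin_att: "j \<in> J \<Longrightarrow> finite (att j)"
  using att_sub finX finite_subset by blast

lemma n_pos: "x \<in> X \<Longrightarrow> n x > 0"
  using finI zero by (auto simp: card_gt_0_iff)

lemma size_real: "j \<in> J \<Longrightarrow> x \<in> att j \<Longrightarrow> real (b x) * n x = real R"
  using size[of j x] by (metis of_nat_mult)

lemma frac_R: "j \<in> J \<Longrightarrow> x \<in> att j \<Longrightarrow> real (b x) * card (line j x \<inter> same j x) = frac j x * R"
  using size_real[of j x] n_pos[of x] attX[of j x] by (simp add: frac_def field_simps)

lemma frac_01: 
  assumes "j \<in> J" "x \<in> att j"
  shows "0 \<le> frac j x" "frac j x \<le> 1"
proof -
  have "card (line j x \<inter> same j x) \<le> card (I x)"
    using card_mono[of "line j x" "line j x \<inter> same j x"] card_line[OF assms] attX[OF assms] by simp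
  then show "0 \<le> frac j x" "frac j x \<le> 1"
    using n_pos[of x] attX[OF assms] by (simp_all add: frac_def)
qed

lemma clause_cost:
  assumes j: "j \<in> J"
  shows "(\<Sum>x\<in>X. \<Sum>p\<in>pts x. pair_cost lam (Cl j) (pt x p)) = s * (card (att j) * real R - gain j)"
proof -
  have 1: "(\<Sum>p\<in>pts x. pair_cost lam (Cl j) (pt x p)) =
     real s * (real (b x) * (real (card (line j x)) - 2 * real (card (line j x \<inter> same j x)) + real (card (same j x))))" if x: "x \<in> X" for x
  proof -
    have "(\<Sum>p\<in>pts x. pair_cost lam (Cl j) (pt x p)) = (\<Sum>p\<in>pts x. real s * real (b x) * of_bool (p \<in> line j x \<longleftrightarrow> p \<notin> same j x))"
      by (rule sum.cong) (auto simp: pair_cost_def line_def same_def)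
    also have "\<dots> = real s * real (b x) * real (card ((line j x \<union> same j x) - (line j x \<inter> same j x)))"
    proof -
      have "{p \<in> pts x. p \<in> line j x \<longleftrightarrow> p \<notin> same j x} = (line j x \<union> same j x) - (line j x \<inter> same j x)"
        by (auto simp: line_def same_def)
      then show ?thesis using finI[OF x]
        by (simp add: of_bool_def sum.If_cases Int_def flip: sum_distrib_left)
    qed
    also have "real (card ((line j x \<union> same j x) - (line j x \<inter> same j x))) =
      real (card (line j x)) - 2 * real (card (line j x \<inter> same j x)) + real (card (same j x))"
    proof -
      have "card (line j x) + card (same j x) = card (line j x \<union> same j x) + card (line j x \<inter> same j x)"
        by (rule card_Un_Int) (use x in auto)
      moreover have "card (line j x \<union> same j x) =
          card ((line j x \<union> same j x) - (line j x \<inter> same j x)) + card (line j x \<inter> same j x)"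
      proof -
        have "card ((line j x \<union> same j x) - (line j x \<inter> same j x)) =
            card (line j x \<union> same j x) - card (line j x \<inter> same j x)"
          by (rule card_Diff_subset) (use x in auto)
        moreover have "card (line j x \<inter> same j x) \<le> card (line j x \<union> same j x)"
          by (rule card_mono) (use x in auto)
        ultimately show ?thesis by linarith
      qed
      ultimately show ?thesis by linarith
    qed
    finally show ?thesis by simp
  qed
  have 2: "(\<Sum>x\<in>X. real (b x) * card (line j x)) = card (att j) * real R"
  proof -
    have "(\<Sum>x\<in>X. real (b x) * card (line j x)) = (\<Sum>x\<in>att j. real (b x) * card (line j x))"
      by (rule sum.mono_neutral_right) (use finX att_sub[OF j] line_empty[of _ j] in auto)
    also have "\<dots> = (\<Sum>x\<in>att j. real R)"
      by (rule sum.cong) (use j in \<open>auto simp: card_line size_real simp del: Un_iff\<close>)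
    finally show ?thesis by simp
  qed
  have 3: "(\<Sum>x\<in>X. real (b x) * card (line j x \<inter> same j x)) = (\<Sum>x\<in>att j. real (b x) * card (line j x \<inter> same j x))"
    by (rule sum.mono_neutral_right) (use finX att_sub[OF j] line_empty[of _ j] in auto)
  have "(\<Sum>x\<in>X. \<Sum>p\<in>pts x. pair_cost lam (Cl j) (pt x p)) =
    real s * (\<Sum>x\<in>X. real (b x) * (real (card (line j x)) - 2 * real (card (line j x \<inter> same j x)) + real (card (same j x))))"
    by (simp add: 1 sum_distrib_left)
  also have "\<dots> = real s * ((\<Sum>x\<in>X. real (b x) * card (line j x)) - 2 * (\<Sum>x\<in>X. real (b x) * card (line j x \<inter> same j x)) +
      (\<Sum>x\<in>X. real (b x) * card (same j x)))"
    by (simp add: algebra_simps sum.distrib sum_subtractf sum_distrib_left)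
  finally show ?thesis unfolding 2 3 gain_def by (simp add: algebra_simps)
qed

lemma gain_le:
  assumes j: "j \<in> J"
  shows "gain j \<le> (\<Sum>x\<in>att j. frac j x) * R"
proof -
  have "(\<Sum>x\<in>att j. real (b x) * card (line j x \<inter> same j x)) \<le> (\<Sum>x\<in>att j. real (b x) * card (same j x))"
    by (intro sum_mono mult_left_mono of_nat_mono card_mono) (use attX[OF j] in auto)
  also have "\<dots> \<le> (\<Sum>x\<in>X. real (b x) * card (same j x))"
    by (rule sum_mono2) (use finX att_sub[OF j] in auto)
  finally have "gain j \<le> (\<Sum>x\<in>att j. real (b x) * card (line j x \<inter> same j x))"
    unfolding gain_def by simp
  also have "\<dots> = (\<Sum>x\<in>att j. frac j x * R)"
    by (rule sum.cong[OF refl frac_R[OF j]])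
  finally show ?thesis by (simp add: sum_distrib_right)
qed

text \<open>This is what the index 0 is for: two clauses at a variable already give a grid with
  three rows, as required by \<open>excess_lower\<close> and \<open>pairs_defect\<close>.\<close>

lemma three_points:
  assumes "j \<in> J" "j' \<in> J" "j \<noteq> j'" "x \<in> att j" "x \<in> att j'"
  shows "card (I x) \<ge> 3"
proof -
  have "{0, j, j'} \<subseteq> I x" using assms occ[of j x] occ[of j' x] zero attX by blast
  moreover have "card {0, j, j'} = 3"
  proof -
    have "j \<noteq> 0" "j' \<noteq> 0" using assms(1,2) J0 by metis+
    then show ?thesis using assms(3) by simp
  qed
  ultimately show ?thesis
    using card_mono[OF finI[OF attX[OF assms(1,4)]], of "{0, j, j'}"] by simp
qed

lemma lines_meet:
  assumes "j \<in> J" "j' \<in> J" "j \<noteq> j'" "x \<in> att j" "x \<in> att j'"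
  shows "card (line j x \<inter> line j' x) \<le> 1"
proof -
  have "line j x \<inter> line j' x \<subseteq> {(j, j')} \<or> line j x \<inter> line j' x \<subseteq> {(j', j)}"
    using assms by (elim UnE) (auto simp: line_pos line_neg)
  then show ?thesis by (auto dest!: card_mono[rotated])
qed

text \<open>In a shared cluster a cell counts positively for both clauses only where their lines
  cross. A crossing is one of at least three cells of a line, so it weighs at most R/3, and at most
  three variables are involved.\<close>

lemma gain_pair:
  assumes j: "j \<in> J" and j': "j' \<in> J" and "j \<noteq> j'" and lab: "lam (Cl j) = lam (Cl j')"
  shows "gain j + gain j' \<le> 2 * R"
proof -
  have same: "same j = same j'" by (auto simp: same_def lab fun_eq_iff)
  have ext: "(\<Sum>x\<in>att i. real (b x) * card (line i x \<inter> same i x)) = (\<Sum>x\<in>X. real (b x) * card (line i x \<inter> same i x))"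
    if "i \<in> J" for i
    by (rule sum.mono_neutral_left) (use that finX att_sub[of i] line_empty[of _ i] in auto)
  have "(\<Sum>x\<in>X. real (b x) * card (line j x \<inter> same j x)) + (\<Sum>x\<in>X. real (b x) * card (line j' x \<inter> same j x))
     \<le> (\<Sum>x\<in>X. real (b x) * card (same j x)) + (\<Sum>x\<in>X. real (b x) * card (line j x \<inter> line j' x))"
    unfolding sum.distrib[symmetric] distrib_left[symmetric]
  proof (intro sum_mono mult_left_mono)
    fix x assume x: "x \<in> X"
    have "card (line j x \<inter> same j x) + card (line j' x \<inter> same j x) =
      card ((line j x \<inter> same j x) \<union> (line j' x \<inter> same j x)) + card ((line j x \<inter> same j x) \<inter> (line j' x \<inter> same j x))"
      by (rule card_Un_Int) (use x in auto)
    also have "\<dots> \<le> card (same j x) + card (line j x \<inter> line j' x)"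
      by (intro add_mono card_mono) (use x in auto)
    finally show "real (card (line j x \<inter> same j x)) + real (card (line j' x \<inter> same j x))
      \<le> real (card (same j x)) + real (card (line j x \<inter> line j' x))" by linarith
  qed simp
  also have "(\<Sum>x\<in>X. real (b x) * card (line j x \<inter> line j' x)) = (\<Sum>x\<in>att j. real (b x) * card (line j x \<inter> line j' x))"
    by (rule sum.mono_neutral_right) (use finX att_sub[OF j] line_empty[of _ j] in auto)
  also have "\<dots> \<le> (\<Sum>x\<in>att j. real R / 3)"
  proof (rule sum_mono)
    fix x assume x: "x \<in> att j"
    show "real (b x) * card (line j x \<inter> line j' x) \<le> real R / 3"
    proof (cases "x \<in> att j'")
      case True
      have "real (b x) * 3 \<le> real (b x) * n x"
        using three_points[OF j j' \<open>j \<noteq> j'\<close> x True] by (intro mult_left_mono) auto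
      moreover have "real (b x) * card (line j x \<inter> line j' x) \<le> real (b x) * 1"
        using lines_meet[OF j j' \<open>j \<noteq> j'\<close> x True] by (intro mult_left_mono) auto
      ultimately show ?thesis using size_real[OF j x] by simp
    next
      case False
      then show ?thesis by (simp add: line_empty del: Un_iff)
    qed
  qed
  also have "\<dots> \<le> R"
  proof -
    have "real (card (att j)) * real R \<le> 3 * real R"
      using card3[OF j] by (intro mult_right_mono) auto
    then show ?thesis by simp
  qed
  finally show ?thesis
    unfolding gain_def ext[OF j] ext[OF j'] unfolding same[symmetric] by simp
qed

text \<open>A clause of largest gain in its cluster. By \<open>gain_pair\<close> the others gain at
  most \<open>R\<close>, so they never beat the base value, and they pay for sharing the
  cluster.\<close>

definition leader :: "'l \<Rightarrow> nat" where
  "leader l = (SOME j. j \<in> J \<and> lam (Cl j) = l \<and> (\<forall>j'\<in>J. lam (Cl j') = l \<longrightarrow> gain j' \<le> gain j))"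

lemma leader:
  assumes "j \<in> J"
  defines "m \<equiv> leader (lam (Cl j))"
  shows "m \<in> J" "lam (Cl m) = lam (Cl j)" "gain j \<le> gain m"
proof -
  let ?S = "{j' \<in> J. lam (Cl j') = lam (Cl j)}"
  have fin: "finite ?S" and ne: "?S \<noteq> {}" using assms finJ by auto
  have "Max (gain ` ?S) \<in> gain ` ?S" using fin ne by (intro Max_in) auto
  then obtain j0 where j0: "j0 \<in> ?S" "gain j0 = Max (gain ` ?S)" by (elim imageE) simp
  have "\<forall>j'\<in>J. lam (Cl j') = lam (Cl j) \<longrightarrow> gain j' \<le> gain j0"
    using Max_ge[of "gain ` ?S"] fin j0(2) by auto
  with j0 have "\<exists>j0. j0 \<in> J \<and> lam (Cl j0) = lam (Cl j) \<and> (\<forall>j'\<in>J. lam (Cl j') = lam (Cl j) \<longrightarrow> gain j' \<le> gain j0)"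
    by blast
  from someI_ex[OF this] show "m \<in> J" "lam (Cl m) = lam (Cl j)" "gain j \<le> gain m"
    unfolding m_def leader_def using assms by auto
qed

definition leaders :: "nat set" where "leaders = {j \<in> J. leader (lam (Cl j)) = j}"

lemma leaders_sub: "leaders \<subseteq> J" by (auto simp: leaders_def)

lemma finite_leaders [simp]: "finite leaders"
  using leaders_sub finJ finite_subset by blast

lemma leaders_inj: "j \<in> leaders \<Longrightarrow> j' \<in> leaders \<Longrightarrow> lam (Cl j) = lam (Cl j') \<Longrightarrow> j = j'"
  by (auto simp: leaders_def)

lemma leader_in_leaders: "j \<in> J \<Longrightarrow> leader (lam (Cl j)) \<in> leaders"
  using leader[of j] by (auto simp: leaders_def)

lemma follower_gain: "j \<in> J - leaders \<Longrightarrow> gain j \<le> R"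
  using gain_pair[of j "leader (lam (Cl j))"] leader[of j] by (auto simp: leaders_def)

text \<open>Different clauses are dissimilar, so each follower pays at least for the two ordered
  pairs that it forms with its leader.\<close>

lemma clause_clause_cost:
  "(\<Sum>j\<in>J. \<Sum>j'\<in>J. pair_cost lam (Cl j) (Cl j')) \<ge> 2 * (real s)^2 * card (J - leaders)"
proof -
  let ?D = "{p \<in> J \<times> J. fst p \<noteq> snd p \<and> lam (Cl (fst p)) = lam (Cl (snd p))}"
  let ?m = "\<lambda>j. leader (lam (Cl j))"
  let ?A = "(\<lambda>j. (j, ?m j)) ` (J - leaders)" and ?B = "(\<lambda>j. (?m j, j)) ` (J - leaders)"
  have fin: "finite ?D" "finite (J - leaders)" using finJ by auto
  have sub: "?A \<union> ?B \<subseteq> ?D" using leader leader_in_leaders by fastforce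
  have "?A \<inter> ?B = {}" using leader_in_leaders by auto
  then have "card (?A \<union> ?B) = card ?A + card ?B" using fin by (intro card_Un_disjoint) auto
  also have "card ?A = card (J - leaders)" by (rule card_image) (auto simp: inj_on_def)
  also have "card ?B = card (J - leaders)" by (rule card_image) (auto simp: inj_on_def)
  finally have card: "2 * card (J - leaders) \<le> card ?D"
    using card_mono[OF fin(1) sub] by simp
  have "(\<Sum>j\<in>J. \<Sum>j'\<in>J. pair_cost lam (Cl j) (Cl j')) = (\<Sum>p\<in>J \<times> J. (real s)^2 * of_bool (p \<in> ?D))"
    unfolding sum.cartesian_product
    by (rule sum.cong) (auto simp: pair_cost_def power2_eq_square)
  also have "\<dots> = (real s)^2 * card ?D"
    using finJ by (simp add: of_bool_def sum.If_cases Int_def flip: sum_distrib_left)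
  also have "\<dots> \<ge> (real s)^2 * real (2 * card (J - leaders))"
    using card by (intro mult_left_mono) simp_all
  finally show ?thesis by simp
qed

text \<open>Each pair of vertices of different variables is charged only by the leader of its cluster.\<close>

lemma cross_cost:
  "(\<Sum>x\<in>X. \<Sum>y\<in>X-{x}. block_cost lam x y) \<ge>
     (\<Sum>j\<in>leaders. \<Sum>x\<in>att j. \<Sum>y\<in>att j-{x}. (frac j x * R) * (frac j y * R))"
proof -
  let ?g = "\<lambda>j x. if x \<in> att j then real (b x) * card (line j x \<inter> same j x) else 0"
  have cnt: "real (card (line j x \<inter> same j x)) = (\<Sum>p\<in>pts x. of_bool (p \<in> line j x \<inter> same j x))" if "x \<in> X" for j x
  proof -
    have "pts x \<inter> (line j x \<inter> same j x) = line j x \<inter> same j x" by (auto simp: line_def)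
    then show ?thesis using finI[OF that] by (simp add: of_bool_def sum.If_cases Int_def)
  qed
  have block: "(\<Sum>j\<in>leaders. ?g j x * ?g j y) \<le> block_cost lam x y" if x: "x \<in> X" and y: "y \<in> X" "x \<noteq> y" for x y
  proof -
    have "(\<Sum>j\<in>leaders. ?g j x * ?g j y) \<le> (\<Sum>j\<in>leaders. \<Sum>p\<in>pts x. \<Sum>q\<in>pts y.
        real (b x) * real (b y) * of_bool (lam (pt x p) = lam (Cl j) \<and> lam (pt y q) = lam (Cl j)))"
    proof (rule sum_mono)
      fix j assume "j \<in> leaders"
      have "?g j x * ?g j y \<le> (real (b x) * card (line j x \<inter> same j x)) * (real (b y) * card (line j y \<inter> same j y))"
        by auto
      also have "\<dots> = (\<Sum>p\<in>pts x. \<Sum>q\<in>pts y. real (b x) * real (b y) *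
          (of_bool (p \<in> line j x \<inter> same j x) * of_bool (q \<in> line j y \<inter> same j y)))"
      proof -
        have *: "(real (b x) * u) * (real (b y) * v) = real (b x) * real (b y) * (u * v)" for u v by simp
        show ?thesis unfolding cnt[OF x] cnt[OF y(1)] * sum_product by (simp only: sum_distrib_left)
      qed
      also have "\<dots> \<le> (\<Sum>p\<in>pts x. \<Sum>q\<in>pts y.
        real (b x) * real (b y) * of_bool (lam (pt x p) = lam (Cl j) \<and> lam (pt y q) = lam (Cl j)))"
        by (intro sum_mono mult_left_mono) (auto simp: same_def)
      finally show "?g j x * ?g j y \<le> \<dots>" .
    qed
    also have "\<dots> = (\<Sum>p\<in>pts x. \<Sum>q\<in>pts y. \<Sum>j\<in>leaders.
        real (b x) * real (b y) * of_bool (lam (pt x p) = lam (Cl j) \<and> lam (pt y q) = lam (Cl j)))"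
      by (subst sum.swap, intro sum.cong refl, subst sum.swap, rule refl)
    also have "\<dots> \<le> block_cost lam x y"
      unfolding block_cost_def
    proof (intro sum_mono)
      fix p q
      show "(\<Sum>j\<in>leaders. real (b x) * real (b y) * of_bool (lam (pt x p) = lam (Cl j) \<and> lam (pt y q) = lam (Cl j)))
         \<le> pair_cost lam (pt x p) (pt y q)"
      proof (cases "\<exists>j\<in>leaders. lam (pt x p) = lam (Cl j) \<and> lam (pt y q) = lam (Cl j)")
        case True
        then obtain j0 where j0: "j0 \<in> leaders" "lam (pt x p) = lam (Cl j0)" "lam (pt y q) = lam (Cl j0)" by blast
        have "(\<Sum>j\<in>leaders. real (b x) * real (b y) * of_bool (lam (pt x p) = lam (Cl j) \<and> lam (pt y q) = lam (Cl j)))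
          = (\<Sum>j\<in>leaders. if j = j0 then real (b x) * real (b y) else 0)"
          by (rule sum.cong) (use j0 leaders_inj in auto)
        also have "\<dots> = real (b x) * real (b y)" using j0(1) by simp
        also have "\<dots> = pair_cost lam (pt x p) (pt y q)" using j0 y(2) by (simp add: pair_cost_def)
        finally show ?thesis by simp
      next
        case False
        then have "(\<Sum>j\<in>leaders. real (b x) * real (b y) * of_bool (lam (pt x p) = lam (Cl j) \<and> lam (pt y q) = lam (Cl j))) = 0"
          by (intro sum.neutral) auto
        also have "\<dots> \<le> pair_cost lam (pt x p) (pt y q)" by (simp add: pair_cost_def)
        finally show ?thesis .
      qed
    qed
    finally show ?thesis .
  qed
  have "(\<Sum>j\<in>leaders. \<Sum>x\<in>att j. \<Sum>y\<in>att j-{x}. (frac j x * R) * (frac j y * R)) =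
     (\<Sum>j\<in>leaders. \<Sum>x\<in>X. \<Sum>y\<in>X-{x}. ?g j x * ?g j y)"
  proof (rule sum.cong[OF refl])
    fix j assume "j \<in> leaders"
    then have j: "j \<in> J" using leaders_sub by blast
    have "(\<Sum>x\<in>att j. \<Sum>y\<in>att j-{x}. (frac j x * R) * (frac j y * R)) = (\<Sum>x\<in>att j. \<Sum>y\<in>att j-{x}. ?g j x * ?g j y)"
      by (intro sum.cong refl) (use frac_R[OF j] in \<open>auto simp del: Un_iff\<close>)
    also have "\<dots> = (\<Sum>x\<in>att j. \<Sum>y\<in>X-{x}. ?g j x * ?g j y)"
      by (intro sum.cong refl sum.mono_neutral_left) (use finX att_sub[OF j] in auto)
    also have "\<dots> = (\<Sum>x\<in>X. \<Sum>y\<in>X-{x}. ?g j x * ?g j y)"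
      by (intro sum.mono_neutral_left) (use finX att_sub[OF j] in auto)
    finally show "(\<Sum>x\<in>att j. \<Sum>y\<in>att j-{x}. (frac j x * R) * (frac j y * R)) = (\<Sum>x\<in>X. \<Sum>y\<in>X-{x}. ?g j x * ?g j y)" .
  qed
  also have "\<dots> = (\<Sum>x\<in>X. \<Sum>y\<in>X-{x}. \<Sum>j\<in>leaders. ?g j x * ?g j y)"
    by (rule trans[OF sum.swap]) (intro sum.cong refl sum.swap)
  also have "\<dots> \<le> (\<Sum>x\<in>X. \<Sum>y\<in>X-{x}. block_cost lam x y)"
    by (intro sum_mono block) auto
  finally show ?thesis .
qed

definition best :: "nat \<Rightarrow> nat" where
  "best j = (SOME x. x \<in> att j \<and> (\<forall>y\<in>att j. frac j y \<le> frac j x))"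

lemma best:
  assumes "j \<in> J" "att j \<noteq> {}"
  shows "best j \<in> att j" "\<And>y. y \<in> att j \<Longrightarrow> frac j y \<le> frac j (best j)"
proof -
  have "Max (frac j ` att j) \<in> frac j ` att j"
    using fin_att[OF assms(1)] assms(2) by (intro Max_in finite_imageI) (simp_all only: image_is_empty not_False_eq_True)
  then obtain x where x: "x \<in> att j" "frac j x = Max (frac j ` att j)" by (elim imageE) simp
  then have "\<exists>x. x \<in> att j \<and> (\<forall>y\<in>att j. frac j y \<le> frac j x)"
    using Max_ge[OF finite_imageI[OF fin_att[OF assms(1)]] imageI, of _ "frac j"]
    by (intro exI[of _ x]) (simp del: Un_iff)
  from someI_ex[OF this] show "best j \<in> att j" "\<And>y. y \<in> att j \<Longrightarrow> frac j y \<le> frac j (best j)"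
    unfolding best_def by auto
qed

text \<open>The multiple of 8/15 R^2 that a leader pays by itself. The defect bounds the fraction of
  pairs on its best line that its cluster does not hold together, as used in
  \<open>variable_price\<close>; a clause without free literals pays in full.\<close>

definition price :: "nat \<Rightarrow> real" where
  "price j = (if att j = {} then 1 else defect (frac j (best j)))"

lemma s_real: "real s = 8 / 15 * real R"
proof -
  have "15 * real s = 8 * real R" using s by (metis of_nat_mult of_nat_numeral)
  then show ?thesis by simp
qed

text \<open>This is \<open>clause_ineq\<close> scaled by 2 R^2: the linear part is the gain lost,
  the products are the pairs of cells of different variables in the cluster.\<close>

lemma leader_cost:
  assumes "j \<in> leaders"
  shows "2 * real s * (real R - gain j) + (\<Sum>x\<in>att j. \<Sum>y\<in>att j-{x}. (frac j x * R) * (frac j y * R))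
    \<ge> 8 / 15 * (real R)^2 * price j"
proof -
  have j: "j \<in> J" using assms leaders_sub by blast
  have "4 / 15 * price j \<le> 8 / 15 * (1 - (\<Sum>y\<in>att j. frac j y)) + (\<Sum>y\<in>att j. \<Sum>z\<in>att j-{y}. frac j y * frac j z) / 2"
  proof (cases "att j = {}")
    case True
    then have "pos j = {}" "neg j = {}" by auto
    then show ?thesis by (simp add: price_def)
  next
    case False
    then show ?thesis unfolding price_def
      using clause_ineq[of "att j" "best j" "frac j"] fin_att[OF j] card3[OF j] best[OF j False] frac_01[OF j]
      by auto
  qed
  then have "2 * (real R)^2 * (4 / 15 * price j) \<le> 2 * (real R)^2 * (8 / 15 * (1 - (\<Sum>y\<in>att j. frac j y)) +
      (\<Sum>y\<in>att j. \<Sum>z\<in>att j-{y}. frac j y * frac j z) / 2)"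
    by (intro mult_left_mono) auto
  also have "\<dots> = 2 * real s * (real R - (\<Sum>y\<in>att j. frac j y) * R) + (\<Sum>x\<in>att j. \<Sum>y\<in>att j-{x}. (frac j x * R) * (frac j y * R))"
  proof -
    have "(\<Sum>x\<in>att j. \<Sum>y\<in>att j-{x}. (frac j x * R) * (frac j y * R)) = (real R)^2 * (\<Sum>y\<in>att j. \<Sum>z\<in>att j-{y}. frac j y * frac j z)"
      unfolding sum_distrib_left by (intro sum.cong refl) (simp add: power2_eq_square)
    then show ?thesis unfolding s_real by (simp add: algebra_simps power2_eq_square)
  qed
  also have "\<dots> \<le> 2 * real s * (real R - gain j) + (\<Sum>x\<in>att j. \<Sum>y\<in>att j-{x}. (frac j x * R) * (frac j y * R))"
    using gain_le[OF j] by (intro add_right_mono mult_left_mono) auto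
  finally show ?thesis by (simp add: algebra_simps)
qed

text \<open>The leaders of \<open>up x\<close> want the grid of \<open>x\<close> cut into rows,
  those of \<open>dn x\<close> want it cut into columns.\<close>

definition up :: "nat \<Rightarrow> nat set" where "up x = {j \<in> leaders. att j \<noteq> {} \<and> best j = x \<and> x \<in> pos j}"
definition dn :: "nat \<Rightarrow> nat set" where "dn x = {j \<in> leaders. att j \<noteq> {} \<and> best j = x \<and> x \<in> neg j}"

lemma finite_up [simp]: "finite (up x)" "finite (dn x)"
  by (auto simp: up_def dn_def)

lemma price_up: "j \<in> up x \<union> dn x \<Longrightarrow> price j = defect (frac j x)"
  by (auto simp: up_def dn_def price_def)

lemma price_nonneg: "j \<in> J \<Longrightarrow> price j \<ge> 0"
  using frac_01[of j "best j"] best[of j] by (auto simp: price_def intro!: defect_nonneg)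

text \<open>The rows and columns used by the leaders at a variable cannot be kept together at the same
  time, because the grid has a mode: if only a fraction of the rows is intact, breaking the used ones
  away from the columns is paid for by the excess cost of the grid.\<close>

lemma variable_price:
  assumes x: "x \<in> X"
  shows "real (min (card (up x)) (card (dn x))) \<le> (\<Sum>j\<in>up x. price j) + (\<Sum>j\<in>dn x. price j)
    + 15 / 8 * ex x / (n x)^2"
proof -
  interpret g: grid "I x" "\<lambda>i k. lam (Grid x i k)" by (rule grid[OF x])
  have sub: "up x \<subseteq> J" "dn x \<subseteq> J" using leaders_sub by (auto simp: up_def dn_def)
  have nonneg: "(\<Sum>j\<in>up x. price j) \<ge> 0" "(\<Sum>j\<in>dn x. price j) \<ge> 0"
    using sub price_nonneg by (auto intro!: sum_nonneg)
  show ?thesis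
  proof (cases "up x = {} \<or> dn x = {}")
    case True
    then have "min (card (up x)) (card (dn x)) = 0" by auto
    then show ?thesis using nonneg g.excess_nonneg by simp
  next
    case False
    then obtain j j' where jj': "j \<in> up x" "j' \<in> dn x" by blast
    \<comment> \<open>A leader using a row and one using a column are different clauses, so the grid
      has at least three rows and a fractional mode.\<close>
    have "j \<in> J" "j' \<in> J" using jj' sub by auto
    moreover have "x \<in> pos j" "x \<in> neg j'" using jj' by (auto simp: up_def dn_def)
    moreover have "j \<noteq> j'" using calculation disj[of j] by blast
    ultimately have n3: "card (I x) \<ge> 3" using three_points[of j j' x] by blast
    define c where "c = n x * (n x - 1)"
    obtain \<tau> where \<tau>: "0 \<le> \<tau>" "\<tau> \<le> 1"
      "(\<Sum>i\<in>I x. max 0 (g.row i / c - \<tau>)) + (\<Sum>k\<in>I x. max 0 (g.col k / c - (1 - \<tau>))) \<le> 15 / 8 * ex x / (n x)^2"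
      using g.fractional_mode[OF n3] unfolding c_def by blast
    \<comment> \<open>The cells of row \<open>j\<close> in the cluster of the clause are equally
      labeled, so the row density is at least 1 - \<open>price j\<close>. The price and the surplus
      of the row over \<tau> together make up for 1 - \<tau>.\<close>
    have up1: "1 - \<tau> \<le> price j + max 0 (g.row j / c - \<tau>)" if j: "j \<in> up x" for j
    proof -
      have jJ: "j \<in> J" "x \<in> pos j" using j sub by (auto simp: up_def)
      let ?S = "{k \<in> I x. lam (Grid x j k) = lam (Cl j)}"
      have "line j x \<inter> same j x = {j} \<times> ?S"
        using occ[of j x] jJ by (auto simp: line_pos[OF jJ] same_def)
      then have fr: "frac j x = real (card ?S) / n x" by (simp add: frac_def card_cartesian_product_singleton)
      have "real (card ?S) * (real (card ?S) - 1) = (\<Sum>q\<in>off_diag (I x). of_bool (fst q \<in> ?S \<and> snd q \<in> ?S))"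
        by (rule g.pairs_in_class_le) auto
      also have "\<dots> \<le> g.row j" unfolding g.row_def g.eq_def by (intro sum_mono) auto
      finally have "real (card ?S) * (real (card ?S) - 1) / c \<le> g.row j / c"
        using n3 by (intro divide_right_mono) (auto simp: c_def)
      moreover have "1 - real (card ?S) * (real (card ?S) - 1) / c \<le> price j"
        using pairs_defect[of "card ?S" "card (I x)"] n3 finI[OF x] card_mono[of "I x" ?S] price_up[of j x] j
        unfolding c_def fr by auto
      ultimately show ?thesis by (auto simp: max_def)
    qed
    have dn1: "\<tau> \<le> price j + max 0 (g.col j / c - (1 - \<tau>))" if j: "j \<in> dn x" for j
    proof -
      have jJ: "j \<in> J" "x \<in> neg j" using j sub by (auto simp: dn_def)
      let ?S = "{i \<in> I x. lam (Grid x i j) = lam (Cl j)}"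
      have "line j x \<inter> same j x = ?S \<times> {j}"
        using occ[of j x] jJ by (auto simp: line_neg[OF jJ] same_def)
      then have fr: "frac j x = real (card ?S) / n x" by (simp add: frac_def card_cartesian_product)
      have "real (card ?S) * (real (card ?S) - 1) = (\<Sum>q\<in>off_diag (I x). of_bool (fst q \<in> ?S \<and> snd q \<in> ?S))"
        by (rule g.pairs_in_class_le) auto
      also have "\<dots> \<le> g.col j" unfolding g.col_def g.eq_def by (intro sum_mono) auto
      finally have "real (card ?S) * (real (card ?S) - 1) / c \<le> g.col j / c"
        using n3 by (intro divide_right_mono) (auto simp: c_def)
      moreover have "1 - real (card ?S) * (real (card ?S) - 1) / c \<le> price j"
        using pairs_defect[of "card ?S" "card (I x)"] n3 finI[OF x] card_mono[of "I x" ?S] price_up[of j x] j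
        unfolding c_def fr by auto
      ultimately show ?thesis by (auto simp: max_def)
    qed
    have subI: "up x \<subseteq> I x" "dn x \<subseteq> I x"
      using sub occ[of _ x] by (auto simp: up_def dn_def)
    \<comment> \<open>The weights 1 - \<tau> and \<tau> match the mode: each user of a row is
      charged 1 - \<tau>, each user of a column \<tau>.\<close>
    have "real (min (card (up x)) (card (dn x))) = (1 - \<tau>) * real (min (card (up x)) (card (dn x))) + \<tau> * real (min (card (up x)) (card (dn x)))"
      by (simp add: algebra_simps)
    also have "\<dots> \<le> (1 - \<tau>) * real (card (up x)) + \<tau> * real (card (dn x))"
      using \<tau> by (intro add_mono mult_left_mono) auto
    also have "\<dots> = (\<Sum>j\<in>up x. 1 - \<tau>) + (\<Sum>j\<in>dn x. \<tau>)" by simp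
    also have "\<dots> \<le> (\<Sum>j\<in>up x. price j + max 0 (g.row j / c - \<tau>)) + (\<Sum>j\<in>dn x. price j + max 0 (g.col j / c - (1 - \<tau>)))"
      by (intro add_mono sum_mono up1 dn1)
    also have "\<dots> = (\<Sum>j\<in>up x. price j) + (\<Sum>j\<in>dn x. price j) +
      ((\<Sum>j\<in>up x. max 0 (g.row j / c - \<tau>)) + (\<Sum>j\<in>dn x. max 0 (g.col j / c - (1 - \<tau>))))"
      by (simp add: sum.distrib)
    also have "(\<Sum>j\<in>up x. max 0 (g.row j / c - \<tau>)) + (\<Sum>j\<in>dn x. max 0 (g.col j / c - (1 - \<tau>))) \<le>
       (\<Sum>j\<in>I x. max 0 (g.row j / c - \<tau>)) + (\<Sum>j\<in>I x. max 0 (g.col j / c - (1 - \<tau>)))"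
      using subI finI[OF x] by (intro add_mono sum_mono2) auto
    also have "\<dots> \<le> 15 / 8 * ex x / (n x)^2" by (rule \<tau>(3))
    finally show ?thesis by simp
  qed
qed

lemma excess_scaled:
  assumes x: "x \<in> X"
  shows "8 / 15 * (real R)^2 * (min (card (up x)) (card (dn x)) - (\<Sum>j\<in>up x. price j) - (\<Sum>j\<in>dn x. price j))
    \<le> real (b x)^2 * ex x"
proof (cases "up x \<union> dn x = {}")
  case True
  then have "up x = {}" "dn x = {}" by auto
  then show ?thesis by (simp add: grid.excess_nonneg[OF grid[OF x]])
next
  case False
  then obtain j where "j \<in> J" "x \<in> att j" using leaders_sub by (auto simp: up_def dn_def)
  then have R: "real R = real (b x) * n x" by (simp add: size_real)
  have "8 / 15 * (real R)^2 * (min (card (up x)) (card (dn x)) - (\<Sum>j\<in>up x. price j) - (\<Sum>j\<in>dn x. price j))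
    \<le> 8 / 15 * (real R)^2 * (15 / 8 * ex x / (n x)^2)"
    using variable_price[OF x] by (intro mult_left_mono) auto
  also have "\<dots> = real (b x)^2 * ex x"
    unfolding R using n_pos[OF x] by (simp add: power_mult_distrib)
  finally show ?thesis .
qed

text \<open>A majority vote among the leaders, so that at each variable only the minority can be
  lost.\<close>

definition val :: "nat \<Rightarrow> bool" where "val x \<longleftrightarrow> card (dn x) \<le> card (up x)"

text \<open>A violated leader with a free literal has lost the vote at its best variable, since
  otherwise the literal there would satisfy it.\<close>

lemma unsat_sub:
  "unsat val \<subseteq> (J - leaders) \<union> {j \<in> leaders. att j = {}} \<union> (\<Union>x\<in>X. if val x then dn x else up x)"
proof
  fix j assume j: "j \<in> unsat val"
  show "j \<in> (J - leaders) \<union> {j \<in> leaders. att j = {}} \<union> (\<Union>x\<in>X. if val x then dn x else up x)"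
  proof (cases "j \<in> leaders \<and> att j \<noteq> {}")
    case True
    have jJ: "j \<in> J" using j by (auto simp: unsat_def)
    then have "best j \<in> att j" "best j \<in> X" using best(1)[of j] True attX by auto
    then have "j \<in> (if val (best j) then dn (best j) else up (best j))"
      using j True by (auto simp: unsat_def up_def dn_def)
    then show ?thesis using \<open>best j \<in> X\<close> by blast
  next
    case False
    then show ?thesis using j by (auto simp: unsat_def)
  qed
qed

lemma sum_by_best:
  "(\<Sum>j\<in>leaders. price j) = card {j \<in> leaders. att j = {}} + (\<Sum>x\<in>X. (\<Sum>j\<in>up x. price j) + (\<Sum>j\<in>dn x. price j))"
proof -
  have "(\<Sum>j\<in>leaders. price j) = (\<Sum>j\<in>{j \<in> leaders. att j = {}}. price j) + (\<Sum>j\<in>{j \<in> leaders. att j \<noteq> {}}. price j)"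
    by (subst sum.union_disjoint[symmetric]) (auto intro: sum.cong)
  also have "(\<Sum>j\<in>{j \<in> leaders. att j = {}}. price j) = (\<Sum>j\<in>{j \<in> leaders. att j = {}}. 1)"
    by (rule sum.cong) (auto simp: price_def)
  also have "(\<Sum>j\<in>{j \<in> leaders. att j \<noteq> {}}. price j) = (\<Sum>x\<in>X. \<Sum>j | j \<in> {j \<in> leaders. att j \<noteq> {}} \<and> best j = x. price j)"
  proof (rule sum.group[symmetric])
    show "best ` {j \<in> leaders. att j \<noteq> {}} \<subseteq> X"
    proof (rule image_subsetI)
      fix j assume "j \<in> {j \<in> leaders. att j \<noteq> {}}"
      then have j: "j \<in> J" "att j \<noteq> {}" using leaders_sub by (blast, blast)
      show "best j \<in> X" by (rule attX[OF j(1) best(1)[OF j]])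
    qed
  qed (simp_all add: finX)
  also have "\<dots> = (\<Sum>x\<in>X. (\<Sum>j\<in>up x. price j) + (\<Sum>j\<in>dn x. price j))"
  proof (rule sum.cong[OF refl])
    fix x
    have "{j. j \<in> {j \<in> leaders. att j \<noteq> {}} \<and> best j = x} = up x \<union> dn x"
      unfolding up_def dn_def using best(1) leaders_sub by blast
    moreover have "up x \<inter> dn x = {}" unfolding up_def dn_def using disj leaders_sub by blast
    ultimately show "(\<Sum>j | j \<in> {j \<in> leaders. att j \<noteq> {}} \<and> best j = x. price j) = (\<Sum>j\<in>up x. price j) + (\<Sum>j\<in>dn x. price j)"
      by (simp add: sum.union_disjoint)
  qed
  finally show ?thesis by simp
qed

text \<open>Three sources pay for the violated clauses: followers through clause pairs, leaders
  through their prices, and the grids for the amount by which the minorities exceed these prices.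
  Ordered pairs account for 8/15 in place of 4/15.\<close>

theorem cost_lower: "cost lam \<ge> base + 8 / 15 * (real R)^2 * card (unsat val)"
proof -
  let ?c = "8 / 15 * (real R)^2"
  let ?cr = "\<lambda>j. \<Sum>x\<in>att j. \<Sum>y\<in>att j-{x}. (frac j x * R) * (frac j y * R)"
  have c: "?c \<ge> 0" by simp
  have "real (card (unsat val)) \<le> card (J - leaders) + card {j \<in> leaders. att j = {}} + (\<Sum>x\<in>X. real (min (card (up x)) (card (dn x))))"
  proof -
    have "card (unsat val) \<le> card ((J - leaders) \<union> {j \<in> leaders. att j = {}} \<union> (\<Union>x\<in>X. if val x then dn x else up x))"
      by (rule card_mono[OF _ unsat_sub]) (use finJ finX in auto)
    also have "\<dots> \<le> card (J - leaders) + card {j \<in> leaders. att j = {}} + card (\<Union>x\<in>X. if val x then dn x else up x)"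
      by (meson add_le_mono card_Un_le le_refl order_trans)
    also have "card (\<Union>x\<in>X. if val x then dn x else up x) \<le> (\<Sum>x\<in>X. card (if val x then dn x else up x))"
      by (rule card_UN_le[OF finX])
    also have "\<dots> = (\<Sum>x\<in>X. min (card (up x)) (card (dn x)))"
      by (rule sum.cong) (auto simp: val_def)
    finally have "card (unsat val) \<le> card (J - leaders) + card {j \<in> leaders. att j = {}} + (\<Sum>x\<in>X. min (card (up x)) (card (dn x)))"
      by simp
    then show ?thesis
      unfolding of_nat_sum[symmetric] of_nat_add[symmetric] of_nat_le_iff .
  qed
  then have "?c * card (unsat val) \<le> ?c * (card (J - leaders) + card {j \<in> leaders. att j = {}} + (\<Sum>x\<in>X. real (min (card (up x)) (card (dn x)))))"
    by (rule mult_left_mono[OF _ c])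
  also have "\<dots> = ?c * card (J - leaders) + ?c * (\<Sum>j\<in>leaders. price j) +
     (\<Sum>x\<in>X. ?c * (min (card (up x)) (card (dn x)) - (\<Sum>j\<in>up x. price j) - (\<Sum>j\<in>dn x. price j)))"
    unfolding sum_by_best sum_distrib_left[symmetric]
    by (simp add: sum.distrib sum_subtractf algebra_simps)
  also have "\<dots> \<le> ?c * card (J - leaders) + (\<Sum>j\<in>leaders. 2 * real s * (real R - gain j) + ?cr j) + (\<Sum>x\<in>X. real (b x)^2 * ex x)"
    unfolding sum_distrib_left by (intro add_mono order_refl sum_mono leader_cost excess_scaled)
  \<comment> \<open>2 s^2 is 128/225 R^2, and 8/15 is 120/225.\<close>
  also have "\<dots> \<le> 2 * (real s)^2 * card (J - leaders) + (\<Sum>j\<in>leaders. 2 * real s * (real R - gain j) + ?cr j) + (\<Sum>x\<in>X. real (b x)^2 * ex x)"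
    unfolding s_real by (intro add_right_mono mult_right_mono) (auto simp: power2_eq_square)
  also have "\<dots> \<le> (\<Sum>j\<in>J. \<Sum>j'\<in>J. pair_cost lam (Cl j) (Cl j')) + (\<Sum>j\<in>J. 2 * real s * (real R - gain j))
     + (\<Sum>x\<in>X. \<Sum>y\<in>X-{x}. block_cost lam x y) + (\<Sum>x\<in>X. real (b x)^2 * ex x)"
  proof -
    \<comment> \<open>The terms added for the followers are nonnegative by
      \<open>follower_gain\<close>.\<close>
    have "(\<Sum>j\<in>leaders. 2 * real s * (real R - gain j)) \<le> (\<Sum>j\<in>J. 2 * real s * (real R - gain j))"
      using finJ leaders_sub follower_gain by (intro sum_mono2) auto
    then show ?thesis using clause_clause_cost cross_cost by (simp add: sum.distrib)
  qed
  also have "\<dots> = cost lam - base"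
  proof -
    have "(\<Sum>j\<in>J. \<Sum>x\<in>X. \<Sum>p\<in>pts x. pair_cost lam (Cl j) (pt x p)) = (\<Sum>j\<in>J. s * (card (att j) * real R - gain j))"
      by (rule sum.cong[OF refl clause_cost])
    moreover have "(\<Sum>x\<in>X. block_cost lam x x) = (\<Sum>x\<in>X. real (b x)^2 * ((n x)^2 * (n x - 1)) + real (b x)^2 * ex x)"
      by (rule sum.cong[OF refl block_cost_same])
    moreover have "2 * (\<Sum>j\<in>J. s * (card (att j) * real R - gain j)) - (\<Sum>j\<in>J. 2 * real s * (real R - gain j)) =
        2 * real s * real R * ((\<Sum>j\<in>J. real (card (att j))) - real (card J))"
      by (simp add: sum_distrib_left sum_distrib_right sum_subtractf sum.distrib algebra_simps)
    ultimately show ?thesis unfolding cost_split base_def by (simp add: sum.distrib)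
  qed
  finally show ?thesis by simp
qed

end

section \<open>Clusterings from assignments, and identical vertices\<close>

context reduction
begin

lemma cost_upper:
  assumes sat: "unsat \<sigma> = {}"
  shows "\<exists>lam :: vert \<Rightarrow> vert. cost lam = base"
proof -
  have ex: "\<exists>x. x \<in> pos j \<and> \<sigma> x \<or> x \<in> neg j \<and> \<not> \<sigma> x" if "j \<in> J" for j
    using sat that by (auto simp: unsat_def)
  define pick where "pick j = (SOME x. x \<in> pos j \<and> \<sigma> x \<or> x \<in> neg j \<and> \<not> \<sigma> x)" for j
  have pick: "pick j \<in> pos j \<and> \<sigma> (pick j) \<or> pick j \<in> neg j \<and> \<not> \<sigma> (pick j)" if "j \<in> J" for j
    unfolding pick_def by (rule someI_ex[OF ex[OF that]])
  \<comment> \<open>A row or column cluster is named by the cell whose other index is 0; a clause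
    takes the name of its line at a satisfied literal.\<close>
  define lam where "lam v = (case v of Grid x i k \<Rightarrow> if \<sigma> x then Grid x i 0 else Grid x 0 k
    | Cl j \<Rightarrow> if \<sigma> (pick j) then Grid (pick j) j 0 else Grid (pick j) 0 j)" for v
  interpret c: reduction_clustering X J I b s R pos neg lam ..
  have "c.ex x = 0" if x: "x \<in> X" for x
  proof -
    interpret g: grid "I x" "\<lambda>i k. lam (Grid x i k)" by (rule c.grid[OF x])
    have card: "(\<Sum>q\<in>off_diag (I x). 1 :: real) = g.n * (g.n - 1)"
      by (simp add: card_off_diag[OF g.finI])
    have "g.diag = 0"
      unfolding g.diag_def by (intro sum.neutral ballI) (auto simp: g.eq_def lam_def off_diag_def)
    moreover have "g.row i = (if \<sigma> x then g.n * (g.n - 1) else 0)" for i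
    proof -
      have "g.row i = (\<Sum>q\<in>off_diag (I x). if \<sigma> x then 1 else 0)"
        unfolding g.row_def by (rule sum.cong) (auto simp: g.eq_def lam_def off_diag_def)
      then show ?thesis using card by simp
    qed
    moreover have "g.col k = (if \<sigma> x then 0 else g.n * (g.n - 1))" for k
    proof -
      have "g.col k = (\<Sum>q\<in>off_diag (I x). if \<sigma> x then 0 else 1)"
        unfolding g.col_def by (rule sum.cong) (auto simp: g.eq_def lam_def off_diag_def)
      then show ?thesis using card by simp
    qed
    ultimately show ?thesis by (simp add: g.excess_def power2_eq_square)
  qed
  then have 1: "(\<Sum>x\<in>X. block_cost lam x x) = (\<Sum>x\<in>X. real (b x)^2 * (real (card (I x))^2 * (real (card (I x)) - 1)))"
    by (intro sum.cong refl) (simp add: c.block_cost_same)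
  have 2: "(\<Sum>x\<in>X. \<Sum>y\<in>X-{x}. block_cost lam x y) = 0"
    unfolding block_cost_def by (intro sum.neutral ballI) (auto simp: pair_cost_def lam_def)
  have "c.gain j = R" if j: "j \<in> J" for j
  proof -
    let ?x = "pick j"
    have x: "?x \<in> att j" "?x \<in> X" using pick[OF j] att_sub[OF j] by auto
    have j0: "j \<noteq> 0" using j J0 by metis
    have same: "c.same j y = (if y = ?x then c.line j y else {})" for y
      using pick[OF j] disj[OF j] j0 by (auto simp: c.same_def c.line_def lam_def split: if_splits)
    have "(\<Sum>x\<in>att j. real (b x) * card (c.line j x \<inter> c.same j x)) = (\<Sum>x\<in>att j. if x = ?x then real (b x) * card (c.line j x) else 0)"
      by (rule sum.cong) (auto simp: same)
    also have "\<dots> = real (b ?x) * card (c.line j ?x)" using x c.fin_att[OF j] by simp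
    finally have a: "(\<Sum>x\<in>att j. real (b x) * card (c.line j x \<inter> c.same j x)) = real (b ?x) * card (c.line j ?x)" .
    have "(\<Sum>x\<in>X. real (b x) * card (c.same j x)) = (\<Sum>x\<in>X. if x = ?x then real (b x) * card (c.line j x) else 0)"
      by (rule sum.cong) (auto simp: same)
    also have "\<dots> = real (b ?x) * card (c.line j ?x)" using x finX by simp
    finally show ?thesis unfolding c.gain_def a using c.size_real[OF j x(1)] c.card_line[OF j x(1)] by simp
  qed
  then have 3: "(\<Sum>j\<in>J. \<Sum>x\<in>X. \<Sum>p\<in>pts x. pair_cost lam (Cl j) (pt x p)) = (\<Sum>j\<in>J. s * (card (att j) * real R - R))"
    by (intro sum.cong refl) (simp add: c.clause_cost)
  have 4: "(\<Sum>j\<in>J. \<Sum>j'\<in>J. pair_cost lam (Cl j) (Cl j')) = 0"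
  proof (intro sum.neutral ballI)
    fix j j' assume "j \<in> J" "j' \<in> J"
    then have "j \<noteq> 0" "j' \<noteq> 0" using J0 by metis+
    then show "pair_cost lam (Cl j) (Cl j') = 0"
      by (auto simp: pair_cost_def lam_def)
  qed
  have "cost lam = base"
    unfolding cost_split 1 2 3 4 base_def
    by (simp add: sum_distrib_left sum_distrib_right sum_subtractf sum.distrib algebra_simps)
  then show ?thesis by blast
qed

end

definition disagreements :: "('v \<Rightarrow> 'v \<Rightarrow> bool) \<Rightarrow> 'v list \<Rightarrow> (nat \<Rightarrow> 'l) \<Rightarrow> nat" where
  "disagreements S vs l = (\<Sum>u<length vs. \<Sum>v<length vs. of_bool (S (vs ! u) (vs ! v) \<noteq> (l u = l v)))"

text \<open>Twins can be moved to the cluster of the cheapest one among them.\<close>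

lemma merge_class:
  fixes l :: "nat \<Rightarrow> 'l"
  assumes reflS: "\<And>a. S a a" and symS: "\<And>a b. S a b = S b a"
  shows "\<exists>c. disagreements S vs (\<lambda>u. if vs ! u = a then c else l u) \<le> disagreements S vs l"
proof (cases "\<exists>u<length vs. vs ! u = a")
  case False
  then have "disagreements S vs (\<lambda>u. if vs ! u = a then c else l u) = disagreements S vs l" for c
    unfolding disagreements_def by (intro sum.cong refl) auto
  then show ?thesis by (intro exI[of _ "l 0"]) simp
next
  case True
  define C where "C = {u. u < length vs \<and> vs ! u = a}"
  define D where "D = {u. u < length vs \<and> vs ! u \<noteq> a}"
  have fin: "finite C" "finite D" and CD: "C \<inter> D = {}" "C \<union> D = {..<length vs}" and ne: "C \<noteq> {}"
    using True by (auto simp: C_def D_def)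
  define F where "F l u v = (of_bool (S (vs ! u) (vs ! v) \<noteq> (l u = l v)) :: nat)" for l :: "nat \<Rightarrow> 'l" and u v
  have Fsym: "F l u v = F l v u" for l u v unfolding F_def using symS[of "vs ! u" "vs ! v"] by auto
  have split: "disagreements S vs l = (\<Sum>u\<in>C. \<Sum>v\<in>C. F l u v) + 2 * (\<Sum>u\<in>C. \<Sum>v\<in>D. F l u v) + (\<Sum>u\<in>D. \<Sum>v\<in>D. F l u v)" for l
  proof -
    have "disagreements S vs l = (\<Sum>u\<in>C \<union> D. \<Sum>v\<in>C \<union> D. F l u v)"
      unfolding disagreements_def F_def CD(2) ..
    also have "\<dots> = (\<Sum>u\<in>C. \<Sum>v\<in>C. F l u v) + (\<Sum>u\<in>C. \<Sum>v\<in>D. F l u v) + ((\<Sum>u\<in>D. \<Sum>v\<in>C. F l u v) + (\<Sum>u\<in>D. \<Sum>v\<in>D. F l u v))"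
      by (simp add: sum.union_disjoint[OF fin CD(1)] sum.distrib)
    also have "(\<Sum>u\<in>D. \<Sum>v\<in>C. F l u v) = (\<Sum>u\<in>C. \<Sum>v\<in>D. F l u v)"
      by (subst sum.swap, rule sum.cong[OF refl], rule sum.cong[OF refl], rule Fsym)
    finally show ?thesis by simp
  qed
  obtain u0 where u0: "u0 \<in> C" "\<And>u. u \<in> C \<Longrightarrow> (\<Sum>v\<in>D. F l u0 v) \<le> (\<Sum>v\<in>D. F l u v)"
    using ex_has_least_nat[of "\<lambda>u. u \<in> C" _ "\<lambda>u. \<Sum>v\<in>D. F l u v"] ne by blast
  let ?l = "\<lambda>u. if vs ! u = a then l u0 else l u"
  have "(\<Sum>u\<in>C. \<Sum>v\<in>C. F ?l u v) = 0"
    by (intro sum.neutral ballI) (auto simp: F_def C_def reflS)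
  moreover have "(\<Sum>u\<in>D. \<Sum>v\<in>D. F ?l u v) = (\<Sum>u\<in>D. \<Sum>v\<in>D. F l u v)"
    by (intro sum.cong refl) (auto simp: F_def D_def)
  moreover have "(\<Sum>u\<in>C. \<Sum>v\<in>D. F ?l u v) \<le> (\<Sum>u\<in>C. \<Sum>v\<in>D. F l u v)"
  proof (rule sum_mono)
    fix u assume u: "u \<in> C"
    have "(\<Sum>v\<in>D. F ?l u v) = (\<Sum>v\<in>D. F l u0 v)"
      by (intro sum.cong refl) (use u u0(1) in \<open>auto simp: F_def C_def D_def\<close>)
    then show "(\<Sum>v\<in>D. F ?l u v) \<le> (\<Sum>v\<in>D. F l u v)" using u0(2)[OF u] by simp
  qed
  ultimately show ?thesis unfolding split by (intro exI[of _ "l u0"]) linarith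
qed

text \<open>The types are treated one after the other. A step relabels a single type, so those
  already treated keep a common label, and in the end the labeling depends on the type only.\<close>

lemma merge_twins:
  fixes l :: "nat \<Rightarrow> 'l" and vs :: "'v list"
  assumes reflS: "\<And>a. S a a" and symS: "\<And>a b. S a b = S b a"
  shows "\<exists>lam :: 'v \<Rightarrow> 'l. disagreements S vs (\<lambda>u. lam (vs ! u)) \<le> disagreements S vs l"
proof -
  have "\<exists>lam :: 'v \<Rightarrow> 'l. disagreements S vs (\<lambda>u. if vs ! u \<in> F then lam (vs ! u) else l u) \<le> disagreements S vs l"
    if "finite F" for F using that
  proof (induction F)
    case (insert a F)
    then obtain lam where lam: "disagreements S vs (\<lambda>u. if vs ! u \<in> F then lam (vs ! u) else l u) \<le> disagreements S vs l" by blast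
    obtain c where c: "disagreements S vs (\<lambda>u. if vs ! u = a then c else if vs ! u \<in> F then lam (vs ! u) else l u)
        \<le> disagreements S vs (\<lambda>u. if vs ! u \<in> F then lam (vs ! u) else l u)"
      using merge_class[where S = S and vs = vs and a = a and
          l = "\<lambda>u. if vs ! u \<in> F then lam (vs ! u) else l u", OF reflS symS] by blast
    have "(\<lambda>u. if vs ! u = a then c else if vs ! u \<in> F then lam (vs ! u) else l u) =
      (\<lambda>u. if vs ! u \<in> insert a F then (lam(a := c)) (vs ! u) else l u)" by (auto simp: fun_eq_iff)
    then show ?case using c lam by (intro exI[of _ "lam(a := c)"]) simp
  qed simp
  from this[of "set vs"] obtain lam :: "'v \<Rightarrow> 'l" where
    "disagreements S vs (\<lambda>u. if vs ! u \<in> set vs then lam (vs ! u) else l u) \<le> disagreements S vs l" by auto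
  moreover have "disagreements S vs (\<lambda>u. if vs ! u \<in> set vs then lam (vs ! u) else l u) =
      disagreements S vs (\<lambda>u. lam (vs ! u))"
    unfolding disagreements_def by (intro sum.cong refl) auto
  ultimately show ?thesis by (intro exI[of _ lam]) simp
qed

definition similarity_edges :: "('v \<Rightarrow> 'v \<Rightarrow> bool) \<Rightarrow> 'v list \<Rightarrow> nat set set" where
  "similarity_edges S vs = {{u, v} | u v. u < length vs \<and> v < length vs \<and> u \<noteq> v \<and> S (vs ! u) (vs ! v)}"

lemma similarity_edges_sub: "similarity_edges S vs \<subseteq> complete_edges (length vs)"
  by (auto simp: similarity_edges_def complete_edges_def)

lemma card_ordered_pairs:
  assumes sym: "\<And>u v. Q u v \<Longrightarrow> Q v u" and irr: "\<And>u. \<not> Q u u"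
  shows "card {(u, v). u < N \<and> v < N \<and> Q u v} = 2 * card {e \<in> complete_edges N. \<exists>u v. e = {u, v} \<and> Q u v}"
proof -
  let ?E = "{e \<in> complete_edges N. \<exists>u v. e = {u, v} \<and> Q u v}"
  let ?P = "\<lambda>e. {(u, v). {u, v} = e \<and> u \<noteq> (v :: nat)}"
  have fin: "finite ?E"
    by (rule finite_subset[of _ "Pow {..<N}"]) (auto simp: complete_edges_def)
  have two: "card (?P e) = 2" if "e \<in> ?E" for e
  proof -
    from that obtain u v where e: "e = {u, v}" "Q u v" by blast
    have "u \<noteq> v" using e irr by blast
    then have "?P e = {(u, v), (v, u)}" unfolding e by (auto simp: doubleton_eq_iff)
    then show ?thesis using \<open>u \<noteq> v\<close> by simp
  qed
  have "{(u, v). u < N \<and> v < N \<and> Q u v} = (\<Union>e\<in>?E. ?P e)"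
  proof (intro set_eqI iffI)
    fix p assume "p \<in> {(u, v). u < N \<and> v < N \<and> Q u v}"
    then obtain u v where p: "p = (u, v)" "u < N" "v < N" "Q u v" by blast
    then have "u \<noteq> v" using irr by blast
    then have uv: "{u, v} \<in> complete_edges N" using p by (auto simp: complete_edges_def)
    have "{u, v} \<in> ?E"
      by (intro CollectI conjI uv exI[of _ u] exI[of _ v] refl p(4))
    then show "p \<in> (\<Union>e\<in>?E. ?P e)"
      by (rule UN_I) (simp add: p(1) \<open>u \<noteq> v\<close>)
  next
    fix p assume "p \<in> (\<Union>e\<in>?E. ?P e)"
    then obtain e where e: "e \<in> ?E" "p \<in> ?P e" by (rule UN_E)
    obtain u v where "p = (u, v)" by (cases p)
    with e have p: "p = (u, v)" "{u, v} \<in> ?E" by simp_all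
    then have "Q u v" using sym by (auto simp: doubleton_eq_iff)
    moreover have "u < N" "v < N" using p by (auto simp: complete_edges_def)
    ultimately show "p \<in> {(u, v). u < N \<and> v < N \<and> Q u v}" using p by blast
  qed
  also have "card \<dots> = (\<Sum>e\<in>?E. card (?P e))"
  proof (rule card_UN_disjoint[OF fin])
    show "\<forall>e\<in>?E. finite (?P e)"
    proof
      fix e assume "e \<in> ?E"
      from two[OF this] show "finite (?P e)" by (intro card_ge_0_finite) simp
    qed
    show "\<forall>e\<in>?E. \<forall>e'\<in>?E. e \<noteq> e' \<longrightarrow> ?P e \<inter> ?P e' = {}" by blast
  qed
  also have "\<dots> = (\<Sum>e\<in>?E. 2)" by (rule sum.cong[OF refl two])
  also have "\<dots> = 2 * card ?E" by simp
  finally show ?thesis .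
qed

lemma mistakes_disagreements:
  assumes reflS: "\<And>a. S a a" and symS: "\<And>a b. S a b = S b a"
    and C: "\<And>u v. u < length vs \<Longrightarrow> v < length vs \<Longrightarrow> together C {u, v} \<longleftrightarrow> l u = l v"
  shows "2 * mistakes (length vs) (similarity_edges S vs) C = disagreements S vs l"
proof -
  let ?N = "length vs"
  let ?Q = "\<lambda>u v. S (vs ! u) (vs ! v) \<noteq> (l u = l v)"
  have "{e \<in> complete_edges ?N. if e \<in> similarity_edges S vs then \<not> together C e else together C e} =
    {e \<in> complete_edges ?N. \<exists>u v. e = {u, v} \<and> ?Q u v}"
  proof (intro set_eqI)
    fix e
    show "e \<in> {e \<in> complete_edges ?N. if e \<in> similarity_edges S vs then \<not> together C e else together C e} \<longleftrightarrow>
       e \<in> {e \<in> complete_edges ?N. \<exists>u v. e = {u, v} \<and> ?Q u v}"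
    proof (cases "e \<in> complete_edges ?N")
      case True
      then obtain u v where e: "e = {u, v}" "u \<noteq> v" by (auto simp: complete_edges_def card_2_iff)
      then have uv: "u < ?N" "v < ?N" using True by (auto simp: complete_edges_def)
      have 1: "e \<in> similarity_edges S vs \<longleftrightarrow> S (vs ! u) (vs ! v)"
        using e uv symS by (auto simp: similarity_edges_def doubleton_eq_iff)
      have 2: "(\<exists>u v. e = {u, v} \<and> ?Q u v) \<longleftrightarrow> ?Q u v"
        using e symS by (auto simp: doubleton_eq_iff)
      show ?thesis using True by (simp only: mem_Collect_eq 1 2) (simp add: e C[OF uv])
    qed simp
  qed
  moreover have "card {(u, v). u < ?N \<and> v < ?N \<and> ?Q u v} =
      2 * card {e \<in> complete_edges ?N. \<exists>u v. e = {u, v} \<and> ?Q u v}"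
  proof (rule card_ordered_pairs)
    show "?Q v u" if "?Q u v" for u v using that symS[of "vs ! u" "vs ! v"] by auto
    show "\<not> ?Q u u" for u using reflS by simp
  qed
  ultimately have "2 * mistakes ?N (similarity_edges S vs) C = card {(u, v). u < ?N \<and> v < ?N \<and> ?Q u v}"
    unfolding mistakes_def by (simp only:)
  also have "{(u, v). u < ?N \<and> v < ?N \<and> ?Q u v} = {p \<in> {..<?N} \<times> {..<?N}. ?Q (fst p) (snd p)}" by auto
  also have "card \<dots> = (\<Sum>p\<in>{..<?N} \<times> {..<?N}. of_bool (?Q (fst p) (snd p)))"
    by (simp add: of_bool_def sum.If_cases Int_def)
  also have "\<dots> = disagreements S vs l"
    unfolding disagreements_def by (simp add: sum.cartesian_product')
  finally show ?thesis .
qed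

definition label_partition :: "nat \<Rightarrow> (nat \<Rightarrow> 'l) \<Rightarrow> nat set set" where
  "label_partition N l = (\<lambda>u. {v. v < N \<and> l v = l u}) ` {..<N}"

lemma label_partition: "partition_on {..<N} (label_partition N l)"
  by (rule partition_onI) (auto simp: label_partition_def disjnt_def)

lemma together_label_partition:
  "u < N \<Longrightarrow> v < N \<Longrightarrow> together (label_partition N l) {u, v} \<longleftrightarrow> l u = l v"
  by (auto simp: label_partition_def together_def)

text \<open>The clusters themselves serve as labels, which brings arbitrary partitions under the
  results on labelings.\<close>

lemma together_partition:
  assumes C: "partition_on {..<N} C" and uv: "u < N" "v < N"
  shows "together C {u, v} \<longleftrightarrow> (THE X. X \<in> C \<and> u \<in> X) = (THE X. X \<in> C \<and> v \<in> X)"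
proof -
  have ex1: "\<exists>!X. X \<in> C \<and> w \<in> X" if "w < N" for w
  proof -
    have "w \<in> \<Union>C" using partition_onD1[OF C] that by blast
    then obtain X where "X \<in> C" "w \<in> X" by blast
    then show ?thesis using partition_onD2[OF C] by (auto simp: disjoint_def)
  qed
  let ?X = "\<lambda>w. THE X. X \<in> C \<and> w \<in> X"
  have X: "?X w \<in> C" "w \<in> ?X w" if "w < N" for w using theI'[OF ex1[OF that]] by auto
  have eq: "?X w = Y" if "w < N" "Y \<in> C" "w \<in> Y" for w Y
    by (rule the1_equality[OF ex1[OF that(1)]]) (use that in simp)
  show ?thesis
  proof
    assume "together C {u, v}"
    then obtain Y where "Y \<in> C" "u \<in> Y" "v \<in> Y" by (auto simp: together_def)
    then show "?X u = ?X v" using eq uv by simp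
  next
    assume "?X u = ?X v"
    then show "together C {u, v}" using X[OF uv(1)] X[OF uv(2)] by (auto simp: together_def)
  qed
qed

lemma finite_mistakes_set: "finite {mistakes N E C | C. partition_on {..<N} C}"
proof -
  have "{C. partition_on {..<N} C} \<subseteq> Pow (Pow {..<N})" by (auto simp: partition_on_def)
  then have "finite {C. partition_on {..<N} C}" by (rule finite_subset) simp
  then have "finite (mistakes N E ` {C. partition_on {..<N} C})" by simp
  moreover have "{mistakes N E C | C. partition_on {..<N} C} = mistakes N E ` {C. partition_on {..<N} C}" by auto
  ultimately show ?thesis by simp
qed

lemma C_OPT_le: "partition_on {..<N} C \<Longrightarrow> C_OPT N E \<le> mistakes N E C"
  unfolding C_OPT_def by (rule Min_le[OF finite_mistakes_set]) blast

lemma optimal_exists: "\<exists>C. optimal N E C"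
proof -
  have "C_OPT N E \<in> {mistakes N E C | C. partition_on {..<N} C}"
    unfolding C_OPT_def
    using label_partition[of N "\<lambda>u. u"] by (intro Min_in[OF finite_mistakes_set]) blast
  then show ?thesis unfolding optimal_def by auto
qed

section \<open>The clustering instance of a formula\<close>

primrec sgn_of :: "literal \<Rightarrow> bool" where
  "sgn_of (Pos x) = True"
| "sgn_of (Neg x) = False"

fun lits :: "clause \<Rightarrow> literal set" where
  "lits (a, b, c) = {a, b, c}"

lemma finite_lits [simp]: "finite (lits c)" and card_lits: "card (lits c) \<le> 3"
  by (cases c; simp add: card_insert_if)+

lemma sat_clause_iff: "sat_clause \<sigma> c \<longleftrightarrow> (\<exists>l\<in>lits c. sat_literal \<sigma> l)"
  by (cases c) auto

lemma clause_vars_lits: "clause_vars c = var_of ` lits c"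
  by (cases c) auto

text \<open>Clauses are numbered \<open>m, \<dots>, 1\<close> along the list, i.e. by the length of the remaining list; the
  number 0 serves as the additional index of every grid. A variable without occurrences gets a 2 x 2
  grid of single vertices, so that the optimal cost is at least linear in the number of clauses.\<close>

locale formula_reduction =
  fixes \<phi> :: formula and A :: "nat \<Rightarrow> bool option" and R s :: nat
begin

definition clause_at :: "nat \<Rightarrow> clause" where "clause_at j = \<phi> ! (length \<phi> - j)"

text \<open>Besides the clauses satisfied by the guessed values, tautologies are removed; this keeps
  \<open>pos\<close> and \<open>neg\<close> disjoint.\<close>

definition dropped :: "nat \<Rightarrow> bool" where
  "dropped j \<longleftrightarrow> (\<exists>l\<in>lits (clause_at j). A (var_of l) = Some (sgn_of l)) \<or>
     (\<exists>x. Pos x \<in> lits (clause_at j) \<and> Neg x \<in> lits (clause_at j))"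

definition J :: "nat set" where "J = {j. 1 \<le> j \<and> j \<le> length \<phi> \<and> \<not> dropped j}"

text \<open>Literals falsified by the guess disappear, so a clause may be left without any
  literal.\<close>

definition pos :: "nat \<Rightarrow> nat set" where "pos j = {x. Pos x \<in> lits (clause_at j) \<and> A x = None}"
definition neg :: "nat \<Rightarrow> nat set" where "neg j = {x. Neg x \<in> lits (clause_at j) \<and> A x = None}"

definition occurs :: "nat \<Rightarrow> nat set" where "occurs x = {j \<in> J. x \<in> pos j \<union> neg j}"

definition I :: "nat \<Rightarrow> nat set" where
  "I x = insert 0 (if occurs x = {} then {1} else occurs x)"

definition b :: "nat \<Rightarrow> nat" where
  "b x = (if occurs x = {} then 1 else R div card (I x))"

text \<open>At most 3 m variables occur in a formula with m clauses, so at least m of these 4 m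
  grids are idle.\<close>

definition X :: "nat set" where "X = {..<4 * length \<phi>}"

text \<open>Decreasing order after the 0, because suffixes of a list come with decreasing lengths:
  \<open>vertices\<close> has to match the list that the program produces.\<close>

definition index_list :: "nat \<Rightarrow> nat list" where
  "index_list x = 0 # (if occurs x = {} then [1] else filter (\<lambda>j. j \<in> occurs x) (rev [1..<Suc (length \<phi>)]))"

definition vertices :: "vert list" where
  "vertices = concat (map (\<lambda>x. concat (map (\<lambda>i. concat (map (\<lambda>k. replicate (b x) (Grid x i k))
       (index_list x))) (index_list x))) (rev [0..<4 * length \<phi>])) @
     concat (map (\<lambda>j. replicate s (Cl j)) (filter (\<lambda>j. j \<in> J) (rev [1..<Suc (length \<phi>)])))"

end

locale valid_reduction = formula_reduction +
  assumes vars: "c \<in> set \<phi> \<Longrightarrow> clause_vars c \<subseteq> {..<3 * length \<phi>}"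
    and dvd: "occurs x \<noteq> {} \<Longrightarrow> card (I x) dvd R"
    and s_R: "15 * s = 8 * R" and R_pos: "R > 0"
begin

lemma finite_J: "finite J" by (rule finite_subset[of _ "{..length \<phi>}"]) (auto simp: J_def)

lemma finite_occurs [simp]: "finite (occurs x)" using finite_J by (simp add: occurs_def)

lemma J_0: "0 \<notin> J" by (simp add: J_def)

lemma clause_at_in: "j \<in> J \<Longrightarrow> clause_at j \<in> set \<phi>"
  by (auto simp: J_def clause_at_def)

lemma finite_I [simp]: "finite (I x)" by (simp add: I_def)

lemma card_I: "card (I x) = (if occurs x = {} then 2 else Suc (card (occurs x)))"
proof -
  have "0 \<notin> occurs x" using J_0 by (simp add: occurs_def)
  then show ?thesis by (simp add: I_def)
qed

lemma att_image: "pos j \<union> neg j \<subseteq> var_of ` lits (clause_at j)"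
  by (force simp: pos_def neg_def)

sublocale reduction X J I b s R pos neg
proof
  show "finite X" by (simp add: X_def)
  show "finite J" by (rule finite_J)
  show "finite (I x)" for x by simp
  show "pos j \<union> neg j \<subseteq> X" if "j \<in> J" for j
    using att_image[of j] vars[OF clause_at_in[OF that]] by (force simp: X_def clause_vars_lits)
  show "pos j \<inter> neg j = {}" if "j \<in> J" for j
    using that by (auto simp: J_def dropped_def pos_def neg_def)
  show "card (pos j \<union> neg j) \<le> 3" for j
  proof -
    have "card (pos j \<union> neg j) \<le> card (var_of ` lits (clause_at j))"
      by (rule card_mono[OF _ att_image]) simp
    also have "\<dots> \<le> card (lits (clause_at j))" by (rule card_image_le) simp
    also have "\<dots> \<le> 3" by (rule card_lits)
    finally show ?thesis .
  qed
  show "j \<in> I x" if "j \<in> J" "x \<in> pos j \<union> neg j" for j x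
    using that by (auto simp: I_def occurs_def)
  show "0 \<in> I x" for x by (simp add: I_def)
  show "0 \<notin> J" by (rule J_0)
  show "b x * card (I x) = R" if "j \<in> J" "x \<in> pos j \<union> neg j" for j x
  proof -
    have "occurs x \<noteq> {}" using that by (auto simp: occurs_def)
    then show ?thesis using dvd[of x] by (simp add: b_def)
  qed
  show "15 * s = 8 * R" "R > 0" by (rule s_R R_pos)+
qed

lemma index_list: "distinct (index_list x)" "set (index_list x) = I x"
  using J_0 by (auto simp: index_list_def I_def occurs_def J_def)

lemma sum_list_concat_map: "sum_list (concat (map f xs)) = (\<Sum>x\<leftarrow>xs. sum_list (f x))"
  by (induction xs) auto

lemma sum_list_vertices:
  fixes f :: "vert \<Rightarrow> real"
  shows "sum_list (map f vertices) = vsum (\<lambda>v. real (weight v) * f v)"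
proof -
  have rep: "sum_list (replicate k c) = real k * c" for k and c :: real
    by (induction k) (auto simp: algebra_simps)
  have dist: "distinct (filter (\<lambda>j. j \<in> J) (rev [1..<Suc (length \<phi>)]))"
    "set (filter (\<lambda>j. j \<in> J) (rev [1..<Suc (length \<phi>)])) = J"
    by (auto simp: J_def)
  have "sum_list (map f vertices) =
    (\<Sum>x\<leftarrow>rev [0..<4 * length \<phi>]. \<Sum>i\<leftarrow>index_list x. \<Sum>k\<leftarrow>index_list x. real (b x) * f (Grid x i k)) +
    (\<Sum>j\<leftarrow>filter (\<lambda>j. j \<in> J) (rev [1..<Suc (length \<phi>)]). real s * f (Cl j))"
    by (simp add: vertices_def map_concat comp_def sum_list_concat_map rep map_replicate del: upt_Suc)
  also have "\<dots> = (\<Sum>x\<in>X. \<Sum>i\<in>I x. \<Sum>k\<in>I x. real (b x) * f (Grid x i k)) + (\<Sum>j\<in>J. real s * f (Cl j))"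
  proof -
    have "(\<Sum>i\<leftarrow>index_list x. g i) = (\<Sum>i\<in>I x. g i)" for x and g :: "nat \<Rightarrow> real"
      using sum_list_distinct_conv_sum_set[OF index_list(1)] unfolding index_list(2) .
    moreover have "(\<Sum>x\<leftarrow>rev [0..<4 * length \<phi>]. g x) = (\<Sum>x\<in>X. g x)" for g :: "nat \<Rightarrow> real"
      using sum_list_distinct_conv_sum_set[of "rev [0..<4 * length \<phi>]" g] by (simp add: X_def atLeast0LessThan)
    moreover have "(\<Sum>j\<leftarrow>filter (\<lambda>j. j \<in> J) (rev [1..<Suc (length \<phi>)]). g j) = (\<Sum>j\<in>J. g j)" for g :: "nat \<Rightarrow> real"
      using sum_list_distinct_conv_sum_set[OF dist(1)] unfolding dist(2) .
    ultimately show ?thesis by (simp only:)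
  qed
  finally show ?thesis by (simp add: vsum_def sum.cartesian_product')
qed

abbreviation N :: nat where "N \<equiv> length vertices"
abbreviation E :: "nat set set" where "E \<equiv> similarity_edges sim vertices"

lemma sum_vertices:
  fixes f :: "vert \<Rightarrow> real"
  shows "(\<Sum>u<N. f (vertices ! u)) = vsum (\<lambda>v. real (weight v) * f v)"
  unfolding sum_list_vertices[symmetric] by (simp add: sum_list_sum_nth atLeast0LessThan)

text \<open>Grouping the copies of each type turns both sums over vertices into weighted sums over
  types.\<close>

lemma disagreements_cost:
  "real (disagreements sim vertices (\<lambda>u. lam (vertices ! u))) = cost lam"
proof -
  have mult: "a * vsum f = vsum (\<lambda>v. a * f v)" for a f
    by (simp add: vsum_def sum_distrib_left distrib_left)
  let ?g = "\<lambda>u v. of_bool (sim u v \<noteq> (lam u = lam v)) :: real"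
  have "real (disagreements sim vertices (\<lambda>u. lam (vertices ! u))) =
      (\<Sum>u<N. \<Sum>v<N. ?g (vertices ! u) (vertices ! v))"
    unfolding disagreements_def of_nat_sum of_nat_of_bool ..
  also have "\<dots> = (\<Sum>u<N. vsum (\<lambda>v. real (weight v) * ?g (vertices ! u) v))"
    by (rule sum.cong[OF refl sum_vertices])
  also have "\<dots> = vsum (\<lambda>u. real (weight u) * vsum (\<lambda>v. real (weight v) * ?g u v))"
    by (rule sum_vertices)
  finally have "real (disagreements sim vertices (\<lambda>u. lam (vertices ! u))) =
    vsum (\<lambda>u. real (weight u) * vsum (\<lambda>v. real (weight v) * ?g u v))" .
  then show ?thesis unfolding mult cost_def pair_cost_def by (simp add: mult.assoc)
qed

lemma sim_refl: "sim a a" by (cases a) auto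

lemma mistakes_lower:
  assumes "partition_on {..<N} C"
  shows "\<exists>\<sigma>. 2 * real (mistakes N E C) \<ge> base + 8 / 15 * (real R)^2 * card (unsat \<sigma>)"
proof -
  let ?l = "\<lambda>u. THE X. X \<in> C \<and> u \<in> X"
  have 1: "2 * mistakes N E C = disagreements sim vertices ?l"
    by (rule mistakes_disagreements[OF sim_refl sim_commute together_partition[OF assms]])
  obtain lam :: "vert \<Rightarrow> nat set" where 2: "disagreements sim vertices (\<lambda>u. lam (vertices ! u)) \<le> disagreements sim vertices ?l"
    using merge_twins[where S = sim and vs = vertices and l = ?l, OF sim_refl sim_commute] by blast
  interpret c: reduction_clustering X J I b s R pos neg lam ..
  have "base + 8 / 15 * (real R)^2 * card (unsat c.val) \<le> cost lam" by (rule c.cost_lower)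
  also have "\<dots> \<le> real (2 * mistakes N E C)"
    unfolding disagreements_cost[symmetric] 1 using 2 by simp
  finally show ?thesis by auto
qed

lemma C_OPT_upper:
  assumes "unsat \<sigma> = {}"
  shows "2 * real (C_OPT N E) \<le> base"
proof -
  obtain lam :: "vert \<Rightarrow> vert" where lam: "cost lam = base" using cost_upper[OF assms] by blast
  let ?C = "label_partition N (\<lambda>u. lam (vertices ! u))"
  have "2 * mistakes N E ?C = disagreements sim vertices (\<lambda>u. lam (vertices ! u))"
    by (rule mistakes_disagreements[OF sim_refl sim_commute together_label_partition])
  then have "real (2 * mistakes N E ?C) = base" unfolding lam[symmetric] disagreements_cost[symmetric] by simp
  moreover have "C_OPT N E \<le> mistakes N E ?C" by (rule C_OPT_le[OF label_partition])
  ultimately show ?thesis by simp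
qed

section \<open>Bounds on the base value, the optimum and the number of vertices\<close>

lemma sum_occurs: "(\<Sum>j\<in>J. real (card (att j))) = (\<Sum>x\<in>X. real (card (occurs x)))"
proof -
  have "(\<Sum>j\<in>J. real (card (att j))) = (\<Sum>j\<in>J. \<Sum>x\<in>X. of_bool (x \<in> att j))"
  proof (rule sum.cong[OF refl])
    fix j assume "j \<in> J"
    then have "X \<inter> att j = att j" using att_sub by blast
    then show "real (card (att j)) = (\<Sum>x\<in>X. of_bool (x \<in> att j))"
      using finX by (simp add: of_bool_def sum.If_cases del: Un_iff)
  qed
  also have "\<dots> = (\<Sum>x\<in>X. \<Sum>j\<in>J. of_bool (x \<in> att j))" by (rule sum.swap)
  also have "\<dots> = (\<Sum>x\<in>X. real (card (occurs x)))"
    by (rule sum.cong[OF refl]) (simp add: of_bool_def sum.If_cases finite_J occurs_def Int_def del: Un_iff)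
  finally show ?thesis .
qed

lemma base_eq:
  "base = (\<Sum>x\<in>X. if occurs x = {} then 4 else (real R)^2 * card (occurs x)) +
     2 * real s * real R * ((\<Sum>x\<in>X. real (card (occurs x))) - card J)"
proof -
  have "real (b x)^2 * (real (card (I x))^2 * (real (card (I x)) - 1)) =
      (if occurs x = {} then 4 else (real R)^2 * card (occurs x))" for x
  proof (cases "occurs x = {}")
    case False
    have "real (b x) * card (I x) = R" using dvd[OF False] False
      by (metis b_def dvd_div_mult_self of_nat_mult)
    then have "real (b x)^2 * real (card (I x))^2 = (real R)^2" by (metis power_mult_distrib)
    then show ?thesis using False by (simp add: card_I flip: mult.assoc)
  qed (simp add: card_I b_def)
  then show ?thesis unfolding base_def sum_occurs by simp
qed

lemma card_J: "card J \<le> length \<phi>"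
proof -
  have "J \<subseteq> {1..length \<phi>}" by (auto simp: J_def)
  from card_mono[OF _ this] show ?thesis by simp
qed

lemma sum_occurs_le: "(\<Sum>x\<in>X. real (card (occurs x))) \<le> 3 * card J"
proof -
  have "(\<Sum>j\<in>J. real (card (att j))) \<le> (\<Sum>j\<in>J. 3)"
    by (rule sum_mono) (use card3 in force)
  then show ?thesis by (simp add: sum_occurs)
qed

text \<open>Each occurrence costs R^2 in its grid and 2 s R = 16/15 R^2 for a cut literal, and each
  clause saves 16/15 R^2 once. With three literals this is 3 * 31/15 - 16/15 = 77/15. The 16 stems
  from 4 m grids that contribute at most 4 each when idle.\<close>

lemma base_le: "base \<le> (16 + 77 / 15 * (real R)^2) * length \<phi>"
proof -
  let ?S = "\<Sum>x\<in>X. real (card (occurs x))"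
  have s: "real s = 8 / 15 * real R"
    using s_R by (metis (no_types, lifting) nonzero_mult_div_cancel_left of_nat_mult of_nat_numeral
        times_divide_eq_left zero_neq_numeral)
  have "(\<Sum>x\<in>X. if occurs x = {} then 4 else (real R)^2 * card (occurs x)) \<le> (\<Sum>x\<in>X. 4 + (real R)^2 * card (occurs x))"
    by (rule sum_mono) auto
  also have "\<dots> = 16 * length \<phi> + (real R)^2 * ?S"
    by (simp add: sum.distrib X_def flip: sum_distrib_left)
  finally have "base \<le> 16 * length \<phi> + (real R)^2 * ?S + 16 / 15 * (real R)^2 * (?S - card J)"
    unfolding base_eq s by (simp add: power2_eq_square)
  also have "\<dots> = 16 * length \<phi> + (real R)^2 * (31 / 15 * ?S - 16 / 15 * card J)"
    by (simp add: field_simps)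
  also have "\<dots> \<le> 16 * length \<phi> + (real R)^2 * (77 / 15 * length \<phi>)"
    using sum_occurs_le card_J by (intro add_mono mult_left_mono) auto
  finally show ?thesis by (simp add: algebra_simps)
qed

text \<open>At least m idle grids contribute 4 each. Satisfiability excludes clauses without
  literals, whose contribution would be negative.\<close>

lemma base_ge:
  assumes "unsat \<sigma> = {}"
  shows "base \<ge> 4 * length \<phi>"
proof -
  let ?U = "{x \<in> X. occurs x \<noteq> {}}"
  have "att j \<noteq> {}" if "j \<in> J" for j using assms that by (auto simp: unsat_def)
  then have "card (att j) \<ge> 1" if "j \<in> J" for j
    using that att_sub finX by (metis One_nat_def Suc_leI card_gt_0_iff finite_subset)
  then have "(\<Sum>j\<in>J. 1) \<le> (\<Sum>j\<in>J. real (card (att j)))" by (intro sum_mono) auto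
  then have 1: "(\<Sum>x\<in>X. real (card (occurs x))) - card J \<ge> 0" by (simp add: sum_occurs)
  have "real (card ?U) = (\<Sum>x\<in>?U. 1)" by simp
  also have "\<dots> \<le> (\<Sum>x\<in>?U. real (card (occurs x)))"
    by (rule sum_mono) (auto simp: Suc_leI card_gt_0_iff)
  also have "\<dots> \<le> (\<Sum>x\<in>X. real (card (occurs x)))" by (rule sum_mono2) (use finX in auto)
  also have "\<dots> \<le> 3 * length \<phi>" using sum_occurs_le card_J by simp
  finally have U: "card ?U \<le> 3 * length \<phi>" by simp
  have "X - ?U = {x \<in> X. occurs x = {}}" by auto
  then have "card {x \<in> X. occurs x = {}} = 4 * length \<phi> - card ?U"
  proof -
    have "card (X - ?U) = card X - card ?U" by (rule card_Diff_subset) (use finX in auto)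
    then show ?thesis unfolding \<open>X - ?U = _\<close> by (simp add: X_def)
  qed
  then have "length \<phi> \<le> card {x \<in> X. occurs x = {}}" using U by simp
  then have "4 * real (length \<phi>) \<le> (\<Sum>x\<in>{x \<in> X. occurs x = {}}. 4)" by simp
  also have "\<dots> \<le> (\<Sum>x\<in>X. if occurs x = {} then 4 else (real R)^2 * card (occurs x))"
    by (rule order_trans[OF _ sum_mono2[where A = "{x \<in> X. occurs x = {}}"]]) (use finX in auto)
  finally have "4 * real (length \<phi>) \<le> (\<Sum>x\<in>X. if occurs x = {} then 4 else (real R)^2 * card (occurs x))" .
  moreover have "2 * real s * real R * ((\<Sum>x\<in>X. real (card (occurs x))) - card J) \<ge> 0" using 1 by simp
  ultimately show ?thesis unfolding base_eq by linarith
qed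

text \<open>It makes the optimum tend to infinity with m, as the asymptotic query bound
  presupposes.\<close>

lemma C_OPT_lower:
  assumes "unsat \<sigma> = {}"
  shows "length \<phi> \<le> C_OPT N E"
proof -
  obtain C where C: "optimal N E C" using optimal_exists by blast
  then obtain \<tau> where "2 * real (mistakes N E C) \<ge> base + 8 / 15 * (real R)^2 * card (unsat \<tau>)"
    using mistakes_lower unfolding optimal_def by blast
  moreover have "8 / 15 * (real R)^2 * card (unsat \<tau>) \<ge> 0" by simp
  ultimately have "2 * real (C_OPT N E) \<ge> 4 * length \<phi>"
    using base_ge[OF assms] C unfolding optimal_def by linarith
  then show ?thesis by simp
qed

lemma N_le: "N \<le> (4 * (R * R + 4) + s) * length \<phi>"
proof -
  have "real N = vsum (\<lambda>v. real (weight v) * 1)"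
    using sum_list_vertices[of "\<lambda>_. 1"] by (simp add: sum_list_triv)
  also have "\<dots> = (\<Sum>x\<in>X. real (card (I x) * card (I x) * b x)) + real (card J * s)"
    by (simp add: vsum_def card_cartesian_product)
  also have "\<dots> \<le> (\<Sum>x\<in>X. real (R * R + 4)) + real (card J * s)"
  proof (intro add_mono sum_mono order_refl of_nat_mono)
    fix x
    show "card (I x) * card (I x) * b x \<le> R * R + 4"
    proof (cases "occurs x = {}")
      case False
      then have "card (I x) * b x = R" using dvd[OF False] by (simp add: b_def)
      moreover have "card (I x) \<le> R" using dvd[OF False] R_pos by (rule dvd_imp_le)
      ultimately show ?thesis by (simp add: mult.assoc trans_le_add1)
    qed (simp add: card_I b_def)
  qed
  also have "\<dots> = real (4 * length \<phi> * (R * R + 4) + card J * s)" by (simp add: X_def)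
  finally have "N \<le> 4 * length \<phi> * (R * R + 4) + card J * s" by linarith
  also have "\<dots> \<le> 4 * length \<phi> * (R * R + 4) + length \<phi> * s"
    using card_J by (intro add_left_mono mult_right_mono) auto
  finally show ?thesis by (simp add: algebra_simps)
qed

definition extend :: "(nat \<Rightarrow> bool) \<Rightarrow> nat \<Rightarrow> bool" where
  "extend \<sigma> x = (case A x of None \<Rightarrow> \<sigma> x | Some v \<Rightarrow> v)"

text \<open>A clause violated by the extended assignment is neither satisfied by the guess nor a
  tautology. Hence it was kept, and its free literals are all false.\<close>

lemma num_sat_extend: "real (length \<phi>) - card (unsat \<sigma>) \<le> num_sat (extend \<sigma>) \<phi>"
proof -
  let ?V = "{i. i < length \<phi> \<and> \<not> sat_clause (extend \<sigma>) (\<phi> ! i)}"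
  have "(\<lambda>i. length \<phi> - i) ` ?V \<subseteq> unsat \<sigma>"
  proof
    fix j assume "j \<in> (\<lambda>i. length \<phi> - i) ` ?V"
    then obtain i where i: "i < length \<phi>" "\<not> sat_clause (extend \<sigma>) (\<phi> ! i)" "j = length \<phi> - i" by blast
    then have cl: "clause_at j = \<phi> ! i" by (simp add: clause_at_def)
    have un: "\<not> sat_literal (extend \<sigma>) l" if "l \<in> lits (clause_at j)" for l
      using i(2) that by (auto simp: cl sat_clause_iff)
    have "\<not> dropped j"
    proof
      assume "dropped j"
      then show False unfolding dropped_def
      proof
        assume "\<exists>l\<in>lits (clause_at j). A (var_of l) = Some (sgn_of l)"
        then obtain l where l: "l \<in> lits (clause_at j)" "A (var_of l) = Some (sgn_of l)" by blast
        then show False using un[OF l(1)] by (cases l) (auto simp: extend_def)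
      next
        assume "\<exists>x. Pos x \<in> lits (clause_at j) \<and> Neg x \<in> lits (clause_at j)"
        then obtain x where "Pos x \<in> lits (clause_at j)" "Neg x \<in> lits (clause_at j)" by blast
        from un[OF this(1)] un[OF this(2)] show False by simp
      qed
    qed
    then have "j \<in> J" using i by (auto simp: J_def)
    moreover have "\<not> \<sigma> x" if "x \<in> pos j" for x
      using un[of "Pos x"] that by (auto simp: pos_def extend_def)
    moreover have "\<sigma> x" if "x \<in> neg j" for x
      using un[of "Neg x"] that by (auto simp: neg_def extend_def)
    ultimately show "j \<in> unsat \<sigma>" by (auto simp: unsat_def)
  qed
  then have "card ((\<lambda>i. length \<phi> - i) ` ?V) \<le> card (unsat \<sigma>)"
    by (rule card_mono[rotated]) (use finite_J in \<open>auto simp: unsat_def\<close>)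
  moreover have "card ((\<lambda>i. length \<phi> - i) ` ?V) = card ?V"
    by (rule card_image) (auto simp: inj_on_def)
  moreover have "num_sat (extend \<sigma>) \<phi> + card ?V = length \<phi>"
  proof -
    have "num_sat (extend \<sigma>) \<phi> = card {i. i < length \<phi> \<and> sat_clause (extend \<sigma>) (\<phi> ! i)}"
      unfolding num_sat_def by (rule length_filter_conv_card)
    moreover have "{i. i < length \<phi> \<and> sat_clause (extend \<sigma>) (\<phi> ! i)} \<union> ?V = {..<length \<phi>}" by auto
    moreover have "{i. i < length \<phi> \<and> sat_clause (extend \<sigma>) (\<phi> ! i)} \<inter> ?V = {}" by auto
    ultimately show ?thesis
      using card_Un_disjoint[of "{i. i < length \<phi> \<and> sat_clause (extend \<sigma>) (\<phi> ! i)}" ?V] by simp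
  qed
  ultimately show ?thesis by linarith
qed

lemma unsat_empty:
  assumes "\<forall>c\<in>set \<phi>. sat_clause \<sigma> c" "\<And>x v. A x = Some v \<Longrightarrow> v = \<sigma> x"
  shows "unsat \<sigma> = {}"
proof -
  have False if j: "j \<in> unsat \<sigma>" for j
  proof -
    have "j \<in> J" using j by (simp add: unsat_def)
    then obtain l where l: "l \<in> lits (clause_at j)" "sat_literal \<sigma> l"
      using assms(1) clause_at_in sat_clause_iff by blast
    show False
    proof (cases "A (var_of l)")
      case None
      then show False using l j by (cases l) (auto simp: unsat_def pos_def neg_def)
    next
      case (Some v)
      then have "A (var_of l) = Some (sgn_of l)" using assms(2)[OF Some] l(2) by (cases l) auto
      then show False using l(1) \<open>j \<in> J\<close> by (auto simp: J_def dropped_def)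
    qed
  qed
  then show ?thesis by blast
qed

end

section \<open>Computing the instance\<close>

lemma dec_list_scmap [simp]:
  "dec_list (scmap f l) = concat (map (\<lambda>S. dec_list (f S)) (suffixes l))"
  by (simp add: scmap_def)

lemma map_head_suffixes: "map head (suffixes t) = dec_list t"
  by (induction t) auto

lemma map_dec_nat_suffixes: "map dec_nat (suffixes t) = rev [1..<Suc (dec_nat t)]"
  by (induction t) auto

lemma nth_suffixes: "i < dec_nat t \<Longrightarrow> head (suffixes t ! i) = dec_list t ! i \<and> dec_nat (suffixes t ! i) = dec_nat t - i"
proof (induction t arbitrary: i)
  case (Node a b)
  then show ?case by (cases i) auto
qed simp

section \<open>Truth values, unary comparison and list operations on trees\<close>

definition tt :: tree where "tt = Node Leaf Leaf"
definition tnot :: "tree \<Rightarrow> tree" where "tnot a = (if a = Leaf then tt else Leaf)"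
definition tand :: "tree \<Rightarrow> tree \<Rightarrow> tree" where "tand a b = (if a = Leaf then Leaf else b)"
definition tor :: "tree \<Rightarrow> tree \<Rightarrow> tree" where "tor a b = (if a = Leaf then b else tt)"
definition leq :: "tree \<Rightarrow> tree \<Rightarrow> tree" where "leq a b = tnot (drp b a)"
definition teq :: "tree \<Rightarrow> tree \<Rightarrow> tree" where "teq a b = tand (leq a b) (leq b a)"
definition cmap :: "(tree \<Rightarrow> tree) \<Rightarrow> tree \<Rightarrow> tree" where "cmap h l = scmap (\<lambda>S. h (head S)) l"
definition tex :: "(tree \<Rightarrow> tree) \<Rightarrow> tree \<Rightarrow> tree" where
  "tex h l = cmap (\<lambda>e. if h e = Leaf then Leaf else tt) l"
definition app :: "tree \<Rightarrow> tree \<Rightarrow> tree" where "app a b = cmap (\<lambda>e. e) (Node a (Node b Leaf))"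

lemma tt_simps [simp]: "tt \<noteq> Leaf" "dec_list tt = [Leaf]" "dec_nat tt = 1"
  by (simp_all add: tt_def)

lemma tnot_iff [simp]: "tnot a \<noteq> Leaf \<longleftrightarrow> a = Leaf" "tnot a = Leaf \<longleftrightarrow> a \<noteq> Leaf"
  by (simp_all add: tnot_def)

lemma tand_iff [simp]: "tand a b = Leaf \<longleftrightarrow> a = Leaf \<or> b = Leaf"
  by (simp add: tand_def)

lemma tor_iff [simp]: "tor a b = Leaf \<longleftrightarrow> a = Leaf \<and> b = Leaf"
  by (simp add: tor_def)

lemma leq_iff [simp]: "leq a b = Leaf \<longleftrightarrow> \<not> dec_nat a \<le> dec_nat b"
  by (auto simp: leq_def drp_def dec_nat_def)

lemma teq_iff [simp]: "teq a b = Leaf \<longleftrightarrow> dec_nat a \<noteq> dec_nat b"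
  by (auto simp: teq_def)

lemma dec_list_cmap [simp]: "dec_list (cmap h l) = concat (map (\<lambda>x. dec_list (h x)) (dec_list l))"
  unfolding cmap_def dec_list_scmap map_head_suffixes[of l, symmetric] map_map comp_def ..

lemma tex_iff [simp]: "tex h l = Leaf \<longleftrightarrow> (\<forall>x\<in>set (dec_list l). h x = Leaf)"
  by (simp add: tex_def flip: dec_list_eq_Nil)

lemma dec_list_app [simp]: "dec_list (app a b) = dec_list a @ dec_list b"
  by (simp add: app_def)

lemma dec_nat_app [simp]: "dec_nat (app a b) = dec_nat a + dec_nat b"
  by (simp add: dec_nat_def)

lemma FP_cmap:
  assumes "FP (\<lambda>p. h (head p) (tail p))" "FP L"
  shows "FP (\<lambda>x. cmap (h x) (L x))"
  unfolding cmap_def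
  by (intro FP_scmap FP_comp[OF assms(1), of "\<lambda>p. Node (head p) (head (tail p))", simplified]
    FP_Node FP_head FP_tail FP_id assms(2))

lemma FP_tex:
  assumes "FP (\<lambda>p. h (head p) (tail p))" "FP L"
  shows "FP (\<lambda>x. tex (h x) (L x))"
  unfolding tex_def by (intro FP_cmap FP_if FP_const assms)

lemma FP_tnot: "FP f \<Longrightarrow> FP (\<lambda>x. tnot (f x))"
  unfolding tnot_def by (intro FP_if FP_const)

lemma FP_tand: "FP f \<Longrightarrow> FP g \<Longrightarrow> FP (\<lambda>x. tand (f x) (g x))"
  unfolding tand_def by (intro FP_if FP_const)

lemma FP_tor: "FP f \<Longrightarrow> FP g \<Longrightarrow> FP (\<lambda>x. tor (f x) (g x))"
  unfolding tor_def by (intro FP_if FP_const)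

lemma FP_leq: "FP f \<Longrightarrow> FP g \<Longrightarrow> FP (\<lambda>x. leq (f x) (g x))"
  unfolding leq_def by (intro FP_tnot FP_drp)

lemma FP_teq: "FP f \<Longrightarrow> FP g \<Longrightarrow> FP (\<lambda>x. teq (f x) (g x))"
  unfolding teq_def by (intro FP_tand FP_leq)

lemma FP_app: "FP f \<Longrightarrow> FP g \<Longrightarrow> FP (\<lambda>x. app (f x) (g x))"
  unfolding app_def by (intro FP_cmap[where h = "\<lambda>_ e. e"] FP_Node FP_const FP_tail FP_id)

lemmas FP_intros = FP_scmap FP_cmap FP_tex FP_tnot FP_tand FP_tor FP_leq FP_teq FP_app FP_drp
  FP_if FP_Node FP_head FP_tail FP_id FP_const

text \<open>Horner's rule in unary. It produces the clock from the list of vertices.\<close>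

lemma FP_unary_poly:
  fixes p :: "nat poly"
  assumes "FP L"
  shows "\<exists>F. FP F \<and> (\<forall>v. dec_nat (F v) = poly p (dec_nat (L v)))"
proof (induction p)
  case 0
  show ?case by (rule exI[of _ "\<lambda>_. Leaf"]) (simp add: FP_const)
next
  case (pCons a p)
  then obtain F where F: "FP F" "\<And>v. dec_nat (F v) = poly p (dec_nat (L v))" by blast
  let ?G = "\<lambda>v. app (enc_nat a) (cmap (\<lambda>_. F v) (L v))"
  have "FP ?G" by (intro FP_intros FP_comp[OF F(1)] assms)
  moreover have "dec_nat (?G v) = poly (pCons a p) (dec_nat (L v))" for v
    using F(2)[of v] by (simp add: dec_nat_def length_concat comp_def sum_list_triv dec_enc_nat[unfolded dec_nat_def])
  ultimately show ?case by blast
qed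

text \<open>A guess is a list of pairs of a key and a truth value; the key is a leaf (for a guessed oracle
  answer) or \<open>Node Leaf x\<close> for a variable \<open>x\<close>.\<close>

definition tassigned :: "tree \<Rightarrow> tree \<Rightarrow> tree" where
  "tassigned p x = tex (\<lambda>e. tand (head e) (teq (tail (head e)) x)) p"

definition ttrue :: "tree \<Rightarrow> tree \<Rightarrow> tree" where
  "ttrue p x = tex (\<lambda>e. tand (head e) (tand (teq (tail (head e)) x) (tail e))) p"

definition assignment :: "tree \<Rightarrow> nat \<Rightarrow> bool option" where
  "assignment p x = (if \<exists>e\<in>set (dec_list p). head e \<noteq> Leaf \<and> dec_nat (tail (head e)) = x
     then Some (\<exists>e\<in>set (dec_list p). head e \<noteq> Leaf \<and> dec_nat (tail (head e)) = x \<and> tail e \<noteq> Leaf) else None)"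

definition tlit :: "tree \<Rightarrow> tree \<Rightarrow> tree" where
  "tlit p l = tand (tassigned p (tail l)) (if head l = Leaf then tnot (ttrue p (tail l)) else ttrue p (tail l))"

definition tdropped :: "tree \<Rightarrow> tree \<Rightarrow> tree" where
  "tdropped p c = tor (tex (\<lambda>l. tlit p l) c)
     (tex (\<lambda>l. tex (\<lambda>l'. tand (head l) (tand (tnot (head l')) (teq (tail l) (tail l')))) c) c)"

definition tpos :: "tree \<Rightarrow> tree \<Rightarrow> tree \<Rightarrow> tree" where
  "tpos p c x = tand (tnot (tassigned p x)) (tex (\<lambda>l. tand (head l) (teq (tail l) x)) c)"

definition tneg :: "tree \<Rightarrow> tree \<Rightarrow> tree \<Rightarrow> tree" where
  "tneg p c x = tand (tnot (tassigned p x)) (tex (\<lambda>l. tand (tnot (head l)) (teq (tail l) x)) c)"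

text \<open>A clause is passed around as the suffix that starts with it: the head is the clause, the
  length its number.\<close>

definition toccurs :: "tree \<Rightarrow> tree \<Rightarrow> tree \<Rightarrow> tree" where
  "toccurs \<phi> p x = scmap (\<lambda>S. if tand (tnot (tdropped p (head S))) (tor (tpos p (head S) x) (tneg p (head S) x)) = Leaf
     then Leaf else Node S Leaf) \<phi>"

definition tindex :: "tree \<Rightarrow> tree \<Rightarrow> tree \<Rightarrow> tree" where
  "tindex \<phi> p x = Node Leaf (if toccurs \<phi> p x = Leaf then Node tt Leaf else toccurs \<phi> p x)"

text \<open>A table in place of division: \<open>D\<close> and \<open>R\<close> are constants of the
  program, and a grid with attached clauses has at most D + 1 rows.\<close>

definition quotients :: "nat \<Rightarrow> nat \<Rightarrow> tree" where
  "quotients D R = list_tree (map (\<lambda>n. enc_nat (R div n)) [0..<D + 2])"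

definition tcopies :: "nat \<Rightarrow> nat \<Rightarrow> tree \<Rightarrow> tree \<Rightarrow> tree \<Rightarrow> tree" where
  "tcopies D R \<phi> p x = (if toccurs \<phi> p x = Leaf then tt else head (drp (tindex \<phi> p x) (quotients D R)))"

text \<open>The tails of the suffixes of four copies of the formula have lengths 4 m - 1, ..., 0 and
  serve as the unary names of the variables.\<close>

definition tvars :: "tree \<Rightarrow> tree" where
  "tvars \<phi> = scmap (\<lambda>S. Node (tail S) Leaf) (app \<phi> (app \<phi> (app \<phi> \<phi>)))"

definition tvertices :: "nat \<Rightarrow> nat \<Rightarrow> nat \<Rightarrow> tree \<Rightarrow> tree \<Rightarrow> tree" where
  "tvertices D R s \<phi> p = app
     (cmap (\<lambda>x. cmap (\<lambda>i. cmap (\<lambda>k. cmap (\<lambda>_. Node (Node (Node Leaf x) (Node i k)) Leaf)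
        (tcopies D R \<phi> p x)) (tindex \<phi> p x)) (tindex \<phi> p x)) (tvars \<phi>))
     (scmap (\<lambda>S. if tdropped p (head S) = Leaf then cmap (\<lambda>_. Node (Node Leaf S) Leaf) (enc_nat s) else Leaf) \<phi>)"

definition tline :: "tree \<Rightarrow> tree \<Rightarrow> tree \<Rightarrow> tree" where
  "tline p u v = tor (tand (tpos p (head (tail u)) (tail (head v))) (teq (head (tail v)) (tail u)))
     (tand (tneg p (head (tail u)) (tail (head v))) (teq (tail (tail v)) (tail u)))"

definition tsim :: "tree \<Rightarrow> tree \<Rightarrow> tree \<Rightarrow> tree" where
  "tsim p u v = (if head u = Leaf then (if head v = Leaf then teq (tail u) (tail v) else tline p u v)
     else (if head v = Leaf then tline p v u else
       tand (teq (tail (head u)) (tail (head v)))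
         (tor (teq (head (tail u)) (head (tail v))) (teq (tail (tail u)) (tail (tail v))))))"

text \<open>Every vertex is similar to itself, but the adjacency matrix has no loops; positions are
  told apart by the lengths of the suffixes.\<close>

definition tgraph :: "tree \<Rightarrow> tree \<Rightarrow> tree" where
  "tgraph p vs = scmap (\<lambda>U. Node (scmap (\<lambda>W.
     Node (if tand (tsim p (head U) (head W)) (tnot (teq U W)) = Leaf then Leaf else tt) Leaf) vs) Leaf) vs"

text \<open>If \<open>U\<close> is the suffix of \<open>vs\<close> at position u, then
  \<open>drp U vs\<close> has length u and can be used as an index into the output.\<close>

definition tlabel :: "tree \<Rightarrow> tree \<Rightarrow> tree \<Rightarrow> tree" where
  "tlabel vs out U = head (drp (drp U vs) out)"

definition tmistakes :: "tree \<Rightarrow> tree \<Rightarrow> tree \<Rightarrow> tree" where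
  "tmistakes p vs out = scmap (\<lambda>U. scmap (\<lambda>W.
     if tsim p (head U) (head W) = Leaf then teq (tlabel vs out U) (tlabel vs out W)
     else tnot (teq (tlabel vs out U) (tlabel vs out W))) vs) vs"

text \<open>Twice the number of mistakes is compared with \<open>base + c * m\<close>; the negative part of \<open>base\<close> is
  moved to the left.\<close>

definition tcheck :: "nat \<Rightarrow> nat \<Rightarrow> nat \<Rightarrow> tree \<Rightarrow> tree \<Rightarrow> tree \<Rightarrow> tree \<Rightarrow> tree" where
  "tcheck R s c \<phi> p vs out = tand (teq out vs)
     (leq (app (tmistakes p vs out) (scmap (\<lambda>S. if tdropped p (head S) = Leaf then enc_nat (2 * s * R) else Leaf) \<phi>))
       (app (cmap (\<lambda>x. if toccurs \<phi> p x = Leaf then enc_nat 4 else cmap (\<lambda>_. enc_nat (R * R + 2 * s * R)) (toccurs \<phi> p x)) (tvars \<phi>))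
         (cmap (\<lambda>_. enc_nat c) \<phi>)))"

definition theavy :: "nat \<Rightarrow> tree \<Rightarrow> tree" where
  "theavy D \<phi> = cmap (\<lambda>x. if drp (enc_nat D) (cmap (\<lambda>c. if tex (\<lambda>l. teq (tail l) x) c = Leaf then Leaf else tt) \<phi>) = Leaf
     then Leaf else Node (Node Leaf x) Leaf) (tvars \<phi>)"

text \<open>The suffix lengths j with k j \<le> m are counted, which gives m div k without a
  division.\<close>

definition tadvice :: "nat \<Rightarrow> nat \<Rightarrow> tree \<Rightarrow> tree" where
  "tadvice K k \<phi> = app (enc_nat K) (scmap (\<lambda>S. if leq (cmap (\<lambda>_. S) (enc_nat k)) \<phi> = Leaf then Leaf else tt) \<phi>)"

section \<open>The instance and the final check are computable in polynomial time\<close>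

lemma FP_tassigned:
  assumes "FP f" "FP g"
  shows "FP (\<lambda>v. tassigned (f v) (g v))"
  unfolding tassigned_def by (intro FP_intros assms[THEN FP_comp])

lemma FP_ttrue:
  assumes "FP f" "FP g"
  shows "FP (\<lambda>v. ttrue (f v) (g v))"
  unfolding ttrue_def by (intro FP_intros assms[THEN FP_comp])

lemma FP_tlit:
  assumes "FP f" "FP g"
  shows "FP (\<lambda>v. tlit (f v) (g v))"
  unfolding tlit_def by (intro FP_intros FP_tassigned FP_ttrue assms[THEN FP_comp])

lemma FP_tdropped:
  assumes "FP f" "FP g"
  shows "FP (\<lambda>v. tdropped (f v) (g v))"
  unfolding tdropped_def by (intro FP_intros FP_tlit assms[THEN FP_comp])

lemma FP_tpos:
  assumes "FP f" "FP g" "FP h"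
  shows "FP (\<lambda>v. tpos (f v) (g v) (h v))"
  unfolding tpos_def by (intro FP_intros FP_tassigned assms[THEN FP_comp])

lemma FP_tneg:
  assumes "FP f" "FP g" "FP h"
  shows "FP (\<lambda>v. tneg (f v) (g v) (h v))"
  unfolding tneg_def by (intro FP_intros FP_tassigned assms[THEN FP_comp])

lemma FP_toccurs:
  assumes "FP f" "FP g" "FP h"
  shows "FP (\<lambda>v. toccurs (f v) (g v) (h v))"
  unfolding toccurs_def by (intro FP_intros FP_tdropped FP_tpos FP_tneg assms[THEN FP_comp])

lemma FP_tindex:
  assumes "FP f" "FP g" "FP h"
  shows "FP (\<lambda>v. tindex (f v) (g v) (h v))"
  unfolding tindex_def by (intro FP_intros FP_toccurs assms[THEN FP_comp])

lemma FP_tcopies: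
  assumes "FP f" "FP g" "FP h"
  shows "FP (\<lambda>v. tcopies D R (f v) (g v) (h v))"
  unfolding tcopies_def by (intro FP_intros FP_toccurs FP_tindex assms[THEN FP_comp])

lemma FP_tvars:
  assumes "FP f"
  shows "FP (\<lambda>v. tvars (f v))"
  unfolding tvars_def by (intro FP_intros assms[THEN FP_comp])

lemma FP_tvertices:
  assumes "FP f" "FP g"
  shows "FP (\<lambda>v. tvertices D R s (f v) (g v))"
  unfolding tvertices_def
  by (intro FP_intros FP_tcopies FP_tindex FP_tvars FP_tdropped assms[THEN FP_comp])

lemma FP_tline:
  assumes "FP f" "FP g" "FP h"
  shows "FP (\<lambda>v. tline (f v) (g v) (h v))"
  unfolding tline_def by (intro FP_intros FP_tpos FP_tneg assms[THEN FP_comp])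

lemma FP_tsim:
  assumes "FP f" "FP g" "FP h"
  shows "FP (\<lambda>v. tsim (f v) (g v) (h v))"
  unfolding tsim_def by (intro FP_intros FP_tline assms[THEN FP_comp])

lemma FP_tgraph:
  assumes "FP f" "FP g"
  shows "FP (\<lambda>v. tgraph (f v) (g v))"
  unfolding tgraph_def by (intro FP_intros FP_tsim assms[THEN FP_comp])

lemma FP_tlabel:
  assumes "FP f" "FP g" "FP h"
  shows "FP (\<lambda>v. tlabel (f v) (g v) (h v))"
  unfolding tlabel_def by (intro FP_intros assms[THEN FP_comp])

lemma FP_tmistakes:
  assumes "FP f" "FP g" "FP h"
  shows "FP (\<lambda>v. tmistakes (f v) (g v) (h v))"
  unfolding tmistakes_def by (intro FP_intros FP_tsim FP_tlabel assms[THEN FP_comp])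

lemma FP_tcheck:
  assumes "FP f" "FP g" "FP h" "FP h'"
  shows "FP (\<lambda>v. tcheck R s c (f v) (g v) (h v) (h' v))"
  unfolding tcheck_def
  by (intro FP_intros FP_tmistakes FP_tdropped FP_toccurs FP_tvars assms[THEN FP_comp])

lemma FP_theavy:
  assumes "FP f"
  shows "FP (\<lambda>v. theavy D (f v))"
  unfolding theavy_def by (intro FP_intros FP_tvars assms[THEN FP_comp])

lemma FP_tadvice:
  assumes "FP f"
  shows "FP (\<lambda>v. tadvice K k (f v))"
  unfolding tadvice_def by (intro FP_intros assms[THEN FP_comp])

section \<open>The program computes the instance of the abstract reduction\<close>

lemma in_suffixes:
  assumes "S \<in> set (suffixes t)"
  shows "1 \<le> dec_nat S" "dec_nat S \<le> dec_nat t" "head S = dec_list t ! (dec_nat t - dec_nat S)"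
proof -
  obtain i where i: "i < dec_nat t" "S = suffixes t ! i"
    using assms by (auto simp: in_set_conv_nth)
  then show "1 \<le> dec_nat S" "dec_nat S \<le> dec_nat t" "head S = dec_list t ! (dec_nat t - dec_nat S)"
    using nth_suffixes[OF i(1)] by auto
qed

lemma map_tail_suffixes: "map (\<lambda>S. dec_nat (tail S)) (suffixes t) = rev [0..<dec_nat t]"
  by (induction t) auto

lemma set_enc_clause: "set (dec_list (enc_clause c)) = enc_literal ` lits c"
  by (cases c) auto

lemma enc_literal_simps [simp]:
  "head (enc_literal l) = Leaf \<longleftrightarrow> \<not> sgn_of l" "tail (enc_literal l) = enc_nat (var_of l)"
  by (cases l; simp add: enc_bool_def)+

lemma dec_list_enc_formula: "dec_list (enc_formula \<phi>) = map enc_clause \<phi>"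
  by (simp add: enc_formula_def)

lemma dec_nat_enc_formula [simp]: "dec_nat (enc_formula \<phi>) = length \<phi>"
  by (simp add: dec_nat_def dec_list_enc_formula)

lemma suffix_formula:
  assumes "S \<in> set (suffixes (enc_formula \<phi>))"
  shows "1 \<le> dec_nat S" "dec_nat S \<le> length \<phi>" "head S = enc_clause (\<phi> ! (length \<phi> - dec_nat S))"
  using in_suffixes[OF assms] by (auto simp: dec_list_enc_formula)

lemma tassigned_iff: "tassigned p x = Leaf \<longleftrightarrow> assignment p (dec_nat x) = None"
  by (auto simp: tassigned_def assignment_def)

lemma ttrue_iff: "ttrue p x = Leaf \<longleftrightarrow> assignment p (dec_nat x) \<noteq> Some True"
  by (auto simp: ttrue_def assignment_def)

lemma tlit_iff: "tlit p (enc_literal l) = Leaf \<longleftrightarrow> assignment p (var_of l) \<noteq> Some (sgn_of l)"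
  by (cases "assignment p (var_of l)") (auto simp: tlit_def tassigned_iff ttrue_iff)

lemma ex_lit:
  "(\<exists>l\<in>L. sgn_of l \<and> var_of l = x) \<longleftrightarrow> Pos x \<in> L"
  "(\<exists>l\<in>L. \<not> sgn_of l \<and> var_of l = x) \<longleftrightarrow> Neg x \<in> L"
proof -
  have pos: "sgn_of l \<and> var_of l = x \<longleftrightarrow> l = Pos x" for l by (cases l) auto
  have neg: "\<not> sgn_of l \<and> var_of l = x \<longleftrightarrow> l = Neg x" for l by (cases l) auto
  show "(\<exists>l\<in>L. sgn_of l \<and> var_of l = x) \<longleftrightarrow> Pos x \<in> L"
    "(\<exists>l\<in>L. \<not> sgn_of l \<and> var_of l = x) \<longleftrightarrow> Neg x \<in> L"
    unfolding pos neg by simp_all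
qed

lemma tdropped_iff: "tdropped p (enc_clause c) = Leaf \<longleftrightarrow>
  \<not> ((\<exists>l\<in>lits c. assignment p (var_of l) = Some (sgn_of l)) \<or> (\<exists>x. Pos x \<in> lits c \<and> Neg x \<in> lits c))"
proof -
  have "(\<exists>l\<in>lits c. \<exists>l'\<in>lits c. sgn_of l \<and> \<not> sgn_of l' \<and> var_of l = var_of l') \<longleftrightarrow>
      (\<exists>x. Pos x \<in> lits c \<and> Neg x \<in> lits c)"
  proof
    assume "\<exists>l\<in>lits c. \<exists>l'\<in>lits c. sgn_of l \<and> \<not> sgn_of l' \<and> var_of l = var_of l'"
    then obtain l l' where l: "l \<in> lits c" "l' \<in> lits c" "sgn_of l" "\<not> sgn_of l'" "var_of l = var_of l'" by blast
    have "l = Pos (var_of l)" using l(3) by (cases l) auto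
    moreover have "l' = Neg (var_of l)" using l(4,5) by (cases l') auto
    ultimately have "Pos (var_of l) \<in> lits c \<and> Neg (var_of l) \<in> lits c" using l(1,2) by simp
    then show "\<exists>x. Pos x \<in> lits c \<and> Neg x \<in> lits c" ..
  next
    assume "\<exists>x. Pos x \<in> lits c \<and> Neg x \<in> lits c"
    then obtain x where "Pos x \<in> lits c" "Neg x \<in> lits c" by blast
    then show "\<exists>l\<in>lits c. \<exists>l'\<in>lits c. sgn_of l \<and> \<not> sgn_of l' \<and> var_of l = var_of l'"
      by (intro bexI[of _ "Pos x"] bexI[of _ "Neg x"]) auto
  qed
  then show ?thesis by (auto simp: tdropped_def set_enc_clause tlit_iff)
qed

lemma tpos_iff: "tpos p (enc_clause c) x = Leaf \<longleftrightarrow>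
  \<not> (assignment p (dec_nat x) = None \<and> Pos (dec_nat x) \<in> lits c)"
  using ex_lit(1)[of "lits c" "dec_nat x"] by (simp add: tpos_def tassigned_iff set_enc_clause) blast

lemma tneg_iff: "tneg p (enc_clause c) x = Leaf \<longleftrightarrow>
  \<not> (assignment p (dec_nat x) = None \<and> Neg (dec_nat x) \<in> lits c)"
  using ex_lit(2)[of "lits c" "dec_nat x"] by (simp add: tneg_def tassigned_iff set_enc_clause) blast

lemma concat_filter: "concat (map (\<lambda>x. if Q x then [] else [x]) xs) = filter (\<lambda>x. \<not> Q x) xs"
  by (induction xs) auto

definition vertex_of :: "tree \<Rightarrow> vert" where
  "vertex_of u = (if head u = Leaf then Cl (dec_nat (tail u))
     else Grid (dec_nat (tail (head u))) (dec_nat (head (tail u))) (dec_nat (tail (tail u))))"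

lemma vertex_of_simps [simp]:
  "vertex_of (Node Leaf S) = Cl (dec_nat S)"
  "vertex_of (Node (Node Leaf x) (Node i k)) = Grid (dec_nat x) (dec_nat i) (dec_nat k)"
  by (simp_all add: vertex_of_def)

lemma tvars: "map dec_nat (dec_list (tvars (enc_formula \<phi>))) = rev [0..<4 * length \<phi>]"
proof -
  have "map dec_nat (dec_list (tvars (enc_formula \<phi>))) = map (\<lambda>S. dec_nat (tail S)) (suffixes (app (enc_formula \<phi>) (app (enc_formula \<phi>) (app (enc_formula \<phi>) (enc_formula \<phi>)))))"
    by (simp add: tvars_def comp_def)
  also have "\<dots> = rev [0..<4 * length \<phi>]"
  proof -
    have "dec_nat (app (enc_formula \<phi>) (app (enc_formula \<phi>) (app (enc_formula \<phi>) (enc_formula \<phi>)))) = 4 * length \<phi>" by simp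
    then show ?thesis unfolding map_tail_suffixes by (simp only:)
  qed
  finally show ?thesis .
qed

text \<open>The bound on the occurrences ensures that the size of each grid with attached clauses is
  found in the table \<open>quotients\<close>.\<close>

locale program_reduction = valid_reduction \<phi> "assignment p" R s
  for \<phi> :: formula and p :: tree and R s :: nat +
  fixes D :: nat
  assumes card_occurs: "card (occurs x) \<le> D"
begin

abbreviation "\<Phi> \<equiv> enc_formula \<phi>"

lemma suffix_clause: "S \<in> set (suffixes \<Phi>) \<Longrightarrow> head S = enc_clause (clause_at (dec_nat S))"
  using suffix_formula(3) by (simp add: clause_at_def)

lemma tdropped_suffix: "S \<in> set (suffixes \<Phi>) \<Longrightarrow> tdropped p (head S) = Leaf \<longleftrightarrow> dec_nat S \<in> J"
  using suffix_formula(1,2)[of S \<phi>] by (simp add: suffix_clause tdropped_iff J_def dropped_def)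

lemma tpos_suffix: "S \<in> set (suffixes \<Phi>) \<Longrightarrow> tpos p (head S) x = Leaf \<longleftrightarrow> dec_nat x \<notin> pos (dec_nat S)"
  by (auto simp: suffix_clause tpos_iff pos_def)

lemma tneg_suffix: "S \<in> set (suffixes \<Phi>) \<Longrightarrow> tneg p (head S) x = Leaf \<longleftrightarrow> dec_nat x \<notin> neg (dec_nat S)"
  by (auto simp: suffix_clause tneg_iff neg_def)

lemma map_dec_nat_filter:
  "map dec_nat (filter (\<lambda>S. dec_nat S \<in> M) (suffixes t)) = filter (\<lambda>j. j \<in> M) (rev [1..<Suc (dec_nat t)])"
  unfolding map_dec_nat_suffixes[symmetric] filter_map comp_def ..

lemma toccurs: "map dec_nat (dec_list (toccurs \<Phi> p x)) = filter (\<lambda>j. j \<in> occurs (dec_nat x)) (rev [1..<Suc (length \<phi>)])"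
proof -
  have "dec_list (toccurs \<Phi> p x) = concat (map (\<lambda>S. if dec_nat S \<notin> occurs (dec_nat x) then [] else [S]) (suffixes \<Phi>))"
    unfolding toccurs_def dec_list_scmap
    by (intro arg_cong[of _ _ concat] map_cong refl)
      (auto simp: tdropped_suffix tpos_suffix tneg_suffix occurs_def)
  also have "\<dots> = filter (\<lambda>S. dec_nat S \<in> occurs (dec_nat x)) (suffixes \<Phi>)"
    unfolding concat_filter by simp
  finally show ?thesis using map_dec_nat_filter[of "occurs (dec_nat x)" \<Phi>] by simp
qed

lemma toccurs_Leaf: "toccurs \<Phi> p x = Leaf \<longleftrightarrow> occurs (dec_nat x) = {}"
proof -
  have "toccurs \<Phi> p x = Leaf \<longleftrightarrow> map dec_nat (dec_list (toccurs \<Phi> p x)) = []" by simp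
  also have "\<dots> \<longleftrightarrow> occurs (dec_nat x) = {}"
    unfolding toccurs by (auto simp: filter_empty_conv occurs_def J_def)
  finally show ?thesis .
qed

lemma length_toccurs: "length (dec_list (toccurs \<Phi> p x)) = card (occurs (dec_nat x))"
proof -
  have "length (dec_list (toccurs \<Phi> p x)) = length (map dec_nat (dec_list (toccurs \<Phi> p x)))" by simp
  also have "\<dots> = card (set (map dec_nat (dec_list (toccurs \<Phi> p x))))"
    unfolding toccurs by (rule distinct_card[symmetric]) simp
  also have "set (map dec_nat (dec_list (toccurs \<Phi> p x))) = occurs (dec_nat x)"
    unfolding toccurs by (auto simp: occurs_def J_def)
  finally show ?thesis .
qed

lemma tindex: "map dec_nat (dec_list (tindex \<Phi> p x)) = index_list (dec_nat x)"
  by (simp add: tindex_def index_list_def toccurs_Leaf toccurs del: upt_Suc)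

lemma tcopies: "dec_nat (tcopies D R \<Phi> p x) = b (dec_nat x)"
proof (cases "occurs (dec_nat x) = {}")
  case False
  let ?n = "card (I (dec_nat x))"
  have "length (dec_list (tindex \<Phi> p x)) = length (index_list (dec_nat x))"
    unfolding tindex[symmetric] by simp
  also have "\<dots> = ?n" using distinct_card[OF index_list(1)] by (simp add: index_list(2))
  finally have n: "dec_nat (tindex \<Phi> p x) = ?n" by (simp add: dec_nat_def)
  have le: "?n < D + 2" using card_I[of "dec_nat x"] card_occurs[of "dec_nat x"] False by simp
  have "drp (tindex \<Phi> p x) (quotients D R) = list_tree (drop ?n (map (\<lambda>n. enc_nat (R div n)) [0..<D + 2]))"
    by (simp add: drp_def n quotients_def del: upt_Suc)
  also have "head \<dots> = map (\<lambda>n. enc_nat (R div n)) [0..<D + 2] ! ?n"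
    using le by (subst Cons_nth_drop_Suc[symmetric]) (simp_all del: upt_Suc)
  also have "\<dots> = enc_nat (R div ?n)" using le by (simp del: upt_Suc)
  finally show ?thesis using False by (simp add: tcopies_def toccurs_Leaf b_def)
qed (simp add: tcopies_def toccurs_Leaf b_def)

abbreviation "Vs \<equiv> tvertices D R s \<Phi> p"

lemma concat_map_dec: "concat (map (\<lambda>x. F (dec_nat x)) xs) = concat (map F (map dec_nat xs))"
  by (simp add: comp_def)

lemma tvertices: "map vertex_of (dec_list Vs) = vertices"
proof -
  have grid: "map vertex_of (concat (map (\<lambda>x. concat (map (\<lambda>i. concat (map (\<lambda>k. concat (map (\<lambda>_.
      [Node (Node Leaf x) (Node i k)]) (dec_list (tcopies D R \<Phi> p x)))) (dec_list (tindex \<Phi> p x)))) (dec_list (tindex \<Phi> p x)))) (dec_list (tvars \<Phi>))))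
    = concat (map (\<lambda>x. concat (map (\<lambda>i. concat (map (\<lambda>k. replicate (b x) (Grid x i k))
       (index_list x))) (index_list x))) (rev [0..<4 * length \<phi>]))"
  proof -
    have 1: "concat (map (\<lambda>_. map vertex_of [Node (Node Leaf x) (Node i k)]) (dec_list (tcopies D R \<Phi> p x)))
        = replicate (b (dec_nat x)) (Grid (dec_nat x) (dec_nat i) (dec_nat k))" for x i k
      using tcopies[of x] by (simp add: map_replicate_const comp_def dec_nat_def[of "tcopies D R \<Phi> p x"])
    show ?thesis
      unfolding map_concat map_map comp_def 1
      unfolding concat_map_dec[where F = "\<lambda>k. replicate (b (dec_nat x)) (Grid (dec_nat x) (dec_nat i) k)" for x i] tindex
      unfolding concat_map_dec[where F = "\<lambda>i. concat (map (\<lambda>k. replicate (b (dec_nat x)) (Grid (dec_nat x) i k)) (index_list (dec_nat x)))" for x] tindex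
      unfolding concat_map_dec[where F = "\<lambda>x. concat (map (\<lambda>i. concat (map (\<lambda>k. replicate (b x) (Grid x i k)) (index_list x))) (index_list x))"] tvars
      ..
  qed
  have cl: "map vertex_of (concat (map (\<lambda>S. dec_list (if tdropped p (head S) = Leaf then cmap (\<lambda>_. Node (Node Leaf S) Leaf) (enc_nat s) else Leaf)) (suffixes \<Phi>)))
    = concat (map (\<lambda>j. replicate s (Cl j)) (filter (\<lambda>j. j \<in> J) (rev [1..<Suc (length \<phi>)])))"
  proof -
    have "map vertex_of (concat (map (\<lambda>S. dec_list (if tdropped p (head S) = Leaf then cmap (\<lambda>_. Node (Node Leaf S) Leaf) (enc_nat s) else Leaf)) (suffixes \<Phi>)))
      = concat (map (\<lambda>S. if dec_nat S \<in> J then replicate s (Cl (dec_nat S)) else []) (suffixes \<Phi>))"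
      unfolding map_concat map_map comp_def
      by (intro arg_cong[of _ _ concat] map_cong refl)
        (auto simp: tdropped_suffix map_replicate_const comp_def dec_enc_nat[unfolded dec_nat_def])
    also have "\<dots> = concat (map (\<lambda>j. if j \<in> J then replicate s (Cl j) else []) (map dec_nat (suffixes \<Phi>)))"
      by (simp add: comp_def)
    also have "\<dots> = concat (map (\<lambda>j. replicate s (Cl j)) (filter (\<lambda>j. j \<in> J) (map dec_nat (suffixes \<Phi>))))"
    proof -
      have "concat (map (\<lambda>j. if j \<in> J then f j else []) xs) = concat (map f (filter (\<lambda>j. j \<in> J) xs))"
        for f :: "nat \<Rightarrow> vert list" and xs by (induction xs) auto
      then show ?thesis .
    qed
    finally show ?thesis by (simp add: map_dec_nat_suffixes del: upt_Suc)
  qed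
  show ?thesis unfolding tvertices_def vertices_def dec_list_app map_append
    using grid cl by (simp del: upt_Suc)
qed

lemma length_Vs: "dec_nat Vs = N" "length (dec_list Vs) = N"
  unfolding tvertices[symmetric] by (simp_all add: dec_nat_def)

text \<open>\<open>tsim\<close> reads a clause vertex as a suffix of the formula, so its correctness
  is claimed only for trees of the shape that the program lists.\<close>

definition valid :: "tree \<Rightarrow> bool" where
  "valid u \<longleftrightarrow> (\<exists>x i k. u = Node (Node Leaf x) (Node i k)) \<or> (\<exists>S\<in>set (suffixes \<Phi>). u = Node Leaf S)"

lemma valid_Vs: "u \<in> set (dec_list Vs) \<Longrightarrow> valid u"
  by (auto simp: tvertices_def valid_def split: if_splits)

lemma tsim: "valid u \<Longrightarrow> valid v \<Longrightarrow> tsim p u v = Leaf \<longleftrightarrow> \<not> sim (vertex_of u) (vertex_of v)"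
  unfolding valid_def
  by (elim disjE exE bexE) (auto simp: tsim_def tline_def tpos_suffix tneg_suffix)

lemma tsim_nth:
  assumes "U < N" "W < N"
  shows "tsim p (dec_list Vs ! U) (dec_list Vs ! W) = Leaf \<longleftrightarrow> \<not> sim (vertices ! U) (vertices ! W)"
  unfolding tvertices[symmetric] using assms
  by (simp add: tsim valid_Vs length_Vs)

lemma suffixes_conv: "suffixes t = map (\<lambda>i. suffixes t ! i) [0..<dec_nat t]"
  by (rule nth_equalityI) auto

lemma suffix_Vs: "u < N \<Longrightarrow> head (suffixes Vs ! u) = dec_list Vs ! u" "u < N \<Longrightarrow> dec_nat (suffixes Vs ! u) = N - u"
  using nth_suffixes[of u Vs] length_Vs by auto

lemma tgraph: "tgraph p Vs = enc_graph N E"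
proof -
  have edge: "{u, v} \<in> E \<longleftrightarrow> u \<noteq> v \<and> sim (vertices ! u) (vertices ! v)" if "u < N" "v < N" for u v
    using that sim_commute by (auto simp: similarity_edges_def doubleton_eq_iff)
  have "tgraph p Vs = list_tree (map (\<lambda>u. list_tree (map (\<lambda>v.
     if tand (tsim p (head (suffixes Vs ! u)) (head (suffixes Vs ! v))) (tnot (teq (suffixes Vs ! u) (suffixes Vs ! v))) = Leaf
     then Leaf else tt) [0..<N])) [0..<N])"
  proof -
    have 1: "scmap (\<lambda>W. Node (f W) Leaf) Vs = list_tree (map (\<lambda>v. f (suffixes Vs ! v)) [0..<N])" for f
      unfolding scmap_def by (subst suffixes_conv) (simp add: length_Vs comp_def)
    show ?thesis unfolding tgraph_def 1 ..
  qed
  also have "\<dots> = list_tree (map (\<lambda>u. list_tree (map (\<lambda>v. enc_bool ({u, v} \<in> E)) [0..<N])) [0..<N])"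
    by (intro arg_cong[of _ _ list_tree] map_cong refl)
      (auto simp: suffix_Vs tsim_nth edge enc_bool_def tt_def)
  finally show ?thesis by (simp add: enc_graph_def enc_list_conv comp_def)
qed

lemma tlabel:
  assumes "u < N" "dec_nat out = N"
  shows "dec_nat (tlabel Vs out (suffixes Vs ! u)) = map dec_nat (dec_list out) ! u"
proof -
  have "dec_nat (drp (suffixes Vs ! u) Vs) = u"
    using assms suffix_Vs[OF assms(1)] length_Vs by (simp add: drp_def)
  then have "drp (drp (suffixes Vs ! u) Vs) out = list_tree (drop u (dec_list out))" by (simp add: drp_def)
  moreover have "drop u (dec_list out) = dec_list out ! u # drop (Suc u) (dec_list out)"
    using assms by (intro Cons_nth_drop_Suc[symmetric]) (simp add: dec_nat_def)
  ultimately show ?thesis using assms by (simp add: tlabel_def dec_nat_def)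
qed

lemma tmistakes:
  assumes "dec_nat out = N"
  shows "dec_nat (tmistakes p Vs out) = disagreements sim vertices (\<lambda>u. map dec_nat (dec_list out) ! u)"
proof -
  \<comment> \<open>The truth values produced here are lists of length 0 or 1, so concatenating them
    counts the pairs.\<close>
  have len: "length (dec_list (if c then teq a b else tnot (teq a b))) = of_bool (c = (dec_nat a = dec_nat b))" for c a b
    by (auto simp: teq_def tnot_def tand_def leq_def drp_def dec_nat_def)
  have 1: "dec_nat (scmap f Vs) = (\<Sum>u<N. dec_nat (f (suffixes Vs ! u)))" for f
    unfolding dec_nat_def dec_list_scmap
    by (subst suffixes_conv) (simp add: length_Vs length_concat comp_def sum_list_sum_nth atLeast0LessThan)
  show ?thesis unfolding tmistakes_def 1 disagreements_def
    by (intro sum.cong refl) (auto simp: dec_nat_def[of "if _ then _ else _"] len tlabel[OF _ assms] suffix_Vs tsim_nth)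
qed

lemma sum_list_tvars: "(\<Sum>x\<leftarrow>dec_list (tvars \<Phi>). f (dec_nat x)) = (\<Sum>x\<in>X. f x)" for f :: "nat \<Rightarrow> nat"
proof -
  have "(\<Sum>x\<leftarrow>dec_list (tvars \<Phi>). f (dec_nat x)) = sum_list (map f (map dec_nat (dec_list (tvars \<Phi>))))"
    by (simp add: comp_def)
  also have "\<dots> = (\<Sum>x\<in>X. f x)"
    unfolding tvars using sum_list_distinct_conv_sum_set[of "rev [0..<4 * length \<phi>]" f]
    by (simp add: X_def atLeast0LessThan)
  finally show ?thesis .
qed

lemma tcheck:
  "tcheck R s c \<Phi> p Vs out \<noteq> Leaf \<longleftrightarrow> dec_nat out = N \<and>
     real (disagreements sim vertices (\<lambda>u. map dec_nat (dec_list out) ! u)) \<le> base + real c * length \<phi>"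
proof (cases "dec_nat out = N")
  case False
  then show ?thesis by (simp add: tcheck_def length_Vs)
next
  case True
  let ?M = "disagreements sim vertices (\<lambda>u. map dec_nat (dec_list out) ! u)"
  have "dec_nat (scmap (\<lambda>S. if tdropped p (head S) = Leaf then enc_nat (2 * s * R) else Leaf) \<Phi>) =
      (\<Sum>S\<leftarrow>suffixes \<Phi>. if dec_nat S \<in> J then 2 * s * R else 0)"
    unfolding dec_nat_def[of "scmap _ _"] dec_list_scmap length_concat map_map comp_def
    by (intro arg_cong[of _ _ sum_list] map_cong refl) (auto simp: tdropped_suffix dec_enc_nat[unfolded dec_nat_def])
  also have "\<dots> = (\<Sum>j\<leftarrow>map dec_nat (suffixes \<Phi>). if j \<in> J then 2 * s * R else 0)" by (simp add: comp_def)
  also have "\<dots> = (\<Sum>j\<in>{1..<Suc (length \<phi>)}. if j \<in> J then 2 * s * R else 0)"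
    unfolding map_dec_nat_suffixes by (subst sum_list_distinct_conv_sum_set) (simp_all del: upt_Suc)
  also have "\<dots> = (\<Sum>j\<in>J. 2 * s * R)"
    by (rule sum.mono_neutral_cong_right) (auto simp: J_def)
  finally have lhs: "dec_nat (scmap (\<lambda>S. if tdropped p (head S) = Leaf then enc_nat (2 * s * R) else Leaf) \<Phi>) = card J * (2 * s * R)"
    by simp
  have "dec_nat (cmap (\<lambda>x. if toccurs \<Phi> p x = Leaf then enc_nat 4 else cmap (\<lambda>_. enc_nat (R * R + 2 * s * R)) (toccurs \<Phi> p x)) (tvars \<Phi>))
      = (\<Sum>x\<leftarrow>dec_list (tvars \<Phi>). if occurs (dec_nat x) = {} then 4 else card (occurs (dec_nat x)) * (R * R + 2 * s * R))"
    unfolding dec_nat_def[of "cmap _ _"] dec_list_cmap length_concat map_map comp_def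
    by (intro arg_cong[of _ _ sum_list] map_cong refl)
      (auto simp: toccurs_Leaf length_concat comp_def sum_list_triv length_toccurs dec_enc_nat[unfolded dec_nat_def])
  also have "\<dots> = (\<Sum>x\<in>X. if occurs x = {} then 4 else card (occurs x) * (R * R + 2 * s * R))"
    by (rule sum_list_tvars)
  finally have rhs1: "dec_nat (cmap (\<lambda>x. if toccurs \<Phi> p x = Leaf then enc_nat 4 else cmap (\<lambda>_. enc_nat (R * R + 2 * s * R)) (toccurs \<Phi> p x)) (tvars \<Phi>))
     = (\<Sum>x\<in>X. if occurs x = {} then 4 else card (occurs x) * (R * R + 2 * s * R))" .
  have rhs2: "dec_nat (cmap (\<lambda>_. enc_nat c) \<Phi>) = c * length \<phi>"
    unfolding dec_nat_def[of "cmap _ _"] dec_list_cmap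
    by (simp add: length_concat comp_def sum_list_triv dec_enc_nat[unfolded dec_nat_def] dec_list_enc_formula)
  have "tcheck R s c \<Phi> p Vs out \<noteq> Leaf \<longleftrightarrow> ?M + card J * (2 * s * R) \<le>
     (\<Sum>x\<in>X. if occurs x = {} then 4 else card (occurs x) * (R * R + 2 * s * R)) + c * length \<phi>"
    using True by (simp add: tcheck_def length_Vs tmistakes lhs rhs1 rhs2)
  also have "\<dots> \<longleftrightarrow> real (?M + card J * (2 * s * R)) \<le>
     real ((\<Sum>x\<in>X. if occurs x = {} then 4 else card (occurs x) * (R * R + 2 * s * R)) + c * length \<phi>)"
    by (rule of_nat_le_iff[symmetric])
  also have "real ((\<Sum>x\<in>X. if occurs x = {} then 4 else card (occurs x) * (R * R + 2 * s * R)) + c * length \<phi>)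
    = base + real (card J * (2 * s * R)) + real c * length \<phi>"
  proof -
    have "real (\<Sum>x\<in>X. if occurs x = {} then 4 else card (occurs x) * (R * R + 2 * s * R)) =
      (\<Sum>x\<in>X. (if occurs x = {} then 4 else (real R)^2 * card (occurs x)) + 2 * real s * real R * real (card (occurs x)))"
      unfolding of_nat_sum by (intro sum.cong refl) (auto simp: algebra_simps power2_eq_square)
    then show ?thesis unfolding base_eq
      by (simp add: sum.distrib algebra_simps flip: sum_distrib_left)
  qed
  finally show ?thesis using True by simp
qed

end

section \<open>Guessing\<close>

text \<open>The leaves of a binary search tree: keys are taken from the first list and pushed with
  either value, so a finished guess lists them in reverse order.\<close>

primrec guesses :: "tree \<Rightarrow> tree \<Rightarrow> tree set" where
  "guesses Leaf p = {p}"
| "guesses (Node a r) p = guesses r (Node (Node a Leaf) p) \<union> guesses r (Node (Node a tt) p)"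

lemma guesses_keys: "p' \<in> guesses r p \<Longrightarrow> map head (dec_list p') = rev (dec_list r) @ map head (dec_list p)"
  by (induction r arbitrary: p) auto

lemma guesses_complete:
  "length xs = length bs \<Longrightarrow>
   list_tree (rev (map2 (\<lambda>a c. Node a (enc_bool c)) xs bs) @ dec_list p) \<in> guesses (list_tree xs) p"
proof (induction xs bs arbitrary: p rule: list_induct2)
  case Nil
  then show ?case by simp
next
  case (Cons a xs c bs)
  from Cons.IH[of "Node (Node a (enc_bool c)) p"] show ?case by (cases c) (auto simp: enc_bool_def tt_def)
qed

lemma guesses_height: "p' \<in> guesses r p \<Longrightarrow> height p' \<le> height p + 2 * dec_nat r + height r + 2"
proof (induction r arbitrary: p)
  case (Node a r)
  then obtain c where c: "height c \<le> 1" "p' \<in> guesses r (Node (Node a c) p)"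
    by (force simp: tt_def)
  \<comment> \<open>The bound \<open>H\<close> stays fixed along the induction; it covers in advance
    the keys that move from the list into the guess.\<close>
  have *: "height p' \<le> H" if "p' \<in> guesses r p" "height p + dec_nat r \<le> H" "\<And>a. a \<in> set (dec_list r) \<Longrightarrow> height a + 2 + dec_nat r \<le> H" for H r p
    using that
  proof (induction r arbitrary: p)
    case (Node a r)
    then obtain c where c: "height c \<le> 1" "p' \<in> guesses r (Node (Node a c) p)"
      by (force simp: tt_def)
    show ?case
    proof (rule Node.IH(2)[OF c(2)])
      show "height (Node (Node a c) p) + dec_nat r \<le> H" using c(1) Node.prems(2) Node.prems(3)[of a] by auto
      show "height a' + 2 + dec_nat r \<le> H" if "a' \<in> set (dec_list r)" for a'
        using Node.prems(3)[of a'] that by auto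
    qed
  qed simp
  show ?case
  proof (rule *[OF Node.prems])
    fix a' assume "a' \<in> set (dec_list (Node a r))"
    from height_dec_list[OF this] show "height a' + 2 + dec_nat (Node a r) \<le> height p + 2 * dec_nat (Node a r) + height (Node a r) + 2"
      by simp
  qed simp
qed simp

text \<open>Depth-first search with an explicit stack, whose entries hold the remaining keys and the
  partial guess. For r keys the tree has 2^(r + 1) - 1 nodes, each of polynomial cost.\<close>

lemma FP_guess:
  assumes rf: "FP rf" and lf: "FP (\<lambda>v. lf (head v) (tail v))"
  shows "\<exists>Q g. \<forall>\<Phi>. \<exists>s. run Q (init \<Phi>) (2 ^ dec_nat (rf \<Phi>) * poly g (height \<Phi>)) s \<and>
    (s 0 \<noteq> Leaf \<longleftrightarrow> (\<exists>p\<in>guesses (rf \<Phi>) Leaf. lf \<Phi> p \<noteq> Leaf))"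
proof -
  obtain Qr pr hr where Qr: "\<And>v. run Qr (init v) (poly pr (height v)) (init (rf v))"
    and hr: "\<And>v. height (rf v) \<le> poly hr (height v)"
    using FP_D[OF rf] by auto
  obtain Ql pl hl where Ql: "\<And>v. run Ql (init v) (poly pl (height v)) (init (lf (head v) (tail v)))"
    using FP_D[OF lf] by auto
  let ?split = "Assign 1 (Pair (Pair (Tl (Hd (Hd (Var 1)))) (Pair (Pair (Hd (Hd (Hd (Var 1)))) Lf) (Tl (Hd (Var 1)))))
    (Pair (Pair (Tl (Hd (Hd (Var 1)))) (Pair (Pair (Hd (Hd (Hd (Var 1)))) (Pair Lf Lf)) (Tl (Hd (Var 1)))))
      (Tl (Var 1))))"
  let ?leaf = "Seq (Assign 3 (Pair (Var 0) (Tl (Hd (Var 1))))) (Seq (shift 3 Ql)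
    (Seq (Cond (Var 3) (Assign 2 (Pair Lf Lf)) Skip) (Seq (Assign 3 Lf) (Assign 1 (Tl (Var 1))))))"
  let ?body = "Cond (Hd (Hd (Var 1))) ?split ?leaf"
  let ?loop = "While (Var 1) ?body"
  let ?Q = "Seq (Assign 1 (Var 0)) (Seq (shift 1 Qr) (Seq (Assign 1 (Pair (Pair (Var 1) Lf) Lf))
    (Seq ?loop (Assign 0 (Var 2)))))"
  \<comment> \<open>Stated relative to the rest of the stack, whose treatment takes time
    \<open>T\<close> and ends in \<open>s\<close>, so that the two branches of a node can be
    chained.\<close>
  have visit: "run ?loop (st [\<Phi>, Node (Node r p) S, f]) ((2 ^ (dec_nat r + 1) - 1) * (B + 8) + T) s"
    if "\<And>p'. p' \<in> guesses r p \<Longrightarrow> poly pl (height (Node \<Phi> p')) \<le> B"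
      "run ?loop (st [\<Phi>, S, if \<exists>p'\<in>guesses r p. lf \<Phi> p' \<noteq> Leaf then tt else f]) T s"
    for \<Phi> r p S f B T s
    using that
  proof (induction r arbitrary: p S f T)
    case Leaf
    let ?v = "Node \<Phi> p" and ?st = "Node (Node Leaf p) S"
    let ?f = "if lf \<Phi> p \<noteq> Leaf then tt else f"
    have "run ?leaf (st [\<Phi>, ?st, f]) (1 + (B + (2 + (1 + 1)))) (st [\<Phi>, S, ?f])"
    proof (intro run_Seq)
      show "run (Assign 3 (Pair (Var 0) (Tl (Hd (Var 1))))) (st [\<Phi>, ?st, f]) 1 (st [\<Phi>, ?st, f, ?v])"
        using run_new_st[of 3 "[\<Phi>, ?st, f]" ?v "Pair (Var 0) (Tl (Hd (Var 1)))"] by (simp add: st_def)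
      show "run (shift 3 Ql) (st [\<Phi>, ?st, f, ?v]) B (st [\<Phi>, ?st, f, lf \<Phi> p])"
        by (rule run_mono[OF run_shift_st[OF Ql, of _ "[\<Phi>, ?st, f]" ?v _ _ "height ?v"]]) (use Leaf(1) in auto)
      show "run (Cond (Var 3) (Assign 2 (Pair Lf Lf)) Skip) (st [\<Phi>, ?st, f, lf \<Phi> p]) 2 (st [\<Phi>, ?st, ?f, lf \<Phi> p])"
      proof (cases "lf \<Phi> p = Leaf")
        case True
        then have "run (Cond (Var 3) (Assign 2 (Pair Lf Lf)) Skip) (st [\<Phi>, ?st, f, lf \<Phi> p]) (1 + 1) (st [\<Phi>, ?st, f, lf \<Phi> p])"
          by (intro run_CondFalse run_Skip) (simp add: st_nth)
        with True show ?thesis by (simp add: numeral_2_eq_2)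
      next
        case False
        have "run (Assign 2 (Pair Lf Lf)) (st [\<Phi>, ?st, f, lf \<Phi> p]) 1 (st [\<Phi>, ?st, tt, lf \<Phi> p])"
          by (rule run_Assign_st) (auto simp: tt_def)
        then have "run (Cond (Var 3) (Assign 2 (Pair Lf Lf)) Skip) (st [\<Phi>, ?st, f, lf \<Phi> p]) (1 + 1) (st [\<Phi>, ?st, tt, lf \<Phi> p])"
          using False by (intro run_CondTrue) (simp_all add: st_nth)
        with False show ?thesis by (simp add: numeral_2_eq_2)
      qed
      show "run (Assign 3 Lf) (st [\<Phi>, ?st, ?f, lf \<Phi> p]) 1 (st [\<Phi>, ?st, ?f])"
        by (subst st_drop_Leaf4[symmetric]) (rule run_Assign_st, auto)
      show "run (Assign 1 (Tl (Var 1))) (st [\<Phi>, ?st, ?f]) 1 (st [\<Phi>, S, ?f])"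
        by (rule run_Assign_st) (auto simp: st_nth)
    qed
    then have "run ?body (st [\<Phi>, ?st, f]) (1 + (1 + (B + (2 + (1 + 1))))) (st [\<Phi>, S, ?f])"
      by (intro run_CondFalse) (simp_all add: st_nth)
    from run_mono[OF run_WhileTrue[OF _ this, of "Var 1"], of T s "(2 ^ (dec_nat Leaf + 1) - 1) * (B + 8) + T"] Leaf(2)
    show ?case by (simp add: st_nth)
  next
    case (Node a r)
    let ?p0 = "Node (Node a Leaf) p" and ?p1 = "Node (Node a tt) p"
    let ?S = "Node (Node r ?p1) S"
    let ?f0 = "if \<exists>p'\<in>guesses r ?p0. lf \<Phi> p' \<noteq> Leaf then tt else f"
    let ?f1 = "if \<exists>p'\<in>guesses r ?p1. lf \<Phi> p' \<noteq> Leaf then tt else ?f0"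
    have f1: "?f1 = (if \<exists>p'\<in>guesses (Node a r) p. lf \<Phi> p' \<noteq> Leaf then tt else f)" by auto
    have "run ?split (st [\<Phi>, Node (Node (Node a r) p) S, f]) 1 (st [\<Phi>, Node (Node r ?p0) ?S, f])"
      by (rule run_Assign_st) (auto simp: st_nth tt_def)
    then have 1: "run ?body (st [\<Phi>, Node (Node (Node a r) p) S, f]) (1 + 1) (st [\<Phi>, Node (Node r ?p0) ?S, f])"
      by (intro run_CondTrue) (simp_all add: st_nth)
    let ?N = "(2 ^ (dec_nat r + 1) - 1) * (B + 8)"
    have 2: "run ?loop (st [\<Phi>, ?S, ?f0]) (?N + T) s"
      by (rule Node.IH(2)) (use Node.prems f1 in auto)
    have 3: "run ?loop (st [\<Phi>, Node (Node r ?p0) ?S, f]) (?N + (?N + T)) s"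
      by (rule Node.IH(2)) (use Node.prems 2 in auto)
    have "run ?loop (st [\<Phi>, Node (Node (Node a r) p) S, f]) (1 + (1 + 1) + (?N + (?N + T))) s"
      by (rule run_WhileTrue[OF _ 1 3]) (simp add: st_nth)
    moreover have "1 + (1 + 1) + (?N + (?N + T)) \<le> (2 ^ (dec_nat (Node a r) + 1) - 1) * (B + 8) + T"
    proof -
      obtain z :: nat where z: "2 ^ (dec_nat r + 1) = Suc z" by (metis Suc_pred' zero_less_numeral zero_less_power)
      have "(2 :: nat) ^ (dec_nat (Node a r) + 1) = 2 * Suc z" using z by simp
      then show ?thesis unfolding z by (simp add: algebra_simps)
    qed
    ultimately show ?case by (rule run_mono)
  qed
  define h where "h = [:1, 1:] + (2 * hr + hr + [:2:])"
  define g where "g = pr + 2 * (pcompose pl h + [:8:]) + [:5:]"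
  have "\<exists>s. run ?Q (init \<Phi>) (2 ^ dec_nat (rf \<Phi>) * poly g (height \<Phi>)) s \<and>
    (s 0 \<noteq> Leaf \<longleftrightarrow> (\<exists>p\<in>guesses (rf \<Phi>) Leaf. lf \<Phi> p \<noteq> Leaf))" for \<Phi>
  proof -
    let ?r = "rf \<Phi>" and ?B = "poly pl (poly h (height \<Phi>))"
    let ?f = "if \<exists>p'\<in>guesses ?r Leaf. lf \<Phi> p' \<noteq> Leaf then tt else Leaf"
    let ?T = "(2 ^ (dec_nat ?r + 1) - 1) * (?B + 8) + 1"
    have B: "poly pl (height (Node \<Phi> p')) \<le> ?B" if "p' \<in> guesses ?r Leaf" for p'
    proof (rule poly_nat_mono)
      have "height p' \<le> 2 * dec_nat ?r + height ?r + 2" using guesses_height[OF that] by simp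
      also have "\<dots> \<le> 2 * poly hr (height \<Phi>) + poly hr (height \<Phi>) + 2"
        using hr[of \<Phi>] dec_nat_le_height[of ?r] by simp
      finally show "height (Node \<Phi> p') \<le> poly h (height \<Phi>)" by (simp add: h_def)
    qed
    have fin: "run ?loop (st [\<Phi>, Leaf, ?f]) 1 (st [\<Phi>, Leaf, ?f])"
      by (rule run_WhileFalse) (simp add: st_nth)
    have "run ?Q (init \<Phi>) (1 + (poly pr (height \<Phi>) + (1 + (?T + 1)))) (st [?f, Leaf, ?f])"
    proof (intro run_Seq)
      show "run (Assign 1 (Var 0)) (init \<Phi>) 1 (st [\<Phi>, \<Phi>])"
        using run_new_st[of 1 "[\<Phi>]" \<Phi> "Var 0"] by (simp add: st_def init_conv_st)
      show "run (shift 1 Qr) (st [\<Phi>, \<Phi>]) (poly pr (height \<Phi>)) (st [\<Phi>, ?r])"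
        by (rule run_shift_st[OF Qr, of _ "[\<Phi>]"]) auto
      show "run (Assign 1 (Pair (Pair (Var 1) Lf) Lf)) (st [\<Phi>, ?r]) 1 (st [\<Phi>, Node (Node ?r Leaf) Leaf])"
        by (rule run_Assign_st) (auto simp: st_nth)
      show "run ?loop (st [\<Phi>, Node (Node ?r Leaf) Leaf]) ?T (st [\<Phi>, Leaf, ?f])"
        using visit[OF B fin] by (simp add: st_drop_Leaf)
      show "run (Assign 0 (Var 2)) (st [\<Phi>, Leaf, ?f]) 1 (st [?f, Leaf, ?f])"
        by (rule run_Assign_st) (auto simp: st_nth)
    qed
    moreover have "1 + (poly pr (height \<Phi>) + (1 + (?T + 1))) \<le> 2 ^ dec_nat ?r * poly g (height \<Phi>)"
    proof -
      have "?T + 3 \<le> 2 ^ dec_nat ?r * (2 * (?B + 8) + 4)"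
      proof -
        have "?T \<le> 2 ^ dec_nat ?r * (2 * (?B + 8)) + 1"
        proof -
          have "(2 ^ (dec_nat ?r + 1) - 1) * (?B + 8) \<le> 2 ^ (dec_nat ?r + 1) * (?B + 8)"
            by (intro mult_right_mono) auto
          also have "\<dots> = 2 ^ dec_nat ?r * (2 * (?B + 8))"
            by (simp only: power_add power_one_right mult.assoc)
          finally show ?thesis by (rule add_right_mono)
        qed
        moreover have "4 \<le> 2 ^ dec_nat ?r * (4 :: nat)" by simp
        ultimately show ?thesis unfolding distrib_left by linarith
      qed
      moreover have "poly pr (height \<Phi>) \<le> 2 ^ dec_nat ?r * poly pr (height \<Phi>)" by simp
      moreover have "2 ^ dec_nat ?r * (poly pr (height \<Phi>) + (2 * (?B + 8) + 4)) \<le> 2 ^ dec_nat ?r * poly g (height \<Phi>)"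
        by (intro mult_left_mono) (auto simp: g_def poly_pcompose)
      ultimately show ?thesis unfolding distrib_left by linarith
    qed
    moreover have "st [?f, Leaf, ?f] 0 \<noteq> Leaf \<longleftrightarrow> (\<exists>p\<in>guesses ?r Leaf. lf \<Phi> p \<noteq> Leaf)"
      by (simp add: st_nth)
    ultimately show ?thesis using run_mono by blast
  qed
  then show ?thesis by blast
qed

lemma poly_less_exponential:
  fixes g :: "nat poly"
  assumes "a > 0"
  shows "\<forall>\<^sub>F m in sequentially. real (poly g m) < exp (a * real m)"
proof -
  have pw: "(\<lambda>m. real m ^ k * exp (- (a * real m))) \<longlonglongrightarrow> 0" for k
  proof -
    have "filterlim (\<lambda>m. a * real m) at_top sequentially"
      using assms by (intro filterlim_tendsto_pos_mult_at_top[OF tendsto_const] filterlim_real_sequentially)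
    from filterlim_compose[OF tendsto_power_div_exp_0 this, of k]
    have "(\<lambda>m. (1 / a ^ k) * ((a * real m) ^ k / exp (a * real m))) \<longlonglongrightarrow> (1 / a ^ k) * 0"
      by (intro tendsto_mult tendsto_const)
    moreover have "(1 / a ^ k) * ((a * real m) ^ k / exp (a * real m)) = real m ^ k * exp (- (a * real m))" for m
      using assms by (simp add: power_mult_distrib exp_minus field_simps)
    ultimately show ?thesis by simp
  qed
  \<comment> \<open>The additional power of m lets the induction over the coefficients go
    through.\<close>
  have "(\<lambda>m. real m ^ k * real (poly g m) * exp (- (a * real m))) \<longlonglongrightarrow> 0" for k
  proof (induction g arbitrary: k)
    case (pCons c g)
    have "(\<lambda>m. real c * (real m ^ k * exp (- (a * real m))) + real m ^ Suc k * real (poly g m) * exp (- (a * real m))) \<longlonglongrightarrow> real c * 0 + 0"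
      by (intro tendsto_add tendsto_mult tendsto_const pw pCons.IH)
    then show ?case by (simp add: algebra_simps)
  qed simp
  from this[of 0] have "\<forall>\<^sub>F m in sequentially. real (poly g m) * exp (- (a * real m)) < 1"
    by (intro order_tendstoD(2)[of _ 0]) simp_all
  then show ?thesis
    by (rule eventually_mono) (simp add: exp_minus field_simps)
qed

lemma exec_queries_le: "exec orc P s t q s' \<Longrightarrow> q \<le> t"
  by (induction rule: exec.induct) auto

section \<open>The subexponential algorithm\<close>

definition occ_count :: "formula \<Rightarrow> nat \<Rightarrow> nat" where
  "occ_count \<phi> x = length (filter (\<lambda>c. x \<in> clause_vars c) \<phi>)"

lemma card_clause_vars: "card (clause_vars c) \<le> 3"
  unfolding clause_vars_lits using card_image_le[of "lits c" var_of] card_lits[of c] by simp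

lemma sum_occ_count: "(\<Sum>x<n. occ_count \<phi> x) \<le> 3 * length \<phi>"
proof (induction \<phi>)
  case (Cons c \<phi>)
  have "(\<Sum>x<n. occ_count (c # \<phi>) x) = (\<Sum>x<n. of_bool (x \<in> clause_vars c) + occ_count \<phi> x)"
    by (rule sum.cong) (auto simp: occ_count_def)
  also have "\<dots> = card ({..<n} \<inter> clause_vars c) + (\<Sum>x<n. occ_count \<phi> x)"
    by (simp add: sum.distrib of_bool_def sum.If_cases)
  also have "card ({..<n} \<inter> clause_vars c) \<le> card (clause_vars c)"
    by (rule card_mono) (auto simp: clause_vars_lits)
  finally show ?case using Cons card_clause_vars[of c] by simp
qed (simp add: occ_count_def)

lemma length_concat_if:
  "length (concat (map (\<lambda>c. dec_list (if Q c then Leaf else tt)) xs)) = length (filter (\<lambda>c. \<not> Q c) xs)"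
  by (induction xs) auto

lemma dec_list_theavy:
  "dec_list (theavy D (enc_formula \<phi>)) =
     map (Node Leaf) (filter (\<lambda>x. D < occ_count \<phi> (dec_nat x)) (dec_list (tvars (enc_formula \<phi>))))"
proof -
  let ?M = "\<lambda>x. cmap (\<lambda>c. if tex (\<lambda>l. teq (tail l) x) c = Leaf then Leaf else tt) (enc_formula \<phi>)"
  have tex: "tex (\<lambda>l. teq (tail l) x) (enc_clause c) = Leaf \<longleftrightarrow> dec_nat x \<notin> clause_vars c" for x c
    unfolding tex_iff set_enc_clause clause_vars_lits teq_iff by (force simp: image_iff)
  have "length (dec_list (?M x)) = occ_count \<phi> (dec_nat x)" for x
    unfolding dec_list_cmap dec_list_enc_formula map_map comp_def length_concat_if tex occ_count_def by simp
  then have "drp (enc_nat D) (?M x) = Leaf \<longleftrightarrow> \<not> D < occ_count \<phi> (dec_nat x)" for x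
    by (simp only: drp_def list_tree_eq_Leaf drop_eq_Nil dec_enc_nat not_less)
  moreover have "concat (map (\<lambda>x. dec_list (if Q x then Leaf else Node (Node Leaf x) Leaf)) xs) =
      map (Node Leaf) (filter (\<lambda>x. \<not> Q x) xs)" for Q xs
    by (induction xs) auto
  ultimately show ?thesis unfolding theavy_def dec_list_cmap by simp
qed

text \<open>A clause has at most three variables, so all occurrences sum up to at most 3 m, and
  every heavy variable accounts for at least D + 1 of them.\<close>

lemma length_theavy: "(D + 1) * length (dec_list (theavy D (enc_formula \<phi>))) \<le> 3 * length \<phi>"
proof -
  let ?n = "4 * length \<phi>"
  have "length (dec_list (theavy D (enc_formula \<phi>))) =
      length (filter (\<lambda>x. D < occ_count \<phi> x) (map dec_nat (dec_list (tvars (enc_formula \<phi>)))))"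
    by (simp add: dec_list_theavy filter_map comp_def)
  also have "\<dots> = card (set (filter (\<lambda>x. D < occ_count \<phi> x) (rev [0..<?n])))"
    unfolding tvars by (rule distinct_card[symmetric]) simp
  also have "set (filter (\<lambda>x. D < occ_count \<phi> x) (rev [0..<?n])) = {x \<in> {..<?n}. D < occ_count \<phi> x}" by auto
  finally have "(D + 1) * length (dec_list (theavy D (enc_formula \<phi>))) = (\<Sum>x\<in>{x \<in> {..<?n}. D < occ_count \<phi> x}. D + 1)"
    by simp
  also have "\<dots> \<le> (\<Sum>x\<in>{x \<in> {..<?n}. D < occ_count \<phi> x}. occ_count \<phi> x)" by (rule sum_mono) auto
  also have "\<dots> \<le> (\<Sum>x<?n. occ_count \<phi> x)" by (rule sum_mono2) auto
  also have "\<dots> \<le> 3 * length \<phi>" by (rule sum_occ_count)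
  finally show ?thesis .
qed

lemma dec_list_enc_nat: "dec_list (enc_nat n) = replicate n Leaf"
  by (simp add: enc_nat_def)

lemma dec_list_tadvice:
  assumes "k > 0"
  shows "dec_list (tadvice K k (enc_formula \<phi>)) = replicate (K + length \<phi> div k) Leaf"
proof -
  let ?m = "length \<phi>"
  have copies: "dec_nat (cmap (\<lambda>_. S) (enc_nat k)) = k * dec_nat S" for S
    unfolding dec_nat_def dec_list_cmap by (simp add: dec_list_enc_nat length_concat sum_list_replicate)
  have con: "concat (map (\<lambda>S. dec_list (if leq (cmap (\<lambda>_. S) (enc_nat k)) (enc_formula \<phi>) = Leaf then Leaf else tt)) xs)
     = replicate (length (filter (\<lambda>j. k * j \<le> ?m) (map dec_nat xs))) Leaf" for xs
    by (induction xs) (auto simp: copies)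
  have "length (filter (\<lambda>j. k * j \<le> ?m) (rev [1..<Suc ?m])) = card (set (filter (\<lambda>j. k * j \<le> ?m) (rev [1..<Suc ?m])))"
    by (rule distinct_card[symmetric]) simp
  also have "set (filter (\<lambda>j. k * j \<le> ?m) (rev [1..<Suc ?m])) = {1..?m div k}"
  proof -
    have "k * j \<le> ?m \<longleftrightarrow> j \<le> ?m div k" for j
      using assms by (simp add: less_eq_div_iff_mult_less_eq mult.commute)
    then have "set (filter (\<lambda>j. k * j \<le> ?m) (rev [1..<Suc ?m])) = {1..<Suc ?m} \<inter> {..?m div k}"
      by (simp only: set_filter set_rev set_upt) blast
    also have "\<dots> = {1..?m div k}"
      using div_le_dividend[of ?m k] by (auto simp del: div_le_dividend)
    finally show ?thesis .
  qed
  finally have "length (filter (\<lambda>j. k * j \<le> ?m) (rev [1..<Suc ?m])) = ?m div k" by simp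
  then show ?thesis
    unfolding tadvice_def dec_list_app dec_list_scmap con map_dec_nat_suffixes dec_nat_enc_formula
    by (simp only: dec_list_enc_nat replicate_add)
qed

lemma height_list_tree: "(\<And>x. x \<in> set xs \<Longrightarrow> height x \<le> H) \<Longrightarrow> height (list_tree xs) \<le> length xs + H"
  by (induction xs) (auto simp: le_SucI trans_le_add2)

text \<open>Names are unary, so this rests on all of them being below 3 m. It converts running times
  in the height into running times in m.\<close>

lemma height_enc_formula:
  assumes "\<And>c. c \<in> set \<phi> \<Longrightarrow> clause_vars c \<subseteq> {..<3 * length \<phi>}"
  shows "height (enc_formula \<phi>) \<le> 4 * length \<phi> + 5"
proof -
  have nat: "height (enc_nat n) \<le> n" for n
    using height_list_tree[of "replicate n Leaf" 0] by (simp add: enc_nat_def enc_list_conv)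
  have "height (enc_clause c) \<le> 3 + (3 * length \<phi> + 2)" if c: "c \<in> set \<phi>" for c
  proof -
    have lit: "height (enc_literal l) \<le> 3 * length \<phi> + 2" if "l \<in> lits c" for l
    proof -
      have "var_of l < 3 * length \<phi>" using assms[OF c] that by (auto simp: clause_vars_lits)
      then show ?thesis using nat[of "var_of l"] by (cases l) (auto simp: enc_bool_def)
    qed
    obtain l1 l2 l3 where "c = (l1, l2, l3)" by (cases c)
    then have "enc_clause c = list_tree (map enc_literal [l1, l2, l3])" by (simp add: enc_list_conv)
    moreover have "height \<dots> \<le> length (map enc_literal [l1, l2, l3]) + (3 * length \<phi> + 2)"
      by (rule height_list_tree) (use lit \<open>c = (l1, l2, l3)\<close> in auto)
    ultimately show ?thesis by simp
  qed
  then have "height (enc_formula \<phi>) \<le> length (map enc_clause \<phi>) + (3 + (3 * length \<phi> + 2))"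
    unfolding enc_formula_def enc_list_conv by (intro height_list_tree) auto
  then show ?thesis by simp
qed

lemma is_3sat_vars:
  assumes "is_3sat n m \<phi>" "c \<in> set \<phi>"
  shows "clause_vars c \<subseteq> {..<3 * length \<phi>}"
proof -
  have "card (\<Union>c\<in>set \<phi>. clause_vars c) \<le> (\<Sum>c\<in>set \<phi>. card (clause_vars c))"
    by (rule card_UN_le) simp
  also have "\<dots> \<le> (\<Sum>c\<in>set \<phi>. 3)" by (rule sum_mono) (rule card_clause_vars)
  also have "\<dots> \<le> 3 * length \<phi>" using card_length[of \<phi>] by simp
  finally have "n \<le> 3 * length \<phi>" using assms(1) by (simp add: is_3sat_def)
  moreover have "clause_vars c \<subseteq> {..<n}" using assms unfolding is_3sat_def by blast
  ultimately show ?thesis by auto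
qed

definition guess_list :: "nat \<Rightarrow> nat \<Rightarrow> nat \<Rightarrow> tree \<Rightarrow> tree" where
  "guess_list D K k \<Phi> = app (theavy D \<Phi>) (tadvice K k \<Phi>)"

text \<open>(D + 1)! is divisible by every size that has to divide \<open>R\<close>, and
  \<open>w\<close> makes \<open>R\<close> as large as desired. The later factors 15 and 8 give
  \<open>R\<close> and \<open>s\<close> their ratio.\<close>

definition scale :: "nat \<Rightarrow> nat \<Rightarrow> nat" where "scale D w = fact (D + 1) * w"

lemma valid_reductionI:
  assumes "is_3sat n m \<phi>" "w > 0" "\<And>x. card (formula_reduction.occurs \<phi> A x) \<le> D"
  shows "valid_reduction \<phi> A (15 * scale D w) (8 * scale D w)"
proof
  interpret formula_reduction \<phi> A "15 * scale D w" "8 * scale D w" .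
  show "clause_vars c \<subseteq> {..<3 * length \<phi>}" if "c \<in> set \<phi>" for c by (rule is_3sat_vars[OF assms(1) that])
  show "card (formula_reduction.I \<phi> A x) dvd 15 * scale D w" if "formula_reduction.occurs \<phi> A x \<noteq> {}" for x
  proof -
    have "finite (occurs x)" by (rule finite_subset[of _ "{..length \<phi>}"]) (auto simp: occurs_def J_def)
    moreover have "0 \<notin> occurs x" by (simp add: occurs_def J_def)
    ultimately have "card (I x) = Suc (card (occurs x))" using that by (simp add: I_def)
    then have "card (I x) dvd fact (D + 1)" using assms(3)[of x] by (intro dvd_fact) auto
    then show ?thesis by (simp add: scale_def)
  qed
  show "15 * (8 * scale D w) = 8 * (15 * scale D w)" by simp
  show "0 < 15 * scale D w" using assms(2) by (simp add: scale_def)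
qed

lemma card_occurs_light:
  assumes "\<And>x. x < 4 * length \<phi> \<Longrightarrow> A x = None \<Longrightarrow> occ_count \<phi> x \<le> D"
    and "is_3sat n m \<phi>"
  shows "card (formula_reduction.occurs \<phi> A x) \<le> D"
proof -
  interpret formula_reduction \<phi> A 0 0 .
  show ?thesis
  proof (cases "occurs x = {}")
    case False
    then obtain j where j: "j \<in> J" "x \<in> pos j \<union> neg j" by (auto simp: occurs_def)
    have occ: "x \<in> clause_vars (\<phi> ! (length \<phi> - j)) \<and> length \<phi> - j < length \<phi> \<and> A x = None"
      if "j \<in> occurs x" for j
      using that by (force simp: occurs_def J_def pos_def neg_def clause_at_def clause_vars_lits)
    have x: "x < 4 * length \<phi>" "A x = None"
      using occ[of j] j is_3sat_vars[OF assms(2), of "\<phi> ! (length \<phi> - j)"] by (auto simp: occurs_def)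
    have "card (occurs x) = card ((\<lambda>j. length \<phi> - j) ` occurs x)"
      by (rule card_image[symmetric]) (auto simp: inj_on_def occurs_def J_def)
    also have "\<dots> \<le> card {i. i < length \<phi> \<and> x \<in> clause_vars (\<phi> ! i)}"
      by (rule card_mono) (use occ in auto)
    also have "\<dots> = occ_count \<phi> x" by (simp add: occ_count_def length_filter_conv_card)
    finally show ?thesis using assms(1)[OF x] by simp
  qed simp
qed

text \<open>Every guess, right or wrong, contains a value for each heavy variable, so only light
  variables stay free.\<close>

lemma assignment_guess:
  assumes "p \<in> guesses (guess_list D K k (enc_formula \<phi>)) Leaf" "x < 4 * length \<phi>" "assignment p x = None"
  shows "occ_count \<phi> x \<le> D"
proof (rule ccontr)
  assume heavy: "\<not> occ_count \<phi> x \<le> D"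
  have "x \<in> set (map dec_nat (dec_list (tvars (enc_formula \<phi>))))" unfolding tvars using assms(2) by simp
  then obtain y where y: "y \<in> set (dec_list (tvars (enc_formula \<phi>)))" "dec_nat y = x" by auto
  then have "Node Leaf y \<in> set (dec_list (guess_list D K k (enc_formula \<phi>)))"
    using heavy by (auto simp: guess_list_def dec_list_theavy)
  then have "Node Leaf y \<in> set (map head (dec_list p))"
    using guesses_keys[OF assms(1)] by simp
  then obtain e where "e \<in> set (dec_list p)" "head e = Node Leaf y" by auto
  then have "\<exists>e\<in>set (dec_list p). head e \<noteq> Leaf \<and> dec_nat (tail (head e)) = x"
    using y(2) by (intro bexI[of _ e]) auto
  then have "assignment p x \<noteq> None" unfolding assignment_def by simp
  with assms(3) show False by simp
qed

text \<open>\<open>F\<close> stands for the clocked algorithm and \<open>U\<close> for the clock;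
  the guess doubles as the advice.\<close>

definition leaf_test :: "nat \<Rightarrow> nat \<Rightarrow> nat \<Rightarrow> (tree \<Rightarrow> tree) \<Rightarrow> (tree \<Rightarrow> tree) \<Rightarrow> tree \<Rightarrow> tree \<Rightarrow> tree" where
  "leaf_test D w c F U \<Phi> p =
     tcheck (15 * scale D w) (8 * scale D w) c \<Phi> p (tvertices D (15 * scale D w) (8 * scale D w) \<Phi> p)
       (F (Node (tgraph p (tvertices D (15 * scale D w) (8 * scale D w) \<Phi> p))
          (Node p (U (tvertices D (15 * scale D w) (8 * scale D w) \<Phi> p)))))"

lemma FP_leaf_test:
  assumes "FP F" "FP U"
  shows "FP (\<lambda>v. leaf_test D w c F U (head v) (tail v))"
  unfolding leaf_test_def
  by (intro FP_tcheck FP_tvertices FP_tgraph FP_Node FP_head FP_tail FP_id assms[THEN FP_comp])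

lemma FP_guess_list: "FP (guess_list D K k)"
  unfolding guess_list_def[abs_def] by (intro FP_app FP_theavy FP_tadvice FP_id)

lemma program_reductionI:
  assumes "is_3sat n m \<phi>" "w > 0" "p \<in> guesses (guess_list D K k (enc_formula \<phi>)) Leaf"
  shows "program_reduction \<phi> p (15 * scale D w) (8 * scale D w) D"
proof -
  have *: "card (formula_reduction.occurs \<phi> (assignment p) x) \<le> D" for x
    using card_occurs_light[OF assignment_guess[OF assms(3)] assms(1)] by blast
  interpret valid_reduction \<phi> "assignment p" "15 * scale D w" "8 * scale D w"
    by (rule valid_reductionI[OF assms(1,2) *])
  show ?thesis by unfold_locales (rule *)
qed

text \<open>Nothing is assumed about \<open>F\<close>: any output that passes the count is a
  clustering near the base value, and \<open>mistakes_lower\<close> converts it into an assignment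
  that violates at most \<gamma> m clauses.\<close>

lemma leaf_test_sound:
  assumes sat: "is_3sat n m \<phi>" and w: "w > 0"
    and p: "p \<in> guesses (guess_list D K k (enc_formula \<phi>)) Leaf"
    and c: "real c \<le> \<gamma> * (8 / 15 * (real (15 * scale D w))^2)"
    and acc: "leaf_test D w c F U (enc_formula \<phi>) p \<noteq> Leaf"
  shows "\<exists>\<sigma>. real (num_sat \<sigma> \<phi>) \<ge> (1 - \<gamma>) * m"
proof -
  let ?R = "15 * scale D w"
  interpret program_reduction \<phi> p ?R "8 * scale D w" D by (rule program_reductionI[OF sat w p])
  have m: "length \<phi> = m" using sat by (simp add: is_3sat_def)
  obtain out where "tcheck ?R (8 * scale D w) c \<Phi> p Vs out \<noteq> Leaf"
    using acc unfolding leaf_test_def by blast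
  then have le: "real (disagreements sim vertices (\<lambda>u. map dec_nat (dec_list out) ! u)) \<le> base + real c * m"
    unfolding tcheck m by blast
  let ?C = "label_partition N (\<lambda>u. map dec_nat (dec_list out) ! u)"
  have mis: "2 * mistakes N E ?C = disagreements sim vertices (\<lambda>u. map dec_nat (dec_list out) ! u)"
    by (rule mistakes_disagreements[OF sim_refl sim_commute together_label_partition])
  obtain \<sigma> where "2 * real (mistakes N E ?C) \<ge> base + 8 / 15 * (real ?R)^2 * card (unsat \<sigma>)"
    using mistakes_lower[OF label_partition] by blast
  moreover have "2 * real (mistakes N E ?C) \<le> base + real c * m"
    using le unfolding mis[symmetric] of_nat_mult of_nat_numeral .
  ultimately have "8 / 15 * (real ?R)^2 * card (unsat \<sigma>) \<le> real c * m" by linarith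
  also have "\<dots> \<le> \<gamma> * (8 / 15 * (real ?R)^2) * m" using c by (rule mult_right_mono) simp
  finally have "(8 / 15 * (real ?R)^2) * card (unsat \<sigma>) \<le> (8 / 15 * (real ?R)^2) * (\<gamma> * m)"
    by (simp only: ac_simps)
  moreover have "8 / 15 * (real ?R)^2 > 0" using R_pos by simp
  ultimately have "card (unsat \<sigma>) \<le> \<gamma> * m" by (rule mult_left_le_imp_le)
  then have "real (num_sat (extend \<sigma>) \<phi>) \<ge> (1 - \<gamma>) * m"
    using num_sat_extend[of \<sigma>] m by (simp add: algebra_simps)
  then show ?thesis by blast
qed

text \<open>The oracle's answers come first, since the simulated algorithm reads them off the front of the
  guess.\<close>

definition right_guess :: "nat \<Rightarrow> formula \<Rightarrow> (nat \<Rightarrow> bool) \<Rightarrow> bool list \<Rightarrow> tree" where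
  "right_guess D \<phi> \<sigma> bs = list_tree (map (\<lambda>c. Node Leaf (enc_bool c)) bs @
     rev (map (\<lambda>e. Node e (enc_bool (\<sigma> (dec_nat (tail e))))) (dec_list (theavy D (enc_formula \<phi>)))))"

lemma right_guess_in:
  assumes "k > 0" "length bs = K + length \<phi> div k"
  shows "right_guess D \<phi> \<sigma> bs \<in> guesses (guess_list D K k (enc_formula \<phi>)) Leaf"
proof -
  let ?h = "dec_list (theavy D (enc_formula \<phi>))"
  let ?bs = "map (\<lambda>e. \<sigma> (dec_nat (tail e))) ?h @ rev bs"
  let ?xs = "?h @ replicate (length bs) Leaf"
  have xs: "guess_list D K k (enc_formula \<phi>) = list_tree ?xs"
    using list_tree_dec[of "guess_list D K k (enc_formula \<phi>)"] assms
    by (simp add: guess_list_def dec_list_tadvice)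
  have rep: "map2 (\<lambda>a c. Node a (enc_bool c)) (replicate (length bs) Leaf) (rev bs) = map (\<lambda>c. Node Leaf (enc_bool c)) (rev bs)"
    by (rule nth_equalityI) auto
  have "map2 (\<lambda>a c. Node a (enc_bool c)) ?h (map (\<lambda>e. \<sigma> (dec_nat (tail e))) ?h) =
      map (\<lambda>e. Node e (enc_bool (\<sigma> (dec_nat (tail e))))) ?h"
    by (rule nth_equalityI) auto
  then have "map2 (\<lambda>a c. Node a (enc_bool c)) ?xs ?bs =
      map (\<lambda>e. Node e (enc_bool (\<sigma> (dec_nat (tail e))))) ?h @ map (\<lambda>c. Node Leaf (enc_bool c)) (rev bs)"
    by (simp add: rep)
  then have "right_guess D \<phi> \<sigma> bs = list_tree (rev (map2 (\<lambda>a c. Node a (enc_bool c)) ?xs ?bs) @ dec_list Leaf)"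
    by (simp add: right_guess_def rev_map)
  then show ?thesis unfolding xs using guesses_complete[of ?xs ?bs Leaf] by simp
qed

lemma assignment_right_guess:
  "assignment (right_guess D \<phi> \<sigma> bs) x =
     (if x < 4 * length \<phi> \<and> D < occ_count \<phi> x then Some (\<sigma> x) else None)"
proof -
  let ?p = "right_guess D \<phi> \<sigma> bs"
  let ?h = "filter (\<lambda>x. D < occ_count \<phi> (dec_nat x)) (dec_list (tvars (enc_formula \<phi>)))"
  have "set (map dec_nat (dec_list (tvars (enc_formula \<phi>)))) = {..<4 * length \<phi>}" unfolding tvars by auto
  then have vars: "dec_nat ` set (dec_list (tvars (enc_formula \<phi>))) = {..<4 * length \<phi>}" by simp
  have mem: "e \<in> set (dec_list ?p) \<and> head e \<noteq> Leaf \<longleftrightarrow>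
      (\<exists>y\<in>set ?h. e = Node (Node Leaf y) (enc_bool (\<sigma> (dec_nat y))))" for e
    by (auto simp: right_guess_def dec_list_theavy)
  have "(\<exists>e\<in>set (dec_list ?p). head e \<noteq> Leaf \<and> Q e) \<longleftrightarrow>
      (\<exists>y\<in>set ?h. Q (Node (Node Leaf y) (enc_bool (\<sigma> (dec_nat y)))))" for Q
    unfolding Bex_def conj_assoc[symmetric] mem by blast
  note ex = this
  have "(\<exists>y\<in>set ?h. dec_nat y = x) \<longleftrightarrow> x < 4 * length \<phi> \<and> D < occ_count \<phi> x"
  proof -
    have "x < 4 * length \<phi> \<longleftrightarrow> (\<exists>y\<in>set (dec_list (tvars (enc_formula \<phi>))). dec_nat y = x)"
      using vars by (metis (no_types, lifting) imageE imageI lessThan_iff)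
    then show ?thesis by auto
  qed
  moreover have "(\<exists>y\<in>set ?h. dec_nat y = x \<and> enc_bool (\<sigma> (dec_nat y)) \<noteq> Leaf) \<longleftrightarrow>
      (\<exists>y\<in>set ?h. dec_nat y = x) \<and> \<sigma> x"
    by (auto simp: enc_bool_def)
  ultimately show ?thesis
    unfolding assignment_def ex by (simp add: ex[where Q = "\<lambda>e. dec_nat (tail (head e)) = x \<and> tail e \<noteq> Leaf"])
qed

text \<open>The successful guess consists of the values of a satisfying assignment at the heavy
  variables and of the oracle's answers for one optimal clustering. The query bound is assumed only
  for instances whose size and optimum are linear in m, as the reduction produces them.\<close>

lemma leaf_test_complete:
  assumes sat: "is_3sat n m \<phi>" "satisfiable \<phi>" and w: "w > 0" and k: "k > 0"
    and approx: "cc_approximation (1 + \<gamma> / 10) P" and \<gamma>: "\<gamma> > 0"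
    and time: "\<And>N E OPT. E \<subseteq> complete_edges N \<Longrightarrow> optimal N E OPT \<Longrightarrow>
        \<exists>t q out. cc_run P N E OPT t q out \<and> t \<le> poly pP N"
    and queries: "\<And>N E OPT t q out. E \<subseteq> complete_edges N \<Longrightarrow> optimal N E OPT \<Longrightarrow>
        m \<le> C_OPT N E \<Longrightarrow> real (C_OPT N E) \<le> (8 + 77 / 30 * (real (15 * scale D w))^2) * m \<Longrightarrow>
        N \<le> (4 * ((15 * scale D w) * (15 * scale D w) + 4) + 8 * scale D w) * m \<Longrightarrow>
        cc_run P N E OPT t q out \<Longrightarrow> t \<le> poly pP N \<Longrightarrow> q \<le> K + m div k"
    and F: "\<And>orc G t q s. exec orc P (init G) t q s \<Longrightarrow>
     (\<exists>bs. length bs = q \<and> (\<forall>a c. t < dec_nat c \<longrightarrow>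
        map tail (take q (dec_list a)) = map enc_bool bs \<longrightarrow> F (Node G (Node a c)) = s 0))"
    and U: "\<And>v. dec_nat (U v) = poly (pP + 1) (dec_nat v)"
    and c: "\<gamma> / 10 * (16 + 77 / 15 * (real (15 * scale D w))^2) \<le> real c"
  shows "\<exists>p\<in>guesses (guess_list D K k (enc_formula \<phi>)) Leaf. leaf_test D w c F U (enc_formula \<phi>) p \<noteq> Leaf"
proof -
  let ?R = "15 * scale D w"
  obtain \<sigma> where \<sigma>: "\<forall>c\<in>set \<phi>. sat_clause \<sigma> c" using sat(2) by (auto simp: satisfiable_def)
  define A where "A x = (if x < 4 * length \<phi> \<and> D < occ_count \<phi> x then Some (\<sigma> x) else None)" for x
  have m: "length \<phi> = m" using sat(1) by (simp add: is_3sat_def)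
  interpret v: valid_reduction \<phi> A ?R "8 * scale D w"
    by (intro valid_reductionI[OF sat(1) w] card_occurs_light[OF _ sat(1)]) (auto simp: A_def split: if_splits)
  let ?N = v.N and ?E = v.E
  have unsat: "v.unsat \<sigma> = {}" by (rule v.unsat_empty[OF \<sigma>]) (auto simp: A_def split: if_splits)
  have sub: "?E \<subseteq> complete_edges ?N" by (rule similarity_edges_sub)
  obtain OPT where OPT: "optimal ?N ?E OPT" using optimal_exists by blast
  obtain t q out where run: "cc_run P ?N ?E OPT t q out" "t \<le> poly pP ?N" using time[OF sub OPT] by blast
  obtain t' q' out' C where app: "cc_run P ?N ?E OPT t' q' out'" "outputs_clustering ?N out' C"
    "real (mistakes ?N ?E C) \<le> (1 + \<gamma> / 10) * real (C_OPT ?N ?E)"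
    using approx sub OPT unfolding cc_approximation_def by blast
  obtain s where fin: "exec (same_cluster OPT) P (init (enc_graph ?N ?E)) t q s" "out = s 0"
    using run(1) by (auto simp: cc_run_def)
  \<comment> \<open>Time bound and approximation bound come from separate existential statements;
    determinism shows that they concern the same run.\<close>
  have out: "out' = out"
    using app(1) fin exec_deterministic unfolding cc_run_def by blast
  have opt: "2 * real (C_OPT ?N ?E) \<le> v.base" by (rule v.C_OPT_upper[OF unsat])
  have q: "q \<le> K + m div k"
  proof (rule queries[OF sub OPT _ _ _ run])
    show "m \<le> C_OPT ?N ?E" using v.C_OPT_lower[OF unsat] m by simp
    show "real (C_OPT ?N ?E) \<le> (8 + 77 / 30 * (real ?R)^2) * m"
      using opt v.base_le unfolding m by (simp add: algebra_simps)
    show "?N \<le> (4 * (?R * ?R + 4) + 8 * scale D w) * m" using v.N_le unfolding m .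
  qed
  obtain bs where bs: "length bs = q" "\<And>a c. t < dec_nat c \<Longrightarrow>
      map tail (take q (dec_list a)) = map enc_bool bs \<Longrightarrow> F (Node (enc_graph ?N ?E) (Node a c)) = s 0"
    using F[OF fin(1)] by blast
  \<comment> \<open>The answers are padded to the fixed length of the advice; the simulated run
    reads only the first \<open>q\<close> of them.\<close>
  define bs' where "bs' = bs @ replicate (K + m div k - q) False"
  define p where "p = right_guess D \<phi> \<sigma> bs'"
  have p: "p \<in> guesses (guess_list D K k (enc_formula \<phi>)) Leaf"
    unfolding p_def by (rule right_guess_in[OF k]) (use q bs(1) m in \<open>simp add: bs'_def\<close>)
  \<comment> \<open>The values stored in the guess give back \<open>A\<close>, so the instance built
    by the program is the one on which \<open>P\<close> was run.\<close>
  have asg: "assignment p = A" by (rule ext) (simp add: p_def assignment_right_guess A_def)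
  interpret program_reduction \<phi> p ?R "8 * scale D w" D by (rule program_reductionI[OF sat(1) w p])
  have N: "N = ?N" and E: "E = ?E" and base: "base = v.base"
    unfolding asg by simp_all
  have "F (Node (tgraph p Vs) (Node p (U Vs))) = out"
    unfolding tgraph N E fin(2)
  proof (rule bs(2))
    show "t < dec_nat (U Vs)" using run(2) N by (simp add: U length_Vs)
    show "map tail (take q (dec_list p)) = map enc_bool bs"
      using bs(1) by (simp add: p_def right_guess_def bs'_def comp_def)
  qed
  then have "leaf_test D w c F U (enc_formula \<phi>) p = tcheck ?R (8 * scale D w) c \<Phi> p Vs out"
    by (simp add: leaf_test_def)
  moreover have "tcheck ?R (8 * scale D w) c \<Phi> p Vs out \<noteq> Leaf"
    unfolding tcheck
  proof
    have oc: "length (map dec_nat (dec_list out)) = N" "C = label_partition N (\<lambda>u. map dec_nat (dec_list out) ! u)"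
      using app(2) unfolding out outputs_clustering_def label_partition_def Let_def N by auto
    show "dec_nat out = N" using oc(1) by (simp add: dec_nat_def)
    have "2 * mistakes N E C = disagreements sim vertices (\<lambda>u. map dec_nat (dec_list out) ! u)"
      unfolding oc(2) by (rule mistakes_disagreements[OF sim_refl sim_commute together_label_partition])
    then have "real (disagreements sim vertices (\<lambda>u. map dec_nat (dec_list out) ! u)) = 2 * real (mistakes N E C)"
      by (simp only: of_nat_mult of_nat_numeral flip: \<open>2 * mistakes N E C = _\<close>)
    also have "\<dots> \<le> (1 + \<gamma> / 10) * (2 * real (C_OPT N E))" using app(3) unfolding N E by simp
    also have "\<dots> \<le> (1 + \<gamma> / 10) * base" using opt \<gamma> unfolding N E base by (intro mult_left_mono) auto
    also have "\<dots> = base + \<gamma> / 10 * base" by (simp add: algebra_simps)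
    also have "\<gamma> / 10 * base \<le> \<gamma> / 10 * ((16 + 77 / 15 * (real ?R)^2) * length \<phi>)"
      using base_le \<gamma> by (intro mult_left_mono) auto
    also have "\<dots> = (\<gamma> / 10 * (16 + 77 / 15 * (real ?R)^2)) * length \<phi>" by (rule mult.assoc[symmetric])
    also have "\<dots> \<le> real c * length \<phi>" using c by (rule mult_right_mono) simp
    finally show "real (disagreements sim vertices (\<lambda>u. map dec_nat (dec_list out) ! u)) \<le> base + real c * length \<phi>"
      by simp
  qed
  ultimately show ?thesis using p by (intro bexI[of _ p]) auto
qed

theorem theorem3:
  fixes \<gamma> :: real
  assumes "gap_eth \<gamma>"
  shows "\<not> (\<exists>P. cc_polynomial_time P \<and> cc_approximation (1 + \<gamma> / 10) P \<and> cc_little_o_queries P)"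
proof
  assume "\<exists>P. cc_polynomial_time P \<and> cc_approximation (1 + \<gamma> / 10) P \<and> cc_little_o_queries P"
  then obtain P where poly: "cc_polynomial_time P" and approx: "cc_approximation (1 + \<gamma> / 10) P"
    and queries: "cc_little_o_queries P" by blast
  from assms obtain \<delta> where \<gamma>: "\<gamma> > 0" and \<delta>: "\<delta> > 0"
    and eth: "\<And>Q. distinguishes \<gamma> Q \<Longrightarrow> \<exists>\<^sub>F m in sequentially. \<exists>n \<phi> t out.
           is_3sat n m \<phi> \<and> sat_run Q \<phi> t out \<and> real t \<ge> 2 powr (\<delta> * real m)"
    unfolding gap_eth_def by blast
  obtain pP where pP: "\<And>N E OPT. E \<subseteq> complete_edges N \<Longrightarrow> optimal N E OPT \<Longrightarrow>
        \<exists>t q out. cc_run P N E OPT t q out \<and> t \<le> poly pP N"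
    using poly unfolding cc_polynomial_time_def by blast
  \<comment> \<open>Heavy variables then contribute at most \<delta>/4 m guessed bits; by the choice
    of \<open>k\<close> so do the oracle's answers, up to a constant.\<close>
  obtain D :: nat where "12 / \<delta> \<le> real D" using real_arch_simple by blast
  then have D: "3 / (real D + 1) \<le> \<delta> / 4" using \<delta> by (simp add: field_simps)
  obtain k :: nat where "4 / \<delta> \<le> real k" using real_arch_simple by blast
  moreover have "4 / \<delta> > 0" using \<delta> by simp
  ultimately have "real k > 0" "4 / \<delta> \<le> real k" by linarith+
  then have k: "k > 0" "1 / real k \<le> \<delta> / 4" using \<delta> by (simp_all add: field_simps)
  \<comment> \<open>The margin is 8/15 - 77/150 = 1/50 of \<gamma> R^2. It has to absorb 16/10
    \<gamma> from the idle grids and 1 from rounding \<open>c\<close> up, so R^2 \<ge> 50/\<gamma> +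
    100 is enough.\<close>
  obtain w :: nat where w: "50 * (1 / \<gamma> + 2) \<le> real w" using real_arch_simple by blast
  have "50 * (1 / \<gamma> + 2) > 0" using \<gamma> by (simp add: add_pos_pos)
  then have "real w > 0" using w by linarith
  then have w0: "w > 0" by simp
  define R where "R = real (15 * scale D w)"
  have "w * 1 \<le> 15 * scale D w"
    unfolding scale_def by (simp add: mult.commute Suc_le_eq)
  then have Rw: "R \<ge> w" "R \<ge> 1" using w0 by (simp_all add: R_def)
  then have "R * 1 \<le> R * R" by (intro mult_left_mono) auto
  then have "50 * (1 / \<gamma> + 2) \<le> R^2" using w Rw unfolding power2_eq_square by linarith
  then have "\<gamma> * (50 * (1 / \<gamma> + 2)) \<le> \<gamma> * R^2" using \<gamma> by (intro mult_left_mono) auto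
  then have "50 + 100 * \<gamma> \<le> \<gamma> * R^2" using \<gamma> by (simp add: algebra_simps)
  then have gap: "\<gamma> / 10 * (16 + 77 / 15 * R^2) + 1 \<le> \<gamma> * (8 / 15 * R^2)"
    using \<gamma> by (simp add: algebra_simps)
  define c where "c = nat \<lceil>\<gamma> / 10 * (16 + 77 / 15 * R^2)\<rceil>"
  have "\<gamma> / 10 * (16 + 77 / 15 * R^2) \<ge> 0" using \<gamma> by simp
  then have c: "\<gamma> / 10 * (16 + 77 / 15 * R^2) \<le> real c" "real c \<le> \<gamma> / 10 * (16 + 77 / 15 * R^2) + 1"
    unfolding c_def by linarith+
  define B where "B = 8 + 77 / 30 * R^2"
  have B: "B > 0" unfolding B_def by (simp add: add_pos_nonneg)
  \<comment> \<open>As the optimum is at most B m, this choice of \<epsilon> turns the query bound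
    into q \<le> m/k.\<close>
  obtain K0 where K0: "\<And>N E OPT t q out. E \<subseteq> complete_edges N \<Longrightarrow> optimal N E OPT \<Longrightarrow>
        K0 \<le> C_OPT N E \<Longrightarrow> cc_run P N E OPT t q out \<Longrightarrow> real q \<le> 1 / (real k * B) * real (C_OPT N E)"
  proof -
    have "1 / (real k * B) > 0" using k(1) B by simp
    then obtain K0 where "\<forall>N E OPT t q out. E \<subseteq> complete_edges N \<longrightarrow> optimal N E OPT \<longrightarrow>
        K0 \<le> C_OPT N E \<longrightarrow> cc_run P N E OPT t q out \<longrightarrow> real q \<le> 1 / (real k * B) * real (C_OPT N E)"
      using queries unfolding cc_little_o_queries_def by blast
    then show ?thesis by (intro that) blast
  qed
  \<comment> \<open>If the optimum is below \<open>K0\<close>, then so is m. The instance then has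
    at most M K0 vertices, and its running time bounds the queries by the constant
    \<open>K\<close>.\<close>
  define M where "M = 4 * ((15 * scale D w) * (15 * scale D w) + 4) + 8 * scale D w"
  define K where "K = poly pP (M * K0)"
  obtain F where F: "FP F" "\<And>orc G t q s. exec orc P (init G) t q s \<Longrightarrow>
     (\<exists>bs. length bs = q \<and> (\<forall>a c. t < dec_nat c \<longrightarrow>
        map tail (take q (dec_list a)) = map enc_bool bs \<longrightarrow> F (Node G (Node a c)) = s 0))"
    using FP_clocked[of P] by blast
  obtain U where U: "FP U" "\<And>v. dec_nat (U v) = poly (pP + 1) (dec_nat v)"
    using FP_unary_poly[OF FP_id, of "pP + 1"] by blast
  obtain Q g where Q: "\<And>\<Phi>. \<exists>s. run Q (init \<Phi>) (2 ^ dec_nat (guess_list D K k \<Phi>) * Polynomial.poly g (height \<Phi>)) s \<and>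
    (s 0 \<noteq> Leaf \<longleftrightarrow> (\<exists>p\<in>guesses (guess_list D K k \<Phi>) Leaf. leaf_test D w c F U \<Phi> p \<noteq> Leaf))"
    using FP_guess[OF FP_guess_list FP_leaf_test[OF F(1) U(1)]] by blast
  have q_le: "q \<le> K + m div k"
    if "E \<subseteq> complete_edges N" "optimal N E OPT" "m \<le> C_OPT N E"
      "real (C_OPT N E) \<le> (8 + 77 / 30 * (real (15 * scale D w))^2) * m"
      "N \<le> (4 * ((15 * scale D w) * (15 * scale D w) + 4) + 8 * scale D w) * m"
      "cc_run P N E OPT t q out" "t \<le> Polynomial.poly pP N" for N E OPT t q out m
  proof (cases "K0 \<le> C_OPT N E")
    case True
    have "real q \<le> 1 / (real k * B) * real (C_OPT N E)" by (rule K0[OF that(1,2) True that(6)])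
    also have "\<dots> \<le> 1 / (real k * B) * (B * m)"
      using that(4) B unfolding B_def R_def by (intro mult_left_mono) auto
    also have "\<dots> = m / k" using B by simp
    finally have "real q * real k \<le> real m" using k(1) by (simp add: field_simps)
    then have "q * k \<le> m" by (simp only: of_nat_le_iff flip: of_nat_mult)
    then have "q \<le> m div k" using k(1) by (simp add: less_eq_div_iff_mult_less_eq)
    then show ?thesis by simp
  next
    case False
    then have "m \<le> K0" using that(3) by simp
    have "N \<le> M * K0" using that(5) \<open>m \<le> K0\<close> unfolding M_def[symmetric] by (rule le_trans[OF _ mult_le_mono2])
    have "q \<le> t" using that(6) exec_queries_le by (auto simp: cc_run_def)
    also have "\<dots> \<le> Polynomial.poly pP (M * K0)" using that(7) poly_nat_mono[OF \<open>N \<le> M * K0\<close>] by (rule le_trans)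
    finally show ?thesis by (simp add: K_def)
  qed
  have "distinguishes \<gamma> Q"
    unfolding distinguishes_def
  proof (intro allI impI)
    fix n m \<phi> assume sat: "is_3sat n m \<phi>"
    let ?\<Phi> = "enc_formula \<phi>"
    obtain s where s: "run Q (init ?\<Phi>) (2 ^ dec_nat (guess_list D K k ?\<Phi>) * Polynomial.poly g (height ?\<Phi>)) s"
      "s 0 \<noteq> Leaf \<longleftrightarrow> (\<exists>p\<in>guesses (guess_list D K k ?\<Phi>) Leaf. leaf_test D w c F U ?\<Phi> p \<noteq> Leaf)"
      using Q[of ?\<Phi>] by blast
    obtain t where t: "sat_run Q \<phi> t (s 0)" using s(1) by (auto simp: run_def sat_run_def)
    have "s 0 \<noteq> Leaf" if "satisfiable \<phi>"
      unfolding s(2)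
      by (rule leaf_test_complete[where F = F and U = U and pP = pP and P = P, OF sat that w0 k(1) approx \<gamma>],
        erule (1) pP, rule q_le, assumption+, erule F(2), rule U(2), rule c(1)[unfolded R_def])
    moreover have "s 0 = Leaf" if all: "\<forall>\<sigma>. real (num_sat \<sigma> \<phi>) < (1 - \<gamma>) * real m"
    proof (rule ccontr)
      assume "s 0 \<noteq> Leaf"
      then obtain p where p: "p \<in> guesses (guess_list D K k ?\<Phi>) Leaf" "leaf_test D w c F U ?\<Phi> p \<noteq> Leaf"
        using s(2) by blast
      have "real c \<le> \<gamma> * (8 / 15 * (real (15 * scale D w))^2)"
        using c(2) gap unfolding R_def by linarith
      from leaf_test_sound[OF sat w0 p(1) this p(2)] obtain \<sigma> where "(1 - \<gamma>) * real m \<le> real (num_sat \<sigma> \<phi>)" ..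
      with all[rule_format, of \<sigma>] show False by simp
    qed
    ultimately show "\<exists>t out. sat_run Q \<phi> t out \<and> (satisfiable \<phi> \<longrightarrow> out \<noteq> Leaf) \<and>
        ((\<forall>\<sigma>. real (num_sat \<sigma> \<phi>) < (1 - \<gamma>) * real m) \<longrightarrow> out = Leaf)"
      using t by blast
  qed
  from eth[OF this] have freq: "\<exists>\<^sub>F m in sequentially. \<exists>n \<phi> t out.
       is_3sat n m \<phi> \<and> sat_run Q \<phi> t out \<and> real t \<ge> 2 powr (\<delta> * real m)" .
  \<comment> \<open>The substituted polynomial is the bound 4 m + 5 on the height of the
    formula.\<close>
  define h where "h = pcompose g [:5, 4:]"
  have bound: "real t \<le> 2 powr (real K + \<delta> / 2 * real m) * real (Polynomial.poly h m)"
    if sat: "is_3sat n m \<phi>" and run: "sat_run Q \<phi> t out" for n m \<phi> t out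
  proof -
    let ?\<Phi> = "enc_formula \<phi>"
    have m: "length \<phi> = m" using sat by (simp add: is_3sat_def)
    obtain s t' where t': "t' \<le> 2 ^ dec_nat (guess_list D K k ?\<Phi>) * Polynomial.poly g (height ?\<Phi>)"
      "exec (\<lambda>_ _. False) Q (init ?\<Phi>) t' 0 s"
      using Q[of ?\<Phi>] by (auto simp: run_def)
    have "t = t'" using run t'(2) exec_deterministic unfolding sat_run_def by blast
    have "height ?\<Phi> \<le> 4 * m + 5" using height_enc_formula[OF is_3sat_vars[OF sat]] m by simp
    then have "Polynomial.poly g (height ?\<Phi>) \<le> Polynomial.poly h m"
      unfolding h_def poly_pcompose using poly_nat_mono[of "height ?\<Phi>" "4 * m + 5" g]
      by (simp add: add.commute mult.commute)
    then have "t \<le> 2 ^ dec_nat (guess_list D K k ?\<Phi>) * Polynomial.poly h m"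
      unfolding \<open>t = t'\<close> by (rule le_trans[OF t'(1) mult_le_mono2])
    then have "real t \<le> real (2 ^ dec_nat (guess_list D K k ?\<Phi>) * Polynomial.poly h m)" by (rule of_nat_mono)
    also have "\<dots> = 2 powr real (dec_nat (guess_list D K k ?\<Phi>)) * real (Polynomial.poly h m)"
      by (simp add: powr_realpow)
    also have "\<dots> \<le> 2 powr (real K + \<delta> / 2 * real m) * real (Polynomial.poly h m)"
    proof (intro mult_right_mono powr_mono)
      let ?h = "length (dec_list (theavy D ?\<Phi>))"
      have len: "dec_nat (guess_list D K k ?\<Phi>) = ?h + (K + m div k)"
        using k(1) m by (simp add: guess_list_def dec_nat_def dec_list_tadvice)
      have "(D + 1) * ?h \<le> 3 * m" using length_theavy[of D \<phi>] m by simp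
      then have "real ((D + 1) * ?h) \<le> real (3 * m)" by (rule of_nat_mono)
      then have "real ?h \<le> 3 / (real D + 1) * m" by (simp add: field_simps)
      also have "\<dots> \<le> \<delta> / 4 * m" using D by (rule mult_right_mono) simp
      finally have 1: "real ?h \<le> \<delta> / 4 * m" .
      have "real (m div k) \<le> 1 / real k * m" using of_nat_div_le_of_nat[of m k] by simp
      also have "\<dots> \<le> \<delta> / 4 * m" using k(2) by (rule mult_right_mono) simp
      finally have 2: "real (m div k) \<le> \<delta> / 4 * m" .
      show "real (dec_nat (guess_list D K k ?\<Phi>)) \<le> real K + \<delta> / 2 * real m"
        unfolding len using 1 2 by simp
    qed simp_all
    finally show ?thesis .
  qed
  \<comment> \<open>The guesses use up half of the exponent \<delta> m; the other half outgrows the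
    polynomial and the constant factor.\<close>
  have "\<forall>\<^sub>F m in sequentially. 2 powr (real K + \<delta> / 2 * real m) * real (Polynomial.poly h m) < 2 powr (\<delta> * real m)"
  proof -
    have "\<forall>\<^sub>F m in sequentially. real (Polynomial.poly (smult (2 ^ K) h) m) < exp (\<delta> / 2 * ln 2 * real m)"
      using \<delta> by (intro poly_less_exponential) simp
    then show ?thesis
    proof (rule eventually_mono)
      fix m assume "real (Polynomial.poly (smult (2 ^ K) h) m) < exp (\<delta> / 2 * ln 2 * real m)"
      then have less: "2 ^ K * real (Polynomial.poly h m) < 2 powr (\<delta> / 2 * real m)"
        by (simp add: powr_def ac_simps)
      have "2 powr (real K + \<delta> / 2 * real m) * real (Polynomial.poly h m) =
          2 powr (\<delta> / 2 * real m) * (2 ^ K * real (Polynomial.poly h m))"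
        by (simp add: powr_add powr_realpow)
      also have "\<dots> < 2 powr (\<delta> / 2 * real m) * 2 powr (\<delta> / 2 * real m)"
        using less by (rule mult_strict_left_mono) simp
      also have "\<dots> = 2 powr (\<delta> * real m)" by (simp flip: powr_add)
      finally show "2 powr (real K + \<delta> / 2 * real m) * real (Polynomial.poly h m) < 2 powr (\<delta> * real m)" .
    qed
  qed
  with freq have "\<exists>\<^sub>F m in sequentially. False"
  proof (rule frequently_rev_mp[OF _ eventually_mono])
    fix m assume less: "2 powr (real K + \<delta> / 2 * real m) * real (Polynomial.poly h m) < 2 powr (\<delta> * real m)"
    show "(\<exists>n \<phi> t out. is_3sat n m \<phi> \<and> sat_run Q \<phi> t out \<and> real t \<ge> 2 powr (\<delta> * real m)) \<longrightarrow> False"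
    proof (intro impI, elim exE conjE)
      fix n \<phi> t out
      assume "is_3sat n m \<phi>" "sat_run Q \<phi> t out" "2 powr (\<delta> * real m) \<le> real t"
      from bound[OF this(1,2)] this(3) less show False by linarith
    qed
  qed
  then show False by simp
qed

end
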